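(* Let $A>0$, and let $\alpha,\beta\in\mathbb{R}$ satisfy $\alpha\le\beta\le 1$, $\beta>0$, $\alpha<1$. Let $a_{i,j}=A(i^\alpha j^\beta+i^\beta j^\alpha)$ for $i,j\ge1$, and let $(B_{j,k}^i)$ be a daughter distribution function satisfying conditions (B1), (B2), (B3) of the context (with constants $\epsilon_m\in(0,1)$, $\kappa_m\ge1$, $m>1$, in (B2)). Given $w^{\rm in}\in Y_1^+$, there is at least one mass-conserving solution $w$ on $[0,+\infty)$ to the discrete collision-induced breakage equation with initial condition $w^{\rm in}$ such that $$M_0(w(t))\ge M_0(w^{\rm in}),\qquad t\ge0,$$ and, for any $m>1$ and $t>0$, $w(t)\in Y_m$ with $$M_m(w(t))\le F_m\Big(1+\frac1t\Big)^{\frac{m-1}{\beta}},$$ where $F_m$ is a positive constant depending only on $m$, $A$, $\alpha$, $\beta$, $\epsilon_m$, $\kappa_m$, $M_1(w^{\rm in})$ and $M_0(w^{\rm in})$. In addition, for every $m>1$ and $\rho_1\ge\rho_0>0$, there is $\mu_m>0$ depending only on $m$, $A$, $\alpha$, $\beta$, $\epsilon_m$, $\kappa_m$, $\rho_1$ and $\rho_0$ such that, if $w^{\rm in}\in Y_m$ with $M_1(w^{\rm in})\le\rho_1$ and $M_0(w^{\rm in})\ge\rho_0$, then this solution satisfies $$M_m(w(t))\le\max\{M_m(w^{\rm in}),\mu_m\},\qquad t>0.$$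
   Context: Spaces and moments. For $\gamma\ge0$, $Y_\gamma$ is the Banach space of real sequences $y=(y_i)_{i\ge1}$ with $\|y\|_\gamma=\sum_{i\ge1}i^\gamma|y_i|<\infty$, and $Y_\gamma^+=\{y\in Y_\gamma: y_i\ge0 \text{ for all } i\ge 1\}$. For a non-negative sequence $w$, $M_\gamma(w)=\sum_{i\ge1}i^\gamma w_i$. Equation. The discrete collision-induced breakage equation with initial condition $w^{\rm in}$ is, for $i\ge1$, $$\frac{dw_i}{dt}=\frac12\sum_{j=i+1}^\infty\sum_{k=1}^{j-1}B_{j-k,k}^i\,a_{j-k,k}\,w_{j-k}w_k-\sum_{j=1}^\infty a_{i,j}w_iw_j,\qquad w_i(0)=w_i^{\rm in}.$$ Conditions on the daughter distribution function $(B_{i,j}^s)$, $i,j,s\ge1$: (B1) for all $i,j\ge1$: $B_{i,j}^s=B_{j,i}^s\ge0$ for $1\le s\le i+j-1$, $B_{i,j}^s=0$ for $s\ge i+j$, and $\sum_{s=1}^{i+j-1}sB_{i,j}^s=i+j$; (B2) for each $m>1$ there are constants $\epsilon_m\in(0,1)$ and $\kappa_m\ge1$ such that, for all $j,k\ge1$, $\sum_{i=1}^{j+k-1}i^mB_{j,k}^i\le(1-\epsilon_m)(j^m+k^m)+\kappa_m(jk^{m-1}+j^{m-1}k)$; (B3) $\sum_{i=1}^{j+k-1}B_{j,k}^i\ge2$ for all $j,k\ge1$. Solutions. Let $T\in(0,+\infty]$ and $w^{\rm in}\in Y_1^+$. A solution on $[0,T)$ with initial condition $w^{\rm in}$ is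 a sequence $w=(w_i)_{i\ge1}$ of non-negative continuous functions such that, for each $i\ge1$ and $t\in(0,T)$: $w_i\in C([0,t))$, $\sum_{j}a_{i,j}w_j\in L^1(0,t)$, $\sum_{j=i+1}^\infty\sum_{k=1}^{j-1}B_{j-k,k}^ia_{j-k,k}w_{j-k}w_k\in L^1(0,t)$, and $$w_i(t)=w_i^{\rm in}+\int_0^t\Big(\frac12\sum_{j=i+1}^\infty\sum_{k=1}^{j-1}B_{j-k,k}^ia_{j-k,k}w_{j-k}(\tau)w_k(\tau)-\sum_{j=1}^\infty a_{i,j}w_i(\tau)w_j(\tau)\Big)d\tau.$$ It is mass-conserving on $[0,T)$ if $M_1(w(t))=M_1(w^{\rm in})$ for all $t\in[0,T)$. *)

theory Defs
  imports "HOL-Analysis.Analysis"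
begin

text \<open>
  A real sequence (y_i), i \<ge> 1, is encoded as a function nat \<Rightarrow> real whose value at 0 is
  irrelevant: every sum and every condition below only involves indices \<ge> 1.
  A time-dependent sequence is a function w of time and index, with w t i standing for w_i(t).
\<close>

definition Y_space :: "real \<Rightarrow> (nat \<Rightarrow> real) set" where
  "Y_space \<gamma> = {y. (\<lambda>i. real i powr \<gamma> * \<bar>y i\<bar>) summable_on {1..}}"

definition Y_plus :: "real \<Rightarrow> (nat \<Rightarrow> real) set" where
  "Y_plus \<gamma> = {y \<in> Y_space \<gamma>. \<forall>i\<ge>1. 0 \<le> y i}"

text \<open>
  The real-valued sum is 0 if it diverges, so the moment of order \<gamma> of a non-negative sequence y
  is meaningful only for y in \<^term>\<open>Y_space \<gamma>\<close>.
\<close>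

definition moment :: "real \<Rightarrow> (nat \<Rightarrow> real) \<Rightarrow> real" where
  "moment \<gamma> y = (\<Sum>\<^sub>\<infinity>i\<in>{1..}. real i powr \<gamma> * y i)"

definition collision_kernel :: "real \<Rightarrow> real \<Rightarrow> real \<Rightarrow> nat \<Rightarrow> nat \<Rightarrow> real" where
  "collision_kernel A \<alpha> \<beta> i j =
     A * (real i powr \<alpha> * real j powr \<beta> + real i powr \<beta> * real j powr \<alpha>)"

text \<open>
  In the following three conditions B i j s stands for the number B with lower indices i, j and
  upper index s, the number of daughters of size s.
\<close>

definition daughter_B1 :: "(nat \<Rightarrow> nat \<Rightarrow> nat \<Rightarrow> real) \<Rightarrow> bool" where
  "daughter_B1 B \<longleftrightarrow>
     (\<forall>i\<ge>1. \<forall>j\<ge>1.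
        (\<forall>s\<in>{1..i + j - 1}. B i j s = B j i s \<and> 0 \<le> B i j s) \<and>
        (\<forall>s\<ge>i + j. B i j s = 0) \<and>
        (\<Sum>s = 1..i + j - 1. real s * B i j s) = real (i + j))"

definition daughter_B2 ::
  "(nat \<Rightarrow> nat \<Rightarrow> nat \<Rightarrow> real) \<Rightarrow> (real \<Rightarrow> real) \<Rightarrow> (real \<Rightarrow> real) \<Rightarrow> bool" where
  "daughter_B2 B \<epsilon> \<kappa> \<longleftrightarrow>
     (\<forall>m>1. 0 < \<epsilon> m \<and> \<epsilon> m < 1 \<and> 1 \<le> \<kappa> m \<and>
        (\<forall>j\<ge>1. \<forall>k\<ge>1.
           (\<Sum>i = 1..j + k - 1. real i powr m * B j k i)
             \<le> (1 - \<epsilon> m) * (real j powr m + real k powr m)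
                + \<kappa> m * (real j * real k powr (m - 1) + real j powr (m - 1) * real k)))"

definition daughter_B3 :: "(nat \<Rightarrow> nat \<Rightarrow> nat \<Rightarrow> real) \<Rightarrow> bool" where
  "daughter_B3 B \<longleftrightarrow> (\<forall>j\<ge>1. \<forall>k\<ge>1. 2 \<le> (\<Sum>i = 1..j + k - 1. B j k i))"

definition gain_term ::
  "(nat \<Rightarrow> nat \<Rightarrow> real) \<Rightarrow> (nat \<Rightarrow> nat \<Rightarrow> nat \<Rightarrow> real) \<Rightarrow> (nat \<Rightarrow> real) \<Rightarrow> nat \<Rightarrow> nat \<Rightarrow> real" where
  "gain_term a B y i j = (\<Sum>k = 1..j - 1. B (j - k) k i * a (j - k) k * y (j - k) * y k)"

text \<open>
  Membership in \<open>L\<^sup>1(0,t)\<close> of a series of non-negative functions of time, f \<tau> j being the j-th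
  term at time \<tau>.  Almost everywhere convergence is required explicitly because a divergent
  \<^term>\<open>infsum\<close> has the value 0.
\<close>

definition series_in_L1 :: "real \<Rightarrow> nat set \<Rightarrow> (real \<Rightarrow> nat \<Rightarrow> real) \<Rightarrow> bool" where
  "series_in_L1 t J f \<longleftrightarrow>
     (AE \<tau> in lborel. \<tau> \<in> {0<..<t} \<longrightarrow> f \<tau> summable_on J) \<and>
     set_integrable lborel {0<..<t} (\<lambda>\<tau>. \<Sum>\<^sub>\<infinity>j\<in>J. f \<tau> j)"

definition breakage_solution ::
  "(nat \<Rightarrow> nat \<Rightarrow> real) \<Rightarrow> (nat \<Rightarrow> nat \<Rightarrow> nat \<Rightarrow> real) \<Rightarrow> ereal \<Rightarrow> (nat \<Rightarrow> real) \<Rightarrow>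
    (real \<Rightarrow> nat \<Rightarrow> real) \<Rightarrow> bool" where
  "breakage_solution a B T w_in w \<longleftrightarrow>
     0 < T \<and> w_in \<in> Y_plus 1 \<and>
     (\<forall>i\<ge>1. \<forall>t\<ge>0. ereal t < T \<longrightarrow> 0 \<le> w t i) \<and>
     (\<forall>i\<ge>1. \<forall>t>0. ereal t < T \<longrightarrow>
        continuous_on {0..<t} (\<lambda>\<tau>. w \<tau> i) \<and>
        series_in_L1 t {1..} (\<lambda>\<tau> j. a i j * w \<tau> j) \<and>
        series_in_L1 t {i + 1..} (\<lambda>\<tau> j. gain_term a B (w \<tau>) i j) \<and>
        w t i = w_in i +
          (LBINT \<tau>:{0<..<t}.
             1 / 2 * (\<Sum>\<^sub>\<infinity>j\<in>{i + 1..}. gain_term a B (w \<tau>) i j)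
             - (\<Sum>\<^sub>\<infinity>j\<in>{1..}. a i j * w \<tau> i * w \<tau> j)))"

definition mass_conserving_solution ::
  "(nat \<Rightarrow> nat \<Rightarrow> real) \<Rightarrow> (nat \<Rightarrow> nat \<Rightarrow> nat \<Rightarrow> real) \<Rightarrow> ereal \<Rightarrow> (nat \<Rightarrow> real) \<Rightarrow>
    (real \<Rightarrow> nat \<Rightarrow> real) \<Rightarrow> bool" where
  "mass_conserving_solution a B T w_in w \<longleftrightarrow>
     breakage_solution a B T w_in w \<and>
     (\<forall>t\<ge>0. ereal t < T \<longrightarrow> w t \<in> Y_plus 1 \<and> moment 1 (w t) = moment 1 w_in)"

end

theory Submission
  imports Defs "HOL-Complex_Analysis.Great_Picard"
begin

text \<open>
  Solutions are limits of solutions of finite systems. In the \<open>N\<close>-th system only sizes up to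
  \<open>N\<close> occur, and a collision of total size larger than \<open>N\<close> produces nothing but monomers
  (\<open>shatter_above\<close>). This truncation keeps the mass, closes the system on the sizes \<open>1..N\<close>, and
  preserves the three conditions on the daughter distribution with the same constants, so that
  every a priori estimate holds uniformly in \<open>N\<close>. Suppressing the collisions of large total size
  instead would switch off the breakage of the largest particles and with it the damping of high
  moments.
  
  The finite system is solved explicitly (\<open>wild_sum_solution\<close>). Adding the same multiple of \<open>w\<^sub>i\<close>
  to gain and loss gives \<open>w' = - \<nu> w + Q(w)\<close> with a quadratic \<open>Q\<close> that has non-negative coefficients
  and maps a sequence of mass \<open>\<rho>\<close> to one of mass \<open>\<nu> \<rho>\<close>. With \<open>w(t) = exp (- \<nu> t) z(1 - exp (- \<nu> t))\<close>
  the equation becomes \<open>z' = Q(z) / \<nu>\<close>, and all coefficients of the power series of \<open>z\<close> are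
  non-negative and have mass \<open>\<rho>\<close>. Positivity, conservation of mass and global existence can be read
  off from this series, known as the Wild sum of kinetic theory.
  
  Write \<open>M\<^sub>p\<close> for the moment of order \<open>p\<close>. Symmetry and the second condition on the daughters give
  \[ M_m' \le A \kappa (M_{1+\alpha} M_{m-1+\beta} + M_{1+\beta} M_{m-1+\alpha})
       - A \epsilon M_{m+\beta} M_\alpha. \]
  The third condition makes \<open>M\<^sub>0\<close> non-decreasing, which with the conserved \<open>M\<^sub>1\<close> bounds \<open>M\<^sub>\<alpha>\<close> from
  below. Interpolation between \<open>M\<^sub>1\<close> and \<open>M\<close> of order \<open>m + \<beta>\<close> bounds the positive part by a power
  less than one of the latter; this is where \<open>\<alpha> < 1\<close> enters. Since that moment in turn dominates
  \<open>M\<^sub>m\<close> to the power \<open>1 + \<beta> / (m - 1)\<close>, the moment \<open>M\<^sub>m\<close> satisfies a differential inequality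
  \<open>y' \<le> C - c y powr (1 + \<gamma>)\<close> with \<open>\<gamma> = \<beta> / (m - 1)\<close>. Its solutions come down from infinity at the rate
  \<open>t powr (- 1 / \<gamma>)\<close> and never exceed the maximum of their initial value and a constant
  (\<open>truncated_moment_bounds\<close>).
  
  At times bounded away from zero the moments of order five are thus bounded uniformly in \<open>N\<close>. This
  yields equicontinuity, hence a pointwise convergent subsequence, and a uniform decay in \<open>i\<close> that
  allows passage to the limit in all series. The bound on the second moment is not integrable at
  \<open>t = 0\<close>, so the initial layer needs another argument: the loss rate of \<open>w\<^sub>j\<close> is at most
  \<open>C j w\<^sub>j\<close>, hence \<open>w\<^sub>j(t) \<ge> exp (- C j t) w\<^sub>j(0)\<close>, and conservation of mass turns this one-sided
  estimate into smallness of \<open>\<Sum>j. j \<bar>w\<^sub>j(t) - w\<^sub>j(0)\<bar>\<close>, uniformly in \<open>N\<close>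
  (\<open>distance_to_initial_le\<close>). The gain is integrable up to \<open>t = 0\<close> because it is non-negative and has
  a primitive that is continuous there (\<open>net_integral\<close>).
\<close>

section \<open>Quadratic systems solved by Wild sums\<close>

text \<open>
  Coefficients of the power series solution of \<open>z\<^sub>i' = (\<Sum>j l. q i j l * z\<^sub>j * z\<^sub>l) / \<nu>\<close>
  with \<open>z(0) = y\<close>.
\<close>

fun wild_coeff ::
  "nat set \<Rightarrow> (nat \<Rightarrow> nat \<Rightarrow> nat \<Rightarrow> real) \<Rightarrow> real \<Rightarrow> (nat \<Rightarrow> real) \<Rightarrow> nat \<Rightarrow> nat \<Rightarrow> real"
where
  "wild_coeff I q \<nu> y 0 i = y i"
| "wild_coeff I q \<nu> y (Suc n) i =
     (\<Sum>k\<le>n. \<Sum>j\<in>I. \<Sum>l\<in>I. q i j l * (wild_coeff I q \<nu> y k j * wild_coeff I q \<nu> y (n - k) l))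
       / (\<nu> * real (Suc n))"

lemma wild_coeff_nonneg:
  assumes "\<And>i j l. \<lbrakk>i \<in> I; j \<in> I; l \<in> I\<rbrakk> \<Longrightarrow> 0 \<le> q i j l" "0 < \<nu>"
    and "\<And>i. i \<in> I \<Longrightarrow> 0 \<le> y i" and "i \<in> I"
  shows "0 \<le> wild_coeff I q \<nu> y n i"
  using \<open>i \<in> I\<close>
proof (induction n arbitrary: i rule: less_induct)
  case (less n)
  show ?case
  proof (cases n)
    case 0
    then show ?thesis using assms less.prems by simp
  next
    case (Suc n')
    show ?thesis
      unfolding Suc wild_coeff.simps
      by (intro divide_nonneg_nonneg sum_nonneg mult_nonneg_nonneg less.IH)
         (use Suc assms less.prems in auto)
  qed
qed

text \<open>
  Each of the \<open>n + 1\<close> terms of the convolution defining the next coefficient has weight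
  \<open>\<Lambda> \<rho>\<^sup>2\<close> by the balance condition on \<open>q\<close>, so the division by \<open>\<Lambda> \<rho> (n + 1)\<close> restores \<open>\<rho>\<close>.
\<close>

lemma wild_coeff_weight:
  assumes "finite I" and \<Lambda>0: "0 < \<Lambda>" and \<rho>0: "0 < \<rho>"
    and q: "\<And>j l. \<lbrakk>j \<in> I; l \<in> I\<rbrakk> \<Longrightarrow> (\<Sum>i\<in>I. p i * q i j l) = \<Lambda> * p j * p l"
    and y: "(\<Sum>i\<in>I. p i * y i) = \<rho>"
  shows "(\<Sum>i\<in>I. p i * wild_coeff I q (\<Lambda> * \<rho>) y n i) = \<rho>"
proof (induction n rule: less_induct)
  case (less n)
  let ?c = "wild_coeff I q (\<Lambda> * \<rho>) y"
  show ?case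
  proof (cases n)
    case 0
    then show ?thesis using y by simp
  next
    case (Suc m)
    have conv: "(\<Sum>i\<in>I. p i * (\<Sum>j\<in>I. \<Sum>l\<in>I. q i j l * (?c k j * ?c (m - k) l))) = \<Lambda> * \<rho> * \<rho>"
      if "k \<le> m" for k
    proof -
      have "(\<Sum>i\<in>I. p i * (\<Sum>j\<in>I. \<Sum>l\<in>I. q i j l * (?c k j * ?c (m - k) l)))
          = (\<Sum>i\<in>I. \<Sum>j\<in>I. \<Sum>l\<in>I. p i * q i j l * (?c k j * ?c (m - k) l))"
        by (simp add: sum_distrib_left mult.assoc)
      also have "\<dots> = (\<Sum>j\<in>I. \<Sum>l\<in>I. \<Sum>i\<in>I. p i * q i j l * (?c k j * ?c (m - k) l))"
        by (subst sum.swap, rule sum.cong[OF refl], rule sum.swap)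
      also have "\<dots> = (\<Sum>j\<in>I. \<Sum>l\<in>I. \<Lambda> * ((p j * ?c k j) * (p l * ?c (m - k) l)))"
        by (intro sum.cong refl) (simp add: q flip: sum_distrib_right)
      also have "\<dots> = \<Lambda> * ((\<Sum>j\<in>I. p j * ?c k j) * (\<Sum>l\<in>I. p l * ?c (m - k) l))"
        by (simp add: sum_product flip: sum_distrib_left)
      also have "\<dots> = \<Lambda> * \<rho> * \<rho>"
        using that Suc by (simp add: less.IH)
      finally show ?thesis .
    qed
    have "(\<Sum>i\<in>I. p i * ?c (Suc m) i)
        = (\<Sum>i\<in>I. \<Sum>k\<le>m. p i * (\<Sum>j\<in>I. \<Sum>l\<in>I. q i j l * (?c k j * ?c (m - k) l)))
            / (\<Lambda> * \<rho> * real (Suc m))"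
      by (simp add: sum_distrib_left sum_divide_distrib)
    also have "\<dots> = (\<Sum>k\<le>m. \<Lambda> * \<rho> * \<rho>) / (\<Lambda> * \<rho> * real (Suc m))"
      by (subst sum.swap) (simp add: conv)
    also have "\<dots> = \<rho>"
      using \<Lambda>0 \<rho>0 by (simp del: of_nat_Suc)
    finally show ?thesis using Suc by simp
  qed
qed

text \<open>
  Constant weight of the coefficients gives radius of convergence at least one, which is what
  the substitution \<open>x = 1 - exp (- \<nu> t)\<close>, mapping \<open>t \<ge> 0\<close> to \<open>0 \<le> x < 1\<close>, requires for existence at all
  times. The weight of the solution is a geometric series that cancels the prefactor.
\<close>

theorem wild_sum_solution:
  fixes q :: "nat \<Rightarrow> nat \<Rightarrow> nat \<Rightarrow> real" and p y :: "nat \<Rightarrow> real"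
  assumes I: "finite I" and p: "\<And>i. i \<in> I \<Longrightarrow> 0 < p i"
    and q0: "\<And>i j l. \<lbrakk>i \<in> I; j \<in> I; l \<in> I\<rbrakk> \<Longrightarrow> 0 \<le> q i j l"
    and \<Lambda>: "0 < \<Lambda>"
    and q: "\<And>j l. \<lbrakk>j \<in> I; l \<in> I\<rbrakk> \<Longrightarrow> (\<Sum>i\<in>I. p i * q i j l) = \<Lambda> * p j * p l"
    and y0: "\<And>i. i \<in> I \<Longrightarrow> 0 \<le> y i"
    and y: "(\<Sum>i\<in>I. p i * y i) = \<rho>" and \<rho>: "0 < \<rho>"
  obtains w where
    "\<And>t i. \<lbrakk>0 \<le> t; i \<in> I\<rbrakk> \<Longrightarrow> 0 \<le> w t i"
    "\<And>i. i \<in> I \<Longrightarrow> w 0 i = y i"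
    "\<And>t. 0 \<le> t \<Longrightarrow> (\<Sum>i\<in>I. p i * w t i) = \<rho>"
    "\<And>t i. \<lbrakk>0 \<le> t; i \<in> I\<rbrakk> \<Longrightarrow> ((\<lambda>t. w t i) has_real_derivative
        (\<Sum>j\<in>I. \<Sum>l\<in>I. q i j l * (w t j * w t l)) - \<Lambda> * \<rho> * w t i) (at t)"
proof -
  define \<nu> where "\<nu> = \<Lambda> * \<rho>"
  define c where "c = wild_coeff I q \<nu> y"
  define x where "x = (\<lambda>t. 1 - exp (- \<nu> * t))"
  define z where "z = (\<lambda>i u. \<Sum>n. c n i * u ^ n)"
  define w where "w = (\<lambda>t i. exp (- \<nu> * t) * z i (x t))"
  have \<nu>: "0 < \<nu>" using \<Lambda> \<rho> by (simp add: \<nu>_def)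
  have c0: "0 \<le> c n i" if "i \<in> I" for n i
    unfolding c_def by (rule wild_coeff_nonneg) (use q0 y0 \<nu> that in auto)
  have mass: "(\<Sum>i\<in>I. p i * c n i) = \<rho>" for n
    unfolding c_def \<nu>_def by (rule wild_coeff_weight) (use I q \<Lambda> y \<rho> in auto)
  have bound: "c n i \<le> \<rho> / p i" if "i \<in> I" for n i
  proof -
    have "p i * c n i \<le> (\<Sum>i\<in>I. p i * c n i)"
      by (rule member_le_sum) (use I that p c0 in \<open>auto simp: less_imp_le\<close>)
    then show ?thesis using p[OF that] by (simp add: mass field_simps)
  qed
  have summ: "summable (\<lambda>n. norm (c n i * u ^ n))" if "i \<in> I" "norm u < 1" for i and u :: real
  proof (rule summable_comparison_test')
    show "summable (\<lambda>n. \<rho> / p i * norm u ^ n)"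
      using that by (intro summable_mult summable_geometric) auto
    show "norm (norm (c n i * u ^ n)) \<le> \<rho> / p i * norm u ^ n" if "n \<ge> 0" for n
      using c0[OF \<open>i \<in> I\<close>] bound[OF \<open>i \<in> I\<close>] p[OF \<open>i \<in> I\<close>]
      by (simp add: abs_mult power_abs mult_right_mono del: times_divide_eq_left)
  qed
  have zder: "(z i has_real_derivative (\<Sum>j\<in>I. \<Sum>l\<in>I. q i j l * (z j u * z l u)) / \<nu>) (at u)"
    if i: "i \<in> I" and u: "norm u < 1" for i u
  proof -
    have "(\<lambda>n. \<Sum>j\<in>I. \<Sum>l\<in>I. q i j l *
            (\<Sum>k\<le>n. (c k j * u ^ k) * (c (n - k) l * u ^ (n - k))))
          sums (\<Sum>j\<in>I. \<Sum>l\<in>I. q i j l * (z j u * z l u))"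
      unfolding z_def
      by (intro sums_sum sums_mult Cauchy_product_sums summ u)
    then have "(\<lambda>n. (\<Sum>j\<in>I. \<Sum>l\<in>I. q i j l *
            (\<Sum>k\<le>n. (c k j * u ^ k) * (c (n - k) l * u ^ (n - k)))) / \<nu>)
          sums ((\<Sum>j\<in>I. \<Sum>l\<in>I. q i j l * (z j u * z l u)) / \<nu>)"
      by (rule sums_divide)
    moreover have "(\<Sum>j\<in>I. \<Sum>l\<in>I. q i j l *
            (\<Sum>k\<le>n. (c k j * u ^ k) * (c (n - k) l * u ^ (n - k)))) / \<nu>
          = diffs (\<lambda>n. c n i) n * u ^ n" for n
    proof -
      have "(\<Sum>j\<in>I. \<Sum>l\<in>I. q i j l *
            (\<Sum>k\<le>n. (c k j * u ^ k) * (c (n - k) l * u ^ (n - k))))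
          = (\<Sum>j\<in>I. \<Sum>l\<in>I. \<Sum>k\<le>n. q i j l * (c k j * c (n - k) l) * u ^ n)"
        unfolding sum_distrib_left
      proof (intro sum.cong refl)
        fix j l k assume "k \<in> {..n}"
        then have "u ^ n = u ^ k * u ^ (n - k)" by (simp flip: power_add)
        then show "q i j l * (c k j * u ^ k * (c (n - k) l * u ^ (n - k)))
            = q i j l * (c k j * c (n - k) l) * u ^ n"
          by (simp add: ac_simps)
      qed
      also have "\<dots> = (\<Sum>k\<le>n. \<Sum>j\<in>I. \<Sum>l\<in>I. q i j l * (c k j * c (n - k) l) * u ^ n)"
        by (subst sum.swap[of _ I "{..n}"], rule sum.cong[OF refl], rule sum.swap)
      also have "\<dots> = (\<Sum>k\<le>n. \<Sum>j\<in>I. \<Sum>l\<in>I. q i j l * (c k j * c (n - k) l)) * u ^ n"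
        by (simp add: sum_distrib_right)
      also have "\<dots> = \<nu> * real (Suc n) * c (Suc n) i * u ^ n"
        using \<nu> by (simp add: c_def)
      finally show ?thesis using \<nu> by (simp add: diffs_def)
    qed
    ultimately have "(\<lambda>n. diffs (\<lambda>n. c n i) n * u ^ n)
          sums ((\<Sum>j\<in>I. \<Sum>l\<in>I. q i j l * (z j u * z l u)) / \<nu>)"
      by simp
    moreover have "(z i has_real_derivative (\<Sum>n. diffs (\<lambda>n. c n i) n * u ^ n)) (at u)"
      unfolding z_def
      by (rule termdiffs_strong'[where K = 1])
         (use summ[OF i] u in \<open>auto intro: summable_norm_cancel\<close>)
    ultimately show ?thesis by (simp add: sums_iff)
  qed
  have x: "norm (x t) < 1" "0 \<le> x t" if "0 \<le> t" for t
    using that \<nu> by (auto simp: x_def)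
  show thesis
  proof (rule that[of w])
    show "0 \<le> w t i" if "0 \<le> t" "i \<in> I" for t i
      unfolding w_def z_def
      by (intro mult_nonneg_nonneg suminf_nonneg summable_norm_cancel[OF summ])
         (use x that c0 in auto)
    show "w 0 i = y i" if "i \<in> I" for i
      by (simp add: w_def x_def z_def c_def)
    show "(\<Sum>i\<in>I. p i * w t i) = \<rho>" if "0 \<le> t" for t
    proof -
      have "(\<lambda>n. \<Sum>i\<in>I. p i * (c n i * x t ^ n)) sums (\<Sum>i\<in>I. p i * z i (x t))"
        unfolding z_def
        by (intro sums_sum sums_mult summable_sums summable_norm_cancel[OF summ] x that)
      then have "(\<lambda>n. \<rho> * x t ^ n) sums (\<Sum>i\<in>I. p i * z i (x t))"
        by (simp add: mass flip: mult.assoc sum_distrib_right)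
      moreover have "(\<lambda>n. \<rho> * x t ^ n) sums (\<rho> * (1 / (1 - x t)))"
        by (intro sums_mult geometric_sums x that)
      ultimately have "(\<Sum>i\<in>I. p i * z i (x t)) = \<rho> / exp (- \<nu> * t)"
        by (auto simp: x_def dest: sums_unique2)
      moreover have "(\<Sum>i\<in>I. p i * w t i) = exp (- \<nu> * t) * (\<Sum>i\<in>I. p i * z i (x t))"
        by (simp add: w_def sum_distrib_left ac_simps)
      ultimately show ?thesis by simp
    qed
    show "((\<lambda>t. w t i) has_real_derivative
        (\<Sum>j\<in>I. \<Sum>l\<in>I. q i j l * (w t j * w t l)) - \<Lambda> * \<rho> * w t i) (at t)"
      if "0 \<le> t" "i \<in> I" for t i
    proof -
      have "((\<lambda>t. w t i) has_real_derivative
          exp (- \<nu> * t) * ((\<Sum>j\<in>I. \<Sum>l\<in>I. q i j l * (z j (x t) * z l (x t))) / \<nu>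
             * (\<nu> * exp (- \<nu> * t))) - \<nu> * exp (- \<nu> * t) * z i (x t)) (at t)"
        unfolding w_def
        by (rule derivative_eq_intros DERIV_chain2[OF zder] refl x that | simp add: x_def)+
      moreover have "exp (- \<nu> * t) * ((\<Sum>j\<in>I. \<Sum>l\<in>I. q i j l * (z j (x t) * z l (x t))) / \<nu>
             * (\<nu> * exp (- \<nu> * t))) = (\<Sum>j\<in>I. \<Sum>l\<in>I. q i j l * (w t j * w t l))"
        using \<nu> by (simp add: w_def sum_distrib_left sum_distrib_right sum_divide_distrib ac_simps)
      ultimately show ?thesis by (simp add: w_def \<nu>_def ac_simps)
    qed
  qed
qed

section \<open>Kernel and truncation of the daughter distribution\<close>

lemma collision_kernel_commute: "collision_kernel A \<alpha> \<beta> i j = collision_kernel A \<alpha> \<beta> j i"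
  by (simp add: collision_kernel_def algebra_simps)

lemma collision_kernel_zero [simp]:
  "collision_kernel A \<alpha> \<beta> i 0 = 0" "collision_kernel A \<alpha> \<beta> 0 i = 0"
  by (simp_all add: collision_kernel_def)

lemma collision_kernel_nonneg: "0 \<le> A \<Longrightarrow> 0 \<le> collision_kernel A \<alpha> \<beta> i j"
  by (simp add: collision_kernel_def)

lemma collision_kernel_le:
  assumes "0 \<le> A" "\<alpha> \<le> 1" "\<beta> \<le> 1"
  shows "collision_kernel A \<alpha> \<beta> i j \<le> 2 * A * real i * real j"
proof (cases "i = 0 \<or> j = 0")
  case True
  then show ?thesis by auto
next
  case False
  have le: "real n powr p \<le> real n" if "n \<noteq> 0" "p \<le> 1" for n p
    using powr_mono[of p 1 "real n"] that by simp
  have "real i powr \<alpha> * real j powr \<beta> + real i powr \<beta> * real j powr \<alpha>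
      \<le> real i * real j + real i * real j"
    using False assms by (intro add_mono mult_mono le) auto
  then show ?thesis
    using assms by (auto simp: collision_kernel_def intro: order_trans[OF mult_left_mono])
qed

definition shatter_above ::
  "nat \<Rightarrow> (nat \<Rightarrow> nat \<Rightarrow> nat \<Rightarrow> real) \<Rightarrow> nat \<Rightarrow> nat \<Rightarrow> nat \<Rightarrow> real" where
  "shatter_above N B j k i =
     (if j + k \<le> N then B j k i else if i = 1 then real (j + k) else 0)"

lemma sum_shatter_above:
  assumes "1 \<le> j" "1 \<le> k" "\<not> j + k \<le> N"
  shows "(\<Sum>i = 1..j + k - 1. f i * shatter_above N B j k i) = f 1 * real (j + k)"
proof -
  have "(\<Sum>i = 1..j + k - 1. f i * shatter_above N B j k i)
      = (\<Sum>i = 1..j + k - 1. if i = 1 then f 1 * real (j + k) else 0)"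
    using assms by (intro sum.cong) (auto simp: shatter_above_def)
  then show ?thesis using assms by simp
qed

lemma daughter_B1_shatter_above: "daughter_B1 B \<Longrightarrow> daughter_B1 (shatter_above N B)"
  unfolding daughter_B1_def
proof (intro allI impI, goal_cases)
  case (1 i j)
  show ?case
  proof (cases "i + j \<le> N")
    case True
    then have eq: "shatter_above N B i j = B i j" "shatter_above N B j i = B j i"
      by (auto simp: shatter_above_def fun_eq_iff)
    show ?thesis using 1 unfolding eq by blast
  next
    case False
    then have eq: "shatter_above N B i j s = (if s = 1 then real (i + j) else 0)"
        "shatter_above N B j i s = (if s = 1 then real (i + j) else 0)" for s
      by (auto simp: shatter_above_def add.commute)
    show ?thesis
      using 1 False sum_shatter_above[of i j N real B] unfolding eq by simp
  qed
qed

lemma daughter_B3_shatter_above: "daughter_B3 B \<Longrightarrow> daughter_B3 (shatter_above N B)"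
  unfolding daughter_B3_def
proof (intro allI impI, goal_cases)
  case (1 j k)
  show ?case
  proof (cases "j + k \<le> N")
    case True
    then have [simp]: "shatter_above N B j k = B j k"
      by (auto simp: shatter_above_def fun_eq_iff)
    show ?thesis using 1 by simp
  next
    case False
    then show ?thesis
      using 1 sum_shatter_above[of j k N "\<lambda>_. 1" B] by simp
  qed
qed

text \<open>
  Complete shattering has moment \<open>j + k\<close> of every order, which is below the mixed term with the
  factor \<open>\<kappa> m \<ge> 1\<close>, since powers of sizes are at least one.
\<close>

lemma daughter_B2_shatter_above: "daughter_B2 B \<epsilon> \<kappa> \<Longrightarrow> daughter_B2 (shatter_above N B) \<epsilon> \<kappa>"
  unfolding daughter_B2_def
proof (intro allI impI, goal_cases)
  case (1 m)
  have \<epsilon>: "0 < \<epsilon> m" "\<epsilon> m < 1" and \<kappa>: "1 \<le> \<kappa> m" using 1 by auto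
  have "(\<Sum>i = 1..j + k - 1. real i powr m * shatter_above N B j k i)
             \<le> (1 - \<epsilon> m) * (real j powr m + real k powr m)
                + \<kappa> m * (real j * real k powr (m - 1) + real j powr (m - 1) * real k)"
    if jk: "1 \<le> j" "1 \<le> k" for j k
  proof (cases "j + k \<le> N")
    case True
    then have [simp]: "shatter_above N B j k = B j k"
      by (auto simp: shatter_above_def fun_eq_iff)
    show ?thesis using 1 jk by simp
  next
    case False
    have "1 \<le> real n powr (m - 1)" if "1 \<le> n" for n
      using 1(2) that by (intro ge_one_powr_ge_zero) auto
    then have "real j * 1 + 1 * real k \<le> real j * real k powr (m - 1) + real j powr (m - 1) * real k"
      using jk by (intro add_mono mult_left_mono mult_right_mono) auto
    also have "\<dots> \<le> \<kappa> m * (real j * real k powr (m - 1) + real j powr (m - 1) * real k)"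
      using mult_right_mono[OF \<kappa>, of "real j * real k powr (m - 1) + real j powr (m - 1) * real k"]
      by simp
    finally have "real (j + k) \<le> \<kappa> m * (real j * real k powr (m - 1) + real j powr (m - 1) * real k)"
      by simp
    moreover have "0 \<le> (1 - \<epsilon> m) * (real j powr m + real k powr m)"
      using \<epsilon> by simp
    ultimately show ?thesis
      using sum_shatter_above[of j k N "\<lambda>i. real i powr m" B] jk False by simp
  qed
  then show ?case using \<epsilon> \<kappa> by auto
qed

lemma shatter_above_closed:
  assumes "daughter_B1 B" "j \<in> {1..N}" "k \<in> {1..N}" "N < i"
  shows "shatter_above N B j k i = 0"
  using assms by (auto simp: shatter_above_def daughter_B1_def)

lemma daughter_nonneg:
  assumes "daughter_B1 B" "1 \<le> j" "1 \<le> k" "1 \<le> i"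
  shows "0 \<le> B j k i"
  using assms by (cases "i \<le> j + k - 1") (auto simp: daughter_B1_def)

lemma daughter_le:
  assumes "daughter_B1 B" "1 \<le> j" "1 \<le> k" "1 \<le> i"
  shows "B j k i \<le> real (j + k)"
proof (cases "i \<le> j + k - 1")
  case True
  have "B j k i \<le> real i * B j k i"
    using daughter_nonneg[OF assms] assms(4) by (simp add: mult_le_cancel_right1)
  also have "\<dots> \<le> (\<Sum>s = 1..j + k - 1. real s * B j k s)"
    by (rule member_le_sum) (use True assms daughter_nonneg[OF assms(1-3)] in auto)
  finally show ?thesis using assms by (auto simp: daughter_B1_def)
next
  case False
  then show ?thesis using assms by (auto simp: daughter_B1_def)
qed

section \<open>A priori estimates for the truncated system\<close>

text \<open>
  The hypothesis \<open>closed\<close> makes the system on \<open>1..N\<close> exact: no daughter leaves that range, so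
  restricting the sums loses no mass. Sequences vanish outside \<open>1..N\<close>, including index \<open>0\<close>, which
  lets sums over \<open>1..N\<close> be read as series over all natural numbers.
\<close>

locale truncated_breakage =
  fixes A \<alpha> \<beta> :: real and B :: "nat \<Rightarrow> nat \<Rightarrow> nat \<Rightarrow> real" and N :: nat
    and w :: "real \<Rightarrow> nat \<Rightarrow> real"
  assumes A: "0 < A" and \<alpha>\<beta>: "\<alpha> \<le> \<beta>" and \<beta>1: "\<beta> \<le> 1" and \<beta>0: "0 < \<beta>" and \<alpha>1: "\<alpha> < 1"
    and B1: "daughter_B1 B"
    and closed: "\<And>i j k. \<lbrakk>j \<in> {1..N}; k \<in> {1..N}; N < i\<rbrakk> \<Longrightarrow> B j k i = 0"
    and nonneg: "\<And>t i. 0 \<le> t \<Longrightarrow> 0 \<le> w t i"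
    and supp: "\<And>t i. i \<notin> {1..N} \<Longrightarrow> w t i = 0"
    and ode: "\<And>t i. \<lbrakk>0 \<le> t; i \<in> {1..N}\<rbrakk> \<Longrightarrow> ((\<lambda>t. w t i) has_real_derivative
        1 / 2 * (\<Sum>j=1..N. \<Sum>l=1..N. B j l i * collision_kernel A \<alpha> \<beta> j l * w t j * w t l)
        - (\<Sum>j=1..N. collision_kernel A \<alpha> \<beta> i j * w t i * w t j)) (at t)"
begin

abbreviation "a \<equiv> collision_kernel A \<alpha> \<beta>"

lemma a_le: "a i j \<le> 2 * A * real i * real j"
  using A \<alpha>1 \<beta>1 by (intro collision_kernel_le) auto

lemma a_nonneg: "0 \<le> a i j"
  using A by (intro collision_kernel_nonneg) auto

text \<open>
  Testing the equation with an arbitrary weight \<open>p\<close> reduces every balance law to a comparison of the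
  daughters of one collision with its two parents.
\<close>

lemma weak_form:
  assumes t: "0 \<le> t"
  shows "((\<lambda>t. \<Sum>i=1..N. p i * w t i) has_real_derivative
     1 / 2 * (\<Sum>j=1..N. \<Sum>l=1..N. a j l * w t j * w t l *
       ((\<Sum>i=1..j + l - 1. p i * B j l i) - p j - p l))) (at t)"
proof -
  let ?G = "\<lambda>i. \<Sum>j=1..N. \<Sum>l=1..N. B j l i * a j l * w t j * w t l"
  let ?L = "\<lambda>i. \<Sum>j=1..N. a i j * w t i * w t j"
  have "((\<lambda>t. \<Sum>i=1..N. p i * w t i) has_real_derivative
     (\<Sum>i=1..N. p i * (1 / 2 * ?G i - ?L i))) (at t)"
    by (intro DERIV_sum DERIV_cmult ode t)
  also have "(\<Sum>i=1..N. p i * (1 / 2 * ?G i - ?L i))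
      = 1 / 2 * (\<Sum>i=1..N. p i * ?G i) - (\<Sum>i=1..N. p i * ?L i)"
    by (simp add: sum_subtractf sum_distrib_left right_diff_distrib ac_simps)
  also have "(\<Sum>i=1..N. p i * ?G i)
      = (\<Sum>j=1..N. \<Sum>l=1..N. a j l * w t j * w t l * (\<Sum>i=1..j + l - 1. p i * B j l i))"
  proof -
    have "(\<Sum>i=1..N. p i * ?G i) = (\<Sum>i=1..N. \<Sum>j=1..N. \<Sum>l=1..N. a j l * w t j * w t l * (p i * B j l i))"
      by (simp add: sum_distrib_left ac_simps)
    also have "\<dots> = (\<Sum>j=1..N. \<Sum>l=1..N. \<Sum>i=1..N. a j l * w t j * w t l * (p i * B j l i))"
      by (subst sum.swap, rule sum.cong[OF refl], rule sum.swap)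
    also have "\<dots> = (\<Sum>j=1..N. \<Sum>l=1..N. a j l * w t j * w t l * (\<Sum>i=1..N. p i * B j l i))"
      by (simp add: sum_distrib_left)
    also have "\<dots> = (\<Sum>j=1..N. \<Sum>l=1..N. a j l * w t j * w t l * (\<Sum>i=1..j + l - 1. p i * B j l i))"
    proof (intro sum.cong refl)
      fix j l assume jl: "j \<in> {1..N}" "l \<in> {1..N}"
      have "B j l i = 0" if "i \<ge> j + l" for i
        using B1 jl that by (auto simp: daughter_B1_def)
      moreover have "B j l i = 0" if "i > N" for i
        using closed jl that by auto
      ultimately have "(\<Sum>i=1..N. p i * B j l i) = (\<Sum>i=1..j + l - 1. p i * B j l i)"
        by (intro sum.mono_neutral_cong) auto
      then show "a j l * w t j * w t l * (\<Sum>i=1..N. p i * B j l i)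
          = a j l * w t j * w t l * (\<Sum>i=1..j + l - 1. p i * B j l i)" by simp
    qed
    finally show ?thesis .
  qed
  also have "(\<Sum>i=1..N. p i * ?L i)
      = 1 / 2 * (\<Sum>j=1..N. \<Sum>l=1..N. a j l * w t j * w t l * (p j + p l))"
  proof -
    have 1: "(\<Sum>i=1..N. p i * ?L i) = (\<Sum>j=1..N. \<Sum>l=1..N. a j l * w t j * w t l * p j)"
      by (simp add: sum_distrib_left ac_simps)
    also have "\<dots> = (\<Sum>l=1..N. \<Sum>j=1..N. a j l * w t j * w t l * p j)"
      by (rule sum.swap)
    also have "\<dots> = (\<Sum>j=1..N. \<Sum>l=1..N. a j l * w t j * w t l * p l)"
      by (simp add: collision_kernel_commute[of A \<alpha> \<beta>] ac_simps)
    finally have 2: "(\<Sum>i=1..N. p i * ?L i) = (\<Sum>j=1..N. \<Sum>l=1..N. a j l * w t j * w t l * p l)" .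
    show ?thesis
      unfolding distrib_left sum.distrib using 1 2 by simp
  qed
  also have "1 / 2 * (\<Sum>j=1..N. \<Sum>l=1..N. a j l * w t j * w t l * (\<Sum>i=1..j + l - 1. p i * B j l i))
      - 1 / 2 * (\<Sum>j=1..N. \<Sum>l=1..N. a j l * w t j * w t l * (p j + p l))
      = 1 / 2 * (\<Sum>j=1..N. \<Sum>l=1..N. a j l * w t j * w t l *
       ((\<Sum>i=1..j + l - 1. p i * B j l i) - p j - p l))"
    by (simp add: sum_subtractf diff_diff_eq right_diff_distrib)
  finally show ?thesis .
qed

definition M :: "real \<Rightarrow> real \<Rightarrow> real" where
  "M p t = (\<Sum>i=1..N. real i powr p * w t i)"

lemma M_nonneg: "0 \<le> t \<Longrightarrow> 0 \<le> M p t"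
  unfolding M_def by (intro sum_nonneg mult_nonneg_nonneg nonneg) auto

lemma M_mono: "0 \<le> t \<Longrightarrow> p \<le> p' \<Longrightarrow> M p t \<le> M p' t"
  unfolding M_def by (intro sum_mono mult_right_mono powr_mono nonneg) auto

lemma le_M:
  assumes "0 \<le> t" shows "real i powr p * w t i \<le> M p t"
proof (cases "i \<in> {1..N}")
  case True
  then show ?thesis unfolding M_def
    by (intro member_le_sum) (use assms nonneg in auto)
next
  case False
  then show ?thesis using supp[OF False] M_nonneg assms by simp
qed

lemma mass_conservation:
  assumes "0 \<le> t" shows "M 1 t = M 1 0"
proof -
  have "((\<lambda>t. M 1 t) has_real_derivative 0) (at s)" if "0 \<le> s" for s
  proof -
    have "(\<Sum>i=1..j + l - 1. real i powr 1 * B j l i) - real j powr 1 - real l powr 1 = 0"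
      if "j \<in> {1..N}" "l \<in> {1..N}" for j l
      using B1 that by (simp add: daughter_B1_def)
    then have "(\<Sum>j=1..N. \<Sum>l=1..N. a j l * w s j * w s l *
       ((\<Sum>i=1..j + l - 1. real i powr 1 * B j l i) - real j powr 1 - real l powr 1)) = 0"
      by (intro sum.neutral ballI) simp
    then show ?thesis
      unfolding M_def using weak_form[OF that, of "\<lambda>i. real i powr 1"] by simp
  qed
  moreover from this have "continuous_on {0..t} (M 1)"
    by (meson DERIV_isCont atLeastAtMost_iff continuous_at_imp_continuous_on)
  ultimately show ?thesis
    using DERIV_isconst_end[of 0 t "M 1"] assms by (cases "t = 0") auto
qed

lemma number_nondecreasing:
  assumes B3: "daughter_B3 B" and "0 \<le> t" shows "M 0 0 \<le> M 0 t"
proof (rule DERIV_nonneg_imp_nondecreasing[OF \<open>0 \<le> t\<close>])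
  fix s :: real assume s: "0 \<le> s"
  let ?D = "1 / 2 * (\<Sum>j=1..N. \<Sum>l=1..N. a j l * w s j * w s l *
       ((\<Sum>i=1..j + l - 1. real i powr 0 * B j l i) - real j powr 0 - real l powr 0))"
  have "(M 0 has_real_derivative ?D) (at s)"
    unfolding M_def[abs_def] by (rule weak_form[OF s])
  moreover have "0 \<le> (\<Sum>i=1..j + l - 1. real i powr 0 * B j l i) - real j powr 0 - real l powr 0"
      if "j \<in> {1..N}" "l \<in> {1..N}" for j l
  proof -
    have "(\<Sum>i=1..j + l - 1. real i powr 0 * B j l i) = (\<Sum>i=1..j + l - 1. B j l i)"
      by (intro sum.cong) auto
    then show ?thesis
      using B3 that by (auto simp: daughter_B3_def)
  qed
  then have "0 \<le> ?D"
    by (intro mult_nonneg_nonneg sum_nonneg a_nonneg nonneg s) auto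
  ultimately show "\<exists>y. (M 0 has_real_derivative y) (at s) \<and> 0 \<le> y" by blast
qed

text \<open>
  Since the kernel is symmetric, the symmetric bound of the second daughter condition may be replaced
  by the function \<open>h\<close>, which gives the power \<open>m\<close> in the loss to one of the parents only. The two
  summands of the kernel then contribute two products of moments to the loss; the one with the higher
  moment is kept.
\<close>

lemma moment_derivative_le:
  assumes B2: "daughter_B2 B \<epsilon> \<kappa>" and m: "1 < m" and t: "0 \<le> t"
  obtains D where "(M m has_real_derivative D) (at t)"
    "D \<le> A * \<kappa> m * (M (1 + \<alpha>) t * M (m - 1 + \<beta>) t + M (1 + \<beta>) t * M (m - 1 + \<alpha>) t)
          - A * \<epsilon> m * (M (m + \<beta>) t * M \<alpha> t)"
proof
  let ?D = "1 / 2 * (\<Sum>j=1..N. \<Sum>l=1..N. a j l * w t j * w t l *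
       ((\<Sum>i=1..j + l - 1. real i powr m * B j l i) - real j powr m - real l powr m))"
  show "(M m has_real_derivative ?D) (at t)"
    unfolding M_def[abs_def] by (rule weak_form[OF t])
  define h where "h = (\<lambda>j l. \<kappa> m * (real j * real l powr (m - 1)) - \<epsilon> m * real j powr m)"
  have \<epsilon>: "0 < \<epsilon> m" and \<kappa>: "1 \<le> \<kappa> m" using B2 m by (auto simp: daughter_B2_def)
  have "?D \<le> 1 / 2 * (\<Sum>j=1..N. \<Sum>l=1..N. a j l * w t j * w t l * (h j l + h l j))"
  proof (intro mult_left_mono sum_mono)
    fix j l assume "j \<in> {1..N}" "l \<in> {1..N}"
    then have "(\<Sum>i = 1..j + l - 1. real i powr m * B j l i)
             \<le> (1 - \<epsilon> m) * (real j powr m + real l powr m)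
                + \<kappa> m * (real j * real l powr (m - 1) + real j powr (m - 1) * real l)"
      using B2 m by (auto simp: daughter_B2_def)
    then show "(\<Sum>i=1..j + l - 1. real i powr m * B j l i) - real j powr m - real l powr m
        \<le> h j l + h l j"
      by (simp add: h_def algebra_simps)
  qed (use a_nonneg nonneg t in auto)
  also have "\<dots> = (\<Sum>j=1..N. \<Sum>l=1..N. a j l * w t j * w t l * h j l)"
  proof -
    have "(\<Sum>j=1..N. \<Sum>l=1..N. a j l * w t j * w t l * h l j)
        = (\<Sum>l=1..N. \<Sum>j=1..N. a j l * w t j * w t l * h l j)"
      by (rule sum.swap)
    also have "\<dots> = (\<Sum>j=1..N. \<Sum>l=1..N. a j l * w t j * w t l * h j l)"
      by (simp add: collision_kernel_commute[of A \<alpha> \<beta>] ac_simps)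
    finally show ?thesis by (simp add: distrib_left sum.distrib)
  qed
  also have "\<dots> \<le> (\<Sum>j=1..N. \<Sum>l=1..N. 
      A * \<kappa> m * ((real j powr (1 + \<alpha>) * w t j) * (real l powr (m - 1 + \<beta>) * w t l) +
                 (real j powr (1 + \<beta>) * w t j) * (real l powr (m - 1 + \<alpha>) * w t l))
      - A * \<epsilon> m * ((real j powr (m + \<beta>) * w t j) * (real l powr \<alpha> * w t l)))"
  proof (intro sum_mono)
    fix j l assume jl: "j \<in> {1..N}" "l \<in> {1..N}"
    have pos: "0 < real j" "0 < real l" using jl by auto
    have split: "x powr (1 + p) = x * x powr p" "x powr (m + p) = x powr m * x powr p"
      "x powr (m - 1 + p) = x powr (m - 1) * x powr p" if "0 < x" for x p
      using that by (simp_all add: powr_add)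
    have "a j l * w t j * w t l * h j l = 
       A * \<kappa> m * ((real j powr (1 + \<alpha>) * w t j) * (real l powr (m - 1 + \<beta>) * w t l) +
                 (real j powr (1 + \<beta>) * w t j) * (real l powr (m - 1 + \<alpha>) * w t l))
      - A * \<epsilon> m * ((real j powr (m + \<beta>) * w t j) * (real l powr \<alpha> * w t l))
      - A * \<epsilon> m * ((real j powr (m + \<alpha>) * w t j) * (real l powr \<beta> * w t l))"
      unfolding collision_kernel_def h_def split[OF pos(1)] split[OF pos(2)]
      by (simp add: algebra_simps)
    moreover have "0 \<le> A * \<epsilon> m * ((real j powr (m + \<alpha>) * w t j) * (real l powr \<beta> * w t l))"
      using A \<epsilon> nonneg t by (intro mult_nonneg_nonneg) auto
    ultimately show "a j l * w t j * w t l * h j l \<le>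
       A * \<kappa> m * ((real j powr (1 + \<alpha>) * w t j) * (real l powr (m - 1 + \<beta>) * w t l) +
                 (real j powr (1 + \<beta>) * w t j) * (real l powr (m - 1 + \<alpha>) * w t l))
      - A * \<epsilon> m * ((real j powr (m + \<beta>) * w t j) * (real l powr \<alpha> * w t l))"
      by linarith
  qed
  also have "\<dots> = A * \<kappa> m * (M (1 + \<alpha>) t * M (m - 1 + \<beta>) t + M (1 + \<beta>) t * M (m - 1 + \<alpha>) t)
          - A * \<epsilon> m * (M (m + \<beta>) t * M \<alpha> t)"
    unfolding M_def sum_product by (simp only: sum_subtractf sum.distrib flip: sum_distrib_left)
  finally show "?D \<le> \<dots>" .
qed

text \<open>
  Mass conservation bounds the loss rate of size \<open>i\<close> linearly in \<open>i\<close>, and the gain is non-negative.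
\<close>

lemma persistence:
  assumes t: "0 \<le> t" shows "w 0 i * exp (- (2 * A * M 1 0 * real i * t)) \<le> w t i"
proof (cases "i \<in> {1..N}")
  case False
  then show ?thesis using supp by simp
next
  case i: True
  define C where "C = 2 * A * M 1 0 * real i"
  have "w 0 i * exp (C * 0) \<le> w t i * exp (C * t)"
  proof (rule DERIV_nonneg_imp_nondecreasing[OF t])
    fix s :: real assume s: "0 \<le> s"
    let ?G = "1 / 2 * (\<Sum>j=1..N. \<Sum>l=1..N. B j l i * a j l * w s j * w s l)"
    let ?L = "\<Sum>j=1..N. a i j * w s i * w s j"
    have "((\<lambda>s. w s i * exp (C * s)) has_real_derivative
        (?G - ?L) * exp (C * s) + exp (C * s) * C * w s i) (at s)"
      by (rule derivative_eq_intros ode s i refl | simp)+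
    moreover have "?L \<le> C * w s i"
    proof -
      have "?L \<le> (\<Sum>j=1..N. (2 * A * real i * real j) * w s i * w s j)"
        by (intro sum_mono mult_right_mono a_le nonneg s)
      also have "\<dots> = 2 * A * real i * w s i * M 1 s"
        unfolding M_def sum_distrib_left by (intro sum.cong) auto
      finally show ?thesis by (simp add: C_def mass_conservation[OF s] ac_simps)
    qed
    moreover have "0 \<le> ?G"
      by (intro mult_nonneg_nonneg sum_nonneg a_nonneg nonneg s daughter_nonneg[OF B1])
         (use i in auto)
    ultimately have "((\<lambda>s. w s i * exp (C * s)) has_real_derivative
        (?G - ?L) * exp (C * s) + exp (C * s) * C * w s i) (at s)"
       "0 \<le> ((?G - ?L) + C * w s i) * exp (C * s)" by auto
    then show "\<exists>y. ((\<lambda>s. w s i * exp (C * s)) has_real_derivative y) (at s) \<and> 0 \<le> y"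
      by (auto simp: algebra_simps)
  qed
  then show ?thesis
    by (simp add: C_def exp_minus field_simps)
qed

text \<open>
  A function with integral zero has twice the integral of its negative part as its absolute integral.
  Applied to the difference of two states of equal mass, this promotes the lower bound of
  \<open>persistence\<close> to a two-sided one that involves only the initial state.
\<close>

lemma distance_to_initial_le:
  assumes t: "0 \<le> t"
  shows "(\<Sum>j=1..N. real j * \<bar>w t j - w 0 j\<bar>)
    \<le> 2 * (\<Sum>j=1..N. real j * w 0 j * (1 - exp (- (2 * A * M 1 0 * real j * t))))"
proof -
  let ?d = "\<lambda>j. w 0 j * (1 - exp (- (2 * A * M 1 0 * real j * t)))"
  have "(\<Sum>j=1..N. real j * \<bar>w t j - w 0 j\<bar>)
      \<le> (\<Sum>j=1..N. (real j powr 1 * w t j - real j powr 1 * w 0 j) + 2 * (real j * ?d j))"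
  proof (rule sum_mono)
    fix j assume "j \<in> {1..N}"
    have "0 \<le> ?d j"
      using t A nonneg M_nonneg by (intro mult_nonneg_nonneg) auto
    moreover have "w 0 j - w t j \<le> ?d j"
      using persistence[OF t, of j] by (simp add: algebra_simps)
    ultimately have "\<bar>w t j - w 0 j\<bar> \<le> (w t j - w 0 j) + 2 * ?d j" by linarith
    then have "real j * \<bar>w t j - w 0 j\<bar> \<le> real j * ((w t j - w 0 j) + 2 * ?d j)"
      by (intro mult_left_mono) auto
    then show "real j * \<bar>w t j - w 0 j\<bar>
        \<le> (real j powr 1 * w t j - real j powr 1 * w 0 j) + 2 * (real j * ?d j)"
      by (simp add: algebra_simps)
  qed
  also have "\<dots> = (M 1 t - M 1 0) + 2 * (\<Sum>j=1..N. real j * ?d j)"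
    unfolding M_def by (simp only: sum.distrib sum_subtractf sum_distrib_left)
  finally show ?thesis using mass_conservation[OF t] by (simp add: mult.assoc)
qed

definition rate :: "nat \<Rightarrow> real \<Rightarrow> real" where
  "rate i t = 1 / 2 * (\<Sum>j=1..N. \<Sum>l=1..N. B j l i * a j l * w t j * w t l)
        - (\<Sum>j=1..N. a i j * w t i * w t j)"

lemma has_rate:
  assumes t: "0 \<le> t" and i: "1 \<le> i"
  shows "((\<lambda>t. w t i) has_real_derivative rate i t) (at t)"
proof (cases "i \<le> N")
  case True
  then show ?thesis unfolding rate_def using ode t i by simp
next
  case False
  then have "w t i = 0" for t using supp by simp
  moreover from this have "rate i t = 0"
    unfolding rate_def using closed False by simp
  ultimately show ?thesis by simp
qed

lemma rate_bound:
  assumes t: "0 \<le> t" and i: "1 \<le> i"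
  shows "\<bar>rate i t\<bar> \<le> 2 * A * M 1 0 * (M 2 t + M 1 0)"
proof -
  let ?G = "1 / 2 * (\<Sum>j=1..N. \<Sum>l=1..N. B j l i * a j l * w t j * w t l)"
  let ?L = "\<Sum>j=1..N. a i j * w t i * w t j"
  have "0 \<le> ?G"
    by (intro mult_nonneg_nonneg sum_nonneg a_nonneg nonneg t daughter_nonneg[OF B1])
       (use i in auto)
  moreover have "0 \<le> ?L"
    by (intro mult_nonneg_nonneg sum_nonneg a_nonneg nonneg t)
  moreover have "?G \<le> 2 * A * M 1 0 * M 2 t"
  proof -
    have "?G \<le> 1 / 2 * (\<Sum>j=1..N. \<Sum>l=1..N. (real (j + l)) * (2 * A * real j * real l) * w t j * w t l)"
      by (intro mult_left_mono sum_mono mult_right_mono nonneg t mult_mono daughter_le[OF B1] a_le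
          a_nonneg) (use i in auto)
    also have "\<dots> = 1 / 2 * (\<Sum>j=1..N. \<Sum>l=1..N.
        2 * A * ((real j powr 2 * w t j) * (real l powr 1 * w t l)
          + (real j powr 1 * w t j) * (real l powr 2 * w t l)))"
      by (intro sum.cong arg_cong[where f = "(*) _"] refl) (simp add: power2_eq_square algebra_simps)
    also have "\<dots> = 1 / 2 * (2 * A * (M 2 t * M 1 t + M 1 t * M 2 t))"
      unfolding M_def sum_product by (simp only: sum.distrib flip: sum_distrib_left)
    finally show ?thesis using mass_conservation[OF t] by (simp add: ac_simps)
  qed
  moreover have "?L \<le> 2 * A * M 1 0 * M 1 0"
  proof -
    have "?L \<le> (\<Sum>j=1..N. (2 * A * real i * real j) * w t i * w t j)"
      by (intro sum_mono mult_right_mono a_le nonneg t)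
    also have "\<dots> = 2 * A * (real i powr 1 * w t i) * M 1 t"
      unfolding M_def sum_distrib_left by (intro sum.cong) auto
    also have "\<dots> \<le> 2 * A * M 1 t * M 1 t"
      using A M_nonneg[OF t] le_M[OF t, of i 1] by (intro mult_left_mono mult_right_mono) auto
    finally show ?thesis using mass_conservation[OF t] by simp
  qed
  ultimately show ?thesis unfolding rate_def by (simp add: distrib_left abs_le_iff)
qed

lemma lipschitz_in_time:
  assumes s: "0 \<le> s" and M2: "\<And>\<tau>. s \<le> \<tau> \<Longrightarrow> M 2 \<tau> \<le> C" and M1: "M 1 0 \<le> \<rho>"
    and i: "1 \<le> i" and tt: "s \<le> t" "s \<le> t'"
  shows "\<bar>w t i - w t' i\<bar> \<le> 2 * A * \<rho> * (C + \<rho>) * \<bar>t - t'\<bar>"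
proof -
  have "norm (w t i - w t' i) \<le> 2 * A * \<rho> * (C + \<rho>) * norm (t - t')"
  proof (rule field_differentiable_bound[where S = "{s..}" and f' = "rate i"])
    fix \<tau> assume \<tau>: "\<tau> \<in> {s..}"
    then have \<tau>0: "0 \<le> \<tau>" using s by simp
    show "((\<lambda>t. w t i) has_field_derivative rate i \<tau>) (at \<tau> within {s..})"
      using has_rate[OF \<tau>0 i] by (rule has_field_derivative_at_within)
    have "\<bar>rate i \<tau>\<bar> \<le> 2 * A * M 1 0 * (M 2 \<tau> + M 1 0)"
      by (rule rate_bound[OF \<tau>0 i])
    also have "\<dots> \<le> 2 * A * \<rho> * (C + \<rho>)"
      using A M1 M2[of \<tau>] \<tau> M_nonneg[of 0 1] M_nonneg[OF \<tau>0, of 2]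
      by (intro mult_mono add_mono add_nonneg_nonneg) auto
    finally show "norm (rate i \<tau>) \<le> 2 * A * \<rho> * (C + \<rho>)" by simp
  qed (use tt in auto)
  then show ?thesis by simp
qed

text \<open>
  Regrouping of collisions by total size \<open>j + l\<close>, the form in which the gain enters the equation.
\<close>

lemma gain_sums:
  assumes i: "1 \<le> i"
  shows "gain_term a B (w t) i sums
    (\<Sum>j=1..N. \<Sum>l=1..N. B j l i * a j l * w t j * w t l)"
proof -
  let ?f = "\<lambda>j l. B j l i * a j l * w t j * w t l"
  have f0: "?f j l = 0" if "j \<notin> {1..N} \<or> l \<notin> {1..N}" for j l
    using supp that by auto
  have "(\<Sum>j=1..N. \<Sum>l=1..N. ?f j l) = (\<Sum>(j,l)\<in>{1..N} \<times> {1..N}. ?f j l)"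
    by (simp add: sum.cartesian_product)
  also have "\<dots> = (\<Sum>(s,k)\<in>(SIGMA s:{..2 * N}. {1..s - 1}). ?f (s - k) k)"
  proof (rule sum.reindex_bij_witness_not_neutral[where
        S' = "{}" and T' = "{(s,k) \<in> (SIGMA s:{..2 * N}. {1..s - 1}). s - k \<notin> {1..N} \<or> k \<notin> {1..N}}"
        and i = "\<lambda>(s,k). (s - k, k)" and j = "\<lambda>(j,l). (j + l, l)"])
    show "finite {(s,k) \<in> (SIGMA s:{..2 * N}. {1..s - 1}). s - k \<notin> {1..N} \<or> k \<notin> {1..N}}"
      by (rule finite_subset[of _ "SIGMA s:{..2 * N}. {1..s - 1}"]) auto
  qed (auto simp: f0)
  also have "\<dots> = (\<Sum>s\<le>2 * N. gain_term a B (w t) i s)"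
    unfolding gain_term_def by (simp add: sum.Sigma)
  finally have "(\<Sum>s\<le>2 * N. gain_term a B (w t) i s) = (\<Sum>j=1..N. \<Sum>l=1..N. ?f j l)" by simp
  moreover have "gain_term a B (w t) i s = 0" if "s \<notin> {..2 * N}" for s
    unfolding gain_term_def using that by (intro sum.neutral ballI f0) auto
  ultimately show ?thesis
    using sums_finite[of "{..2 * N}" "gain_term a B (w t) i"] by simp
qed

end

text \<open>
  The Wild sum applies after half of \<open>\<Lambda> l - a j l\<close> is put on the diagonal \<open>i = j\<close> and half of
  \<open>\<Lambda> j - a j l\<close> on the diagonal \<open>i = l\<close>. These terms are non-negative for \<open>\<Lambda> = 2 A N\<close>, add up to \<open>\<Lambda> \<rho> w\<^sub>i\<close> minus the loss by symmetry of the kernel, and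
  complete the mass balance of the gain to the product \<open>\<Lambda> j l\<close>.
\<close>

lemma truncated_breakage_exists:
  assumes par: "0 < A" "\<alpha> \<le> \<beta>" "\<beta> \<le> 1" "0 < \<beta>" "\<alpha> < 1"
    and B1: "daughter_B1 B"
    and closed: "\<And>i j k. \<lbrakk>j \<in> {1..N}; k \<in> {1..N}; N < i\<rbrakk> \<Longrightarrow> B j k i = 0"
    and y0: "\<And>i. i \<in> {1..N} \<Longrightarrow> 0 \<le> y i" and \<rho>: "0 < (\<Sum>i=1..N. real i * y i)"
  obtains w where "truncated_breakage A \<alpha> \<beta> B N w" "\<And>i. i \<in> {1..N} \<Longrightarrow> w 0 i = y i"
proof -
  let ?I = "{1..N}"
  let ?a = "collision_kernel A \<alpha> \<beta>"
  define \<rho> where "\<rho> = (\<Sum>i=1..N. real i * y i)"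
  define \<Lambda> where "\<Lambda> = 2 * A * real N"
  have N: "0 < N" using \<rho> by (cases N) auto
  have a_le: "?a i l \<le> \<Lambda> * real l" if "i \<in> ?I" for i l
  proof -
    have "?a i l \<le> 2 * A * real i * real l"
      using par by (intro collision_kernel_le) auto
    also have "\<dots> \<le> \<Lambda> * real l"
      unfolding \<Lambda>_def using par that by (intro mult_right_mono mult_left_mono) auto
    finally show ?thesis .
  qed
  define q where "q = (\<lambda>i j l. 1 / 2 * (B j l i * ?a j l
      + (if i = j then \<Lambda> * real l - ?a j l else 0) + (if i = l then \<Lambda> * real j - ?a j l else 0)))"
  have q0: "0 \<le> q i j l" if "i \<in> ?I" "j \<in> ?I" "l \<in> ?I" for i j l
  proof -
    have "0 \<le> B j l i * ?a j l"
      using that par by (intro mult_nonneg_nonneg daughter_nonneg[OF B1] collision_kernel_nonneg) auto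
    moreover have "?a j l \<le> \<Lambda> * real l" "?a j l \<le> \<Lambda> * real j"
      using a_le[of j l] a_le[of l j] that by (auto simp: collision_kernel_commute[of A \<alpha> \<beta> j])
    ultimately show ?thesis by (simp add: q_def)
  qed
  have q: "(\<Sum>i\<in>?I. real i * q i j l) = \<Lambda> * real j * real l" if jl: "j \<in> ?I" "l \<in> ?I" for j l
  proof -
    have "(\<Sum>i=1..N. real i * B j l i) = (\<Sum>i=1..j + l - 1. real i * B j l i)"
      using B1 jl closed[OF jl] by (intro sum.mono_neutral_cong) (auto simp: daughter_B1_def)
    also have "\<dots> = real (j + l)" using B1 jl by (auto simp: daughter_B1_def)
    finally have S: "(\<Sum>i=1..N. real i * B j l i) = real (j + l)" .
    have "(\<Sum>i\<in>?I. real i * q i j l) = 1 / 2 * ((\<Sum>i=1..N. real i * B j l i) * ?a j l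
        + (\<Sum>i=1..N. if i = j then real j * (\<Lambda> * real l - ?a j l) else 0)
        + (\<Sum>i=1..N. if i = l then real l * (\<Lambda> * real j - ?a j l) else 0))"
      unfolding sum_distrib_right sum.distrib[symmetric] sum_distrib_left
      by (intro sum.cong refl) (auto simp: q_def algebra_simps)
    also have "\<dots> = \<Lambda> * real j * real l"
      unfolding S using jl by (simp add: algebra_simps)
    finally show ?thesis .
  qed
  obtain w where w0: "\<And>t i. \<lbrakk>0 \<le> t; i \<in> ?I\<rbrakk> \<Longrightarrow> 0 \<le> w t i"
    and init: "\<And>i. i \<in> ?I \<Longrightarrow> w 0 i = y i"
    and mass: "\<And>t. 0 \<le> t \<Longrightarrow> (\<Sum>i\<in>?I. real i * w t i) = \<rho>"
    and der: "\<And>t i. \<lbrakk>0 \<le> t; i \<in> ?I\<rbrakk> \<Longrightarrow> ((\<lambda>t. w t i) has_real_derivative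
        (\<Sum>j\<in>?I. \<Sum>l\<in>?I. q i j l * (w t j * w t l)) - \<Lambda> * \<rho> * w t i) (at t)"
  proof (rule wild_sum_solution[of ?I real q \<Lambda> y \<rho>])
    show "0 < \<Lambda>" using par N by (simp add: \<Lambda>_def)
  qed (use q0 q y0 \<rho> in \<open>auto simp: \<rho>_def\<close>)
  define u where "u = (\<lambda>t i. if i \<in> ?I then w t i else 0)"
  show thesis
  proof (rule that[of u])
    show "truncated_breakage A \<alpha> \<beta> B N u"
    proof (unfold_locales, fact+)
      show "0 \<le> u t i" if "0 \<le> t" for t i using w0 that by (simp add: u_def)
      show "u t i = 0" if "i \<notin> ?I" for t i using that by (auto simp: u_def)
      fix t :: real and i assume t: "0 \<le> t" and i: "i \<in> ?I"
      let ?G = "\<Sum>j=1..N. \<Sum>l=1..N. B j l i * ?a j l * w t j * w t l"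
      let ?L = "\<Sum>l=1..N. ?a i l * w t i * w t l"
      have loss: "(\<Sum>l\<in>?I. (\<Lambda> * real l - ?a i l) * (w t i * w t l)) = \<Lambda> * \<rho> * w t i - ?L"
        unfolding mass[OF t, symmetric] sum_distrib_left sum_distrib_right sum_subtractf[symmetric]
        by (intro sum.cong) (auto simp: algebra_simps)
      have 1: "(\<Sum>j\<in>?I. \<Sum>l\<in>?I. (if i = j then \<Lambda> * real l - ?a j l else 0) * (w t j * w t l))
          = \<Lambda> * \<rho> * w t i - ?L"
      proof -
        have "(\<Sum>j\<in>?I. \<Sum>l\<in>?I. (if i = j then \<Lambda> * real l - ?a j l else 0) * (w t j * w t l))
            = (\<Sum>j\<in>?I. if i = j then (\<Sum>l\<in>?I. (\<Lambda> * real l - ?a i l) * (w t i * w t l)) else 0)"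
          by (intro sum.cong) auto
        then show ?thesis using i loss by simp
      qed
      have 2: "(\<Sum>j\<in>?I. \<Sum>l\<in>?I. (if i = l then \<Lambda> * real j - ?a j l else 0) * (w t j * w t l))
          = \<Lambda> * \<rho> * w t i - ?L"
      proof -
        have "(\<Sum>j\<in>?I. \<Sum>l\<in>?I. (if i = l then \<Lambda> * real j - ?a j l else 0) * (w t j * w t l))
            = (\<Sum>l\<in>?I. \<Sum>j\<in>?I. (if i = l then \<Lambda> * real j - ?a j l else 0) * (w t j * w t l))"
          by (rule sum.swap)
        also have "\<dots> = (\<Sum>l\<in>?I. \<Sum>j\<in>?I. (if i = l then \<Lambda> * real j - ?a l j else 0) * (w t l * w t j))"
          by (intro sum.cong refl) (simp only: collision_kernel_commute mult.commute)
        finally show ?thesis using 1 by simp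
      qed
      have "(\<Sum>j\<in>?I. \<Sum>l\<in>?I. q i j l * (w t j * w t l))
          = (\<Sum>j\<in>?I. \<Sum>l\<in>?I. 1 / 2 * (B j l i * ?a j l * w t j * w t l
              + (if i = j then \<Lambda> * real l - ?a j l else 0) * (w t j * w t l)
              + (if i = l then \<Lambda> * real j - ?a j l else 0) * (w t j * w t l)))"
        by (intro sum.cong refl) (simp only: q_def distrib_right distrib_left mult.assoc)
      also have "\<dots> = 1 / 2 * (?G + (\<Lambda> * \<rho> * w t i - ?L) + (\<Lambda> * \<rho> * w t i - ?L))"
        unfolding sum_distrib_left[symmetric] sum.distrib 1 2 ..
      finally have eq: "(\<Sum>j\<in>?I. \<Sum>l\<in>?I. q i j l * (w t j * w t l)) - \<Lambda> * \<rho> * w t i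
          = 1 / 2 * ?G - ?L" by simp
      have "((\<lambda>t. u t i) has_real_derivative 1 / 2 * ?G - ?L) (at t)"
        using der[OF t i] i unfolding eq by (simp add: u_def)
      then show "((\<lambda>t. u t i) has_real_derivative
        1 / 2 * (\<Sum>j=1..N. \<Sum>l=1..N. B j l i * ?a j l * u t j * u t l)
        - (\<Sum>j=1..N. ?a i j * u t i * u t j)) (at t)"
        using i by (simp add: u_def)
    qed
    show "u 0 i = y i" if "i \<in> ?I" for i using init that by (simp add: u_def)
  qed
qed

section \<open>Moment interpolation and superlinear damping\<close>

text \<open>
  Hoelder's inequality for moments, from Young's inequality for each size after normalising both
  moments to one.
\<close>

lemma moment_log_convex:
  fixes w :: "nat \<Rightarrow> real"
  assumes w: "\<And>i. 0 \<le> w i" and s: "0 \<le> s" "s \<le> 1"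
  shows "(\<Sum>i=1..N. real i powr ((1 - s) * p + s * q) * w i)
    \<le> (\<Sum>i=1..N. real i powr p * w i) powr (1 - s) * (\<Sum>i=1..N. real i powr q * w i) powr s"
proof -
  define M where "M = (\<lambda>p. \<Sum>i=1..N. real i powr p * w i)"
  have Meq: "M p = (\<Sum>i=1..N. real i powr p * w i)" for p by (simp add: M_def)
  have M0: "0 \<le> M p" for p unfolding M_def by (intro sum_nonneg) (use w in auto)
  have "M ((1 - s) * p + s * q) \<le> M p powr (1 - s) * M q powr s"
  proof (cases "\<exists>i\<in>{1..N}. w i \<noteq> 0")
    case False
    then have "M ((1 - s) * p + s * q) = 0" unfolding M_def by (intro sum.neutral) auto
    then show ?thesis by simp
  next
    case True
    then obtain i where i: "i \<in> {1..N}" "w i > 0" using w by (metis less_eq_real_def)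
    have Mpos: "0 < M p" for p
      unfolding M_def by (rule sum_pos2[OF _ i(1)]) (use i w in auto)
    define X where "X = M p powr (1 - s) * M q powr s"
    have X: "0 < X" using Mpos[of p] Mpos[of q] by (simp add: X_def)
    have "M ((1 - s) * p + s * q) / X \<le> (\<Sum>i=1..N. (1 - s) * (real i powr p * w i / M p)
        + s * (real i powr q * w i / M q))"
      unfolding Meq[of "(1 - s) * p + s * q"] sum_divide_distrib
    proof (rule sum_mono)
      fix i assume "i \<in> {1..N}"
      then have i0: "0 < real i" by auto
      have "(real i powr p / M p) powr (1 - s) * (real i powr q / M q) powr s
          \<le> (1 - s) * (real i powr p / M p) + s * (real i powr q / M q)"
        using i0 Mpos s by (intro Youngs_inequality_0) auto
      moreover have "(real i powr p / M p) powr (1 - s) * (real i powr q / M q) powr s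
          = real i powr ((1 - s) * p + s * q) / X"
        using i0 Mpos[of p] Mpos[of q]
        by (simp add: powr_divide powr_powr X_def powr_add mult.commute)
      ultimately have "real i powr ((1 - s) * p + s * q) / X * w i
          \<le> ((1 - s) * (real i powr p / M p) + s * (real i powr q / M q)) * w i"
        using w by (intro mult_right_mono) auto
      then show "real i powr ((1 - s) * p + s * q) * w i / X
          \<le> (1 - s) * (real i powr p * w i / M p) + s * (real i powr q * w i / M q)"
        by (simp add: algebra_simps)
    qed
    also have "\<dots> = (1 - s) * ((\<Sum>i=1..N. real i powr p * w i) / M p)
        + s * ((\<Sum>i=1..N. real i powr q * w i) / M q)"
      by (simp only: sum.distrib sum_distrib_left[symmetric] sum_divide_distrib[symmetric])
    also have "\<dots> = (1 - s) * (M p / M p) + s * (M q / M q)"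
      by (simp only: Meq[symmetric])
    also have "\<dots> = 1" using Mpos[of p] Mpos[of q] by simp
    finally show ?thesis using X by (simp add: X_def field_simps)
  qed
  then show ?thesis by (simp add: M_def)
qed

lemma sublinear_absorbed:
  fixes K c \<theta> :: real
  assumes "0 < K" "0 < c" "0 \<le> \<theta>" "\<theta> < 1"
  obtains C where "0 \<le> C" "\<And>x. 1 \<le> x \<Longrightarrow> K * x powr \<theta> \<le> c * x + C"
proof
  define x0 where "x0 = (K / c) powr (1 / (1 - \<theta>))"
  show "0 \<le> K * x0 powr \<theta>" using assms by simp
  fix x :: real assume x: "1 \<le> x"
  show "K * x powr \<theta> \<le> c * x + K * x0 powr \<theta>"
  proof (cases "x \<le> x0")
    case True
    then have "K * x powr \<theta> \<le> K * x0 powr \<theta>"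
      using assms x by (intro mult_left_mono powr_mono2) auto
    then show ?thesis using assms x by (simp add: add_increasing)
  next
    case False
    then have "x0 powr (1 - \<theta>) \<le> x powr (1 - \<theta>)"
      using assms by (intro powr_mono2) (auto simp: x0_def)
    then have "K / c \<le> x powr (1 - \<theta>)"
      using assms by (simp add: x0_def powr_powr)
    then have "K * x powr \<theta> \<le> (c * x powr (1 - \<theta>)) * x powr \<theta>"
      using assms by (intro mult_right_mono) (auto simp: field_simps)
    also have "\<dots> = c * x" using x by (simp add: mult.assoc flip: powr_add)
    finally show ?thesis using assms by (simp add: add_increasing2)
  qed
qed

text \<open>
  The moment inequality in closed form. All moments of order \<open>p\<close> up to \<open>m + \<beta>\<close> are bounded by
  \<open>X\<close> to the power \<open>max 0 (p - 1) / (m + \<beta> - 1)\<close>, where \<open>X\<close> is the moment of order \<open>m + \<beta>\<close> plus one.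
  For the two products in the gain these exponents add up to \<open>\<theta>1\<close> and \<open>\<theta>2\<close>, both less than one. The
  constants must not depend on \<open>N\<close> or \<open>w\<close>, whence the order of quantifiers.
\<close>

lemma moment_dissipation:
  assumes A: "0 < A" and par: "\<alpha> \<le> \<beta>" "\<beta> \<le> 1" "0 < \<beta>" "\<alpha> < 1"
    and m: "1 < m" and \<epsilon>: "0 < \<epsilon>" and \<kappa>: "0 < \<kappa>" and \<rho>0: "0 < \<rho>\<^sub>0"
  obtains c C where "0 < c" "0 \<le> C"
    "\<And>N w M. \<lbrakk>\<And>i. 0 \<le> w i; \<And>p. M p = (\<Sum>i=1..N. real i powr p * w i); M 1 \<le> \<rho>\<^sub>1; \<rho>\<^sub>0 \<le> M 0\<rbrakk> \<Longrightarrow>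
      A * \<kappa> * (M (1 + \<alpha>) * M (m - 1 + \<beta>) + M (1 + \<beta>) * M (m - 1 + \<alpha>))
          - A * \<epsilon> * (M (m + \<beta>) * M \<alpha>)
      \<le> C - c * M m powr (1 + \<beta> / (m - 1))"
proof -
  define R where "R = max 1 \<rho>\<^sub>1"
  define r where "r = m + \<beta> - 1"
  define \<theta>1 where "\<theta>1 = (max 0 \<alpha> + max 0 (m - 2 + \<beta>)) / r"
  define \<theta>2 where "\<theta>2 = (max 0 \<beta> + max 0 (m - 2 + \<alpha>)) / r"
  define \<theta> where "\<theta> = max \<theta>1 \<theta>2"
  define s where "s = (if \<alpha> < 0 then - \<alpha> / (1 - \<alpha>) else 0)"
  define d where "d = min \<rho>\<^sub>0 ((\<rho>\<^sub>0 / R powr s) powr (1 / (1 - s)))"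
  define K where "K = 2 * A * \<kappa> * R\<^sup>2"
  define c0 where "c0 = A * \<epsilon> * d / 2"
  define e where "e = 1 + \<beta> / (m - 1)"
  have R: "1 \<le> R" "\<rho>\<^sub>1 \<le> R" by (auto simp: R_def)
  have r: "0 < r" using m par by (simp add: r_def)
  have \<theta>: "0 \<le> \<theta>" "\<theta> < 1"
    using r m par by (auto simp: \<theta>_def \<theta>1_def \<theta>2_def r_def max_def field_simps)
  have s: "0 \<le> s" "s < 1" using par by (auto simp: s_def field_simps)
  have d: "0 < d" using \<rho>0 R by (auto simp: d_def)
  have K: "0 < K" using A \<kappa> R by (simp add: K_def)
  have c0: "0 < c0" using A \<epsilon> d by (simp add: c0_def)
  obtain C where C: "0 \<le> C" "\<And>x. 1 \<le> x \<Longrightarrow> K * x powr \<theta> \<le> c0 * x + C"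
    using sublinear_absorbed[OF K c0 \<theta>] by blast
  have e: "0 < e" "r / (m - 1) = e" using m par by (auto simp: e_def r_def field_simps add_pos_pos)
  show thesis
  proof (rule that[of "c0 / R powr e" "C + 2 * c0"])
    show "0 < c0 / R powr e" "0 \<le> C + 2 * c0" using c0 R C by auto
    fix N w M
    assume w: "\<And>i. 0 \<le> w i" and M: "\<And>p. M p = (\<Sum>i=1..N. real i powr p * w i)"
      and \<rho>1: "M 1 \<le> \<rho>\<^sub>1" and M0: "\<rho>\<^sub>0 \<le> M 0"
    have Mnn: "0 \<le> M p" for p unfolding M by (intro sum_nonneg) (use w in auto)
    have Mmono: "M p \<le> M p'" if "p \<le> p'" for p p'
      unfolding M by (intro sum_mono mult_right_mono powr_mono) (use w that in auto)
    have Mconv: "M ((1 - s) * p + s * q) \<le> M p powr (1 - s) * M q powr s"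
      if "0 \<le> s" "s \<le> 1" for s p q
      unfolding M by (rule moment_log_convex) (use w that in auto)
    \<comment> \<open>Adding one avoids the power \<open>0 powr 0 = 0\<close>.\<close>
    define X where "X = 1 + M (m + \<beta>)"
    have X: "1 \<le> X" "M (m + \<beta>) \<le> X" using Mnn[of "m + \<beta>"] by (auto simp: X_def)
    have interp: "M p \<le> R * X powr (max 0 (p - 1) / r)" if "p \<le> m + \<beta>" for p
    proof (cases "p \<le> 1")
      case True
      then have "M p \<le> R" using Mmono[OF True] \<rho>1 R by simp
      moreover have "R * X powr (max 0 (p - 1) / r) = R"
        using True X by (subst max_absorb1) auto
      ultimately show ?thesis by linarith
    next
      case False
      define \<sigma> where "\<sigma> = (p - 1) / r"
      have \<sigma>: "0 \<le> \<sigma>" "\<sigma> \<le> 1" using False that r by (auto simp: \<sigma>_def r_def field_simps)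
      have "(1 - \<sigma>) * 1 + \<sigma> * (m + \<beta>) = 1 + \<sigma> * r" by (simp add: r_def algebra_simps)
      also have "\<dots> = p" using r by (simp add: \<sigma>_def)
      finally have "M p \<le> M 1 powr (1 - \<sigma>) * M (m + \<beta>) powr \<sigma>"
        using Mconv[OF \<sigma>, of 1 "m + \<beta>"] by simp
      also have "\<dots> \<le> R powr (1 - \<sigma>) * X powr \<sigma>"
        using \<sigma> \<rho>1 R X Mnn by (intro mult_mono powr_mono2) (auto intro: order_trans)
      also have "\<dots> \<le> R powr 1 * X powr \<sigma>"
        using \<sigma> R by (intro mult_right_mono powr_mono) auto
      finally show ?thesis using R False by (simp add: \<sigma>_def max_def)
    qed
    have prod: "M p * M q \<le> R\<^sup>2 * X powr \<theta>"
      if "p \<le> m + \<beta>" "q \<le> m + \<beta>" "(max 0 (p - 1) + max 0 (q - 1)) / r \<le> \<theta>" for p q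
    proof -
      have "M p * M q \<le> (R * X powr (max 0 (p - 1) / r)) * (R * X powr (max 0 (q - 1) / r))"
        using that Mnn R X by (intro mult_mono interp) auto
      also have "\<dots> = R\<^sup>2 * X powr ((max 0 (p - 1) + max 0 (q - 1)) / r)"
        by (simp add: power2_eq_square add_divide_distrib powr_add)
      also have "\<dots> \<le> R\<^sup>2 * X powr \<theta>"
        using that X by (intro mult_left_mono powr_mono) auto
      finally show ?thesis .
    qed
    have p1: "M (1 + \<alpha>) * M (m - 1 + \<beta>) \<le> R\<^sup>2 * X powr \<theta>"
    proof (rule prod)
      have "1 + \<alpha> - 1 = \<alpha>" "m - 1 + \<beta> - 1 = m - 2 + \<beta>" by auto
      then have "(max 0 (1 + \<alpha> - 1) + max 0 (m - 1 + \<beta> - 1)) / r = \<theta>1"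
        by (simp only: \<theta>1_def)
      then show "(max 0 (1 + \<alpha> - 1) + max 0 (m - 1 + \<beta> - 1)) / r \<le> \<theta>"
        by (simp only: \<theta>_def max.cobounded1 max.cobounded2)
    qed (use par m in auto)
    have p2: "M (1 + \<beta>) * M (m - 1 + \<alpha>) \<le> R\<^sup>2 * X powr \<theta>"
    proof (rule prod)
      have "1 + \<beta> - 1 = \<beta>" "m - 1 + \<alpha> - 1 = m - 2 + \<alpha>" by auto
      then have "(max 0 (1 + \<beta> - 1) + max 0 (m - 1 + \<alpha> - 1)) / r = \<theta>2"
        by (simp only: \<theta>2_def)
      then show "(max 0 (1 + \<beta> - 1) + max 0 (m - 1 + \<alpha> - 1)) / r \<le> \<theta>"
        by (simp only: \<theta>_def max.cobounded1 max.cobounded2)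
    qed (use par m in auto)
    \<comment> \<open>For negative \<open>\<alpha>\<close> the order \<open>0\<close> lies between \<open>\<alpha>\<close> and \<open>1\<close>, and \<open>s\<close> is its barycentric
      coordinate.\<close>
    have low: "d \<le> M \<alpha>"
    proof (cases "\<alpha> < 0")
      case False
      then show ?thesis using Mmono[of 0 \<alpha>] M0 by (auto simp: d_def)
    next
      case True
      have "(1 - s) * \<alpha> + s * 1 = 0" using True by (simp add: s_def field_simps)
      then have "M 0 \<le> M \<alpha> powr (1 - s) * M 1 powr s"
        using Mconv[of s \<alpha> 1] s by simp
      also have "\<dots> \<le> M \<alpha> powr (1 - s) * R powr s"
        using s \<rho>1 R Mnn by (intro mult_left_mono powr_mono2) (auto intro: order_trans)
      finally have "\<rho>\<^sub>0 / R powr s \<le> M \<alpha> powr (1 - s)" using M0 R by (simp add: field_simps)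
      then have "(\<rho>\<^sub>0 / R powr s) powr (1 / (1 - s)) \<le> (M \<alpha> powr (1 - s)) powr (1 / (1 - s))"
        using s \<rho>0 R by (intro powr_mono2) auto
      also have "\<dots> = M \<alpha>" using s Mnn by (simp add: powr_powr)
      finally show ?thesis by (simp add: d_def)
    qed
    have "A * \<kappa> * (M (1 + \<alpha>) * M (m - 1 + \<beta>) + M (1 + \<beta>) * M (m - 1 + \<alpha>))
        \<le> A * \<kappa> * (R\<^sup>2 * X powr \<theta> + R\<^sup>2 * X powr \<theta>)"
      using p1 p2 A \<kappa> by (intro mult_left_mono add_mono) auto
    also have "\<dots> = K * X powr \<theta>" by (simp add: K_def)
    also have "\<dots> \<le> c0 * X + C" using C X by simp
    finally have gain: "A * \<kappa> * (M (1 + \<alpha>) * M (m - 1 + \<beta>) + M (1 + \<beta>) * M (m - 1 + \<alpha>))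
        \<le> c0 * X + C" .
    have "A * \<epsilon> * (M (m + \<beta>) * d) \<le> A * \<epsilon> * (M (m + \<beta>) * M \<alpha>)"
      using A \<epsilon> low Mnn by (intro mult_left_mono) auto
    moreover have "A * \<epsilon> * (M (m + \<beta>) * d) = 2 * c0 * X - 2 * c0"
      by (simp add: c0_def X_def algebra_simps)
    moreover have "c0 / R powr e * M m powr e \<le> c0 * X"
    proof -
      have "M m \<le> R * X powr ((m - 1) / r)" using interp[of m] m par by simp
      then have "M m powr e \<le> (R * X powr ((m - 1) / r)) powr e"
        using e Mnn by (intro powr_mono2) auto
      also have "\<dots> = R powr e * X powr ((m - 1) / r * e)"
        using R X by (simp add: powr_mult powr_powr)
      also have "(m - 1) / r * e = 1" unfolding e(2)[symmetric] using r m by simp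
      finally have "M m powr e \<le> R powr e * X" using X by simp
      then show ?thesis using c0 R by (simp add: field_simps)
    qed
    ultimately show "A * \<kappa> * (M (1 + \<alpha>) * M (m - 1 + \<beta>) + M (1 + \<beta>) * M (m - 1 + \<alpha>))
          - A * \<epsilon> * (M (m + \<beta>) * M \<alpha>)
      \<le> C + 2 * c0 - c0 / R powr e * M m powr (1 + \<beta> / (m - 1))"
      using gain unfolding e_def[symmetric] by linarith
  qed
qed

text \<open>
  A function that cannot increase while positive stays non-positive: after the last time at which
  it is non-positive it would have to decrease from there.
\<close>

lemma nonpos_barrier:
  fixes h :: "real \<Rightarrow> real"
  assumes st: "s \<le> t" and h: "h s \<le> 0"
    and der: "\<And>\<tau>. \<lbrakk>s \<le> \<tau>; \<tau> \<le> t\<rbrakk> \<Longrightarrow> \<exists>D. (h has_real_derivative D) (at \<tau>) \<and> (0 < h \<tau> \<longrightarrow> D \<le> 0)"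
  shows "h t \<le> 0"
proof (rule ccontr)
  assume ht: "\<not> h t \<le> 0"
  define S where "S = {\<tau> \<in> {s..t}. h \<tau> \<le> 0}"
  have cont: "continuous_on {s..t} h"
    using der by (meson DERIV_isCont atLeastAtMost_iff continuous_at_imp_continuous_on)
  have "compact S"
  proof -
    have "S = {s..t} \<inter> h -` {..0}" by (auto simp: S_def)
    then show ?thesis
      using continuous_closed_preimage[OF cont, of "{..0}"]
      by (auto simp: compact_eq_bounded_closed intro: bounded_subset[of "{s..t}"])
  qed
  moreover have "s \<in> S" using st h by (simp add: S_def)
  ultimately obtain \<sigma> where \<sigma>: "\<sigma> \<in> S" "\<And>\<tau>. \<tau> \<in> S \<Longrightarrow> \<tau> \<le> \<sigma>"
    using compact_attains_sup[of S] by auto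
  have \<sigma>t: "\<sigma> < t" "s \<le> \<sigma>" using \<sigma>(1) ht by (auto simp: S_def order.strict_iff_order)
  have "h t \<le> h \<sigma>"
  proof (rule DERIV_nonpos_imp_decreasing_open[of \<sigma> t h])
    show "\<sigma> \<le> t" using \<sigma>t by simp
    show "continuous_on {\<sigma>..t} h" using cont \<sigma>t by (auto intro: continuous_on_subset)
    fix x assume x: "\<sigma> < x" "x < t"
    then have "x \<notin> S" using \<sigma>(2) by force
    then have "0 < h x" using x \<sigma>t by (auto simp: S_def)
    then show "\<exists>y. DERIV h x :> y \<and> y \<le> 0" using der[of x] x \<sigma>t by auto
  qed
  then show False using \<sigma>(1) ht by (simp add: S_def)
qed

lemma damped_le_max:
  fixes y :: "real \<Rightarrow> real"
  assumes c: "0 < c" and C: "0 \<le> C" and e: "0 < e"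
    and der: "\<And>t. 0 \<le> t \<Longrightarrow> \<exists>D. (y has_real_derivative D) (at t) \<and> D \<le> C - c * y t powr e"
    and t: "0 \<le> t"
  shows "y t \<le> max (y 0) ((C / c) powr (1 / e))"
proof -
  let ?K = "max (y 0) ((C / c) powr (1 / e))"
  have "y t - ?K \<le> 0"
  proof (rule nonpos_barrier[OF t])
    fix \<tau> :: real assume "0 \<le> \<tau>"
    then obtain D where D: "(y has_real_derivative D) (at \<tau>)" "D \<le> C - c * y \<tau> powr e"
      using der by blast
    have "D \<le> 0" if "0 < y \<tau> - ?K"
    proof -
      have "((C / c) powr (1 / e)) powr e \<le> y \<tau> powr e"
        using that e by (intro powr_mono2) auto
      then have "C / c \<le> y \<tau> powr e" using e c C by (simp add: powr_powr)
      then show ?thesis using D c by (simp add: field_simps)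
    qed
    moreover have "((\<lambda>\<tau>. y \<tau> - ?K) has_real_derivative D) (at \<tau>)"
      using D(1) by (auto intro!: derivative_eq_intros)
    ultimately show "\<exists>D. ((\<lambda>\<tau>. y \<tau> - ?K) has_real_derivative D) (at \<tau>) \<and> (0 < y \<tau> - ?K \<longrightarrow> D \<le> 0)"
      by blast
  qed simp
  then show ?thesis by simp
qed

text \<open>
  The bound is a supersolution that is infinite at \<open>t = 0\<close>, so it lies above \<open>y\<close> at small times
  whatever \<open>y 0\<close> is; this is the source of independence of the initial value.
\<close>

lemma damped_le_universal:
  fixes y :: "real \<Rightarrow> real"
  assumes c: "0 < c" and C: "0 \<le> C" and \<gamma>: "0 < \<gamma>"
    and der: "\<And>t. 0 \<le> t \<Longrightarrow> \<exists>D. (y has_real_derivative D) (at t) \<and> D \<le> C - c * y t powr (1 + \<gamma>)"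
    and t: "0 < t"
  shows "y t \<le> max 1 (((C + 1 / \<gamma>) / c) powr (1 / \<gamma>)) * (1 + 1 / t) powr (1 / \<gamma>)"
proof -
  define F where "F = max 1 (((C + 1 / \<gamma>) / c) powr (1 / \<gamma>))"
  define f where "f = (\<lambda>t. F * (1 + 1 / t) powr (1 / \<gamma>))"
  have F: "1 \<le> F" by (simp add: F_def)
  have cF: "C + 1 / \<gamma> \<le> c * F powr \<gamma>"
  proof -
    have "(((C + 1 / \<gamma>) / c) powr (1 / \<gamma>)) powr \<gamma> \<le> F powr \<gamma>"
      using \<gamma> by (intro powr_mono2) (auto simp: F_def)
    then have "(C + 1 / \<gamma>) / c \<le> F powr \<gamma>"
      using c C \<gamma> by (simp add: powr_powr)
    then show ?thesis using c by (simp add: field_simps)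
  qed
  have cont: "continuous_on {0..t} y"
    using der by (meson DERIV_isCont atLeastAtMost_iff continuous_at_imp_continuous_on)
  then obtain K where K: "0 < K" "\<And>\<tau>. \<tau> \<in> {0..t} \<Longrightarrow> y \<tau> \<le> K"
  proof -
    have "bounded (y ` {0..t})"
      by (intro compact_imp_bounded compact_continuous_image cont) auto
    then obtain K where "0 < K" "\<forall>x\<in>y ` {0..t}. norm x \<le> K" by (auto simp: bounded_pos)
    then show ?thesis using that[of K] by force
  qed
  \<comment> \<open>At time \<open>s\<close> the supersolution is above the maximum \<open>K\<close> of \<open>y\<close>.\<close>
  define s where "s = min t (1 / K powr \<gamma>)"
  have s: "0 < s" "s \<le> t" using K t by (auto simp: s_def)
  have "y t - f t \<le> 0"
  proof (rule nonpos_barrier[OF s(2)])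
    have "K powr \<gamma> \<le> 1 / s"
      using s K by (simp add: s_def field_simps min_def split: if_splits)
    then have "K \<le> (1 / s) powr (1 / \<gamma>)"
      using powr_mono2[of "1 / \<gamma>" "K powr \<gamma>" "1 / s"] \<gamma> K by (simp add: powr_powr)
    also have "\<dots> \<le> (1 + 1 / s) powr (1 / \<gamma>)"
      using s \<gamma> by (intro powr_mono2) auto
    also have "\<dots> \<le> f s"
      using F by (simp add: f_def mult_le_cancel_right1)
    finally show "y s - f s \<le> 0" using K(2)[of s] s by simp
  next
    fix \<tau> assume \<tau>: "s \<le> \<tau>" "\<tau> \<le> t"
    then have \<tau>0: "0 < \<tau>" using s by simp
    then obtain D where D: "(y has_real_derivative D) (at \<tau>)" "D \<le> C - c * y \<tau> powr (1 + \<gamma>)"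
      using der[of \<tau>] by auto
    define g where "g = 1 + 1 / \<tau>"
    have g: "1 \<le> g" "0 < g" using \<tau>0 by (auto simp: g_def add_pos_pos)
    let ?f' = "F * (1 / \<gamma> * g powr (1 / \<gamma> - 1) * - (1 / \<tau>\<^sup>2))"
    have f': "(f has_real_derivative ?f') (at \<tau>)"
      unfolding f_def g_def using \<tau>0
      by (auto intro!: derivative_eq_intros simp: add_pos_pos power2_eq_square)
    have "D - ?f' \<le> 0" if h: "0 < y \<tau> - f \<tau>"
    proof -
      have g1: "1 \<le> g powr (1 / \<gamma> + 1)" using g \<gamma> by (intro ge_one_powr_ge_zero) auto
      have "f \<tau> powr (1 + \<gamma>) = F powr (1 + \<gamma>) * g powr (1 / \<gamma> * (1 + \<gamma>))"
        using F g by (simp add: f_def powr_mult powr_powr flip: g_def)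
      also have "1 / \<gamma> * (1 + \<gamma>) = 1 / \<gamma> + 1" using \<gamma> by (simp add: field_simps)
      finally have fe: "f \<tau> powr (1 + \<gamma>) = F * F powr \<gamma> * g powr (1 / \<gamma> + 1)"
        using F by (simp add: powr_add)
      have "C * 1 * 1 \<le> C * F * g powr (1 / \<gamma> + 1)"
        using C F g1 by (intro mult_mono) auto
      moreover have "- ?f' \<le> (1 / \<gamma>) * F * g powr (1 / \<gamma> + 1)"
      proof -
        have "1 / \<tau>\<^sup>2 \<le> g\<^sup>2"
          using \<tau>0 power_mono[of "1 / \<tau>" g 2] by (simp add: g_def power_one_over)
        then have "g powr (1 / \<gamma> - 1) * (1 / \<tau>\<^sup>2) \<le> g powr (1 / \<gamma> - 1) * g powr 2"
          using g by (intro mult_left_mono) auto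
        also have "\<dots> = g powr (1 / \<gamma> - 1 + 2)" by (simp only: powr_add)
        also have "1 / \<gamma> - 1 + 2 = 1 / \<gamma> + 1" by simp
        finally have "F * (1 / \<gamma>) * (g powr (1 / \<gamma> - 1) * (1 / \<tau>\<^sup>2)) \<le> F * (1 / \<gamma>) * g powr (1 / \<gamma> + 1)"
          using F \<gamma> by (intro mult_left_mono) auto
        then show ?thesis by (simp add: ac_simps)
      qed
      ultimately have "C - ?f' \<le> (C + 1 / \<gamma>) * (F * g powr (1 / \<gamma> + 1))"
        by (simp add: algebra_simps)
      also have "\<dots> \<le> (c * F powr \<gamma>) * (F * g powr (1 / \<gamma> + 1))"
        using cF F by (intro mult_right_mono) auto
      also have "\<dots> = c * f \<tau> powr (1 + \<gamma>)" by (simp add: fe)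
      also have "\<dots> \<le> c * y \<tau> powr (1 + \<gamma>)"
        using c \<gamma> h F by (intro mult_left_mono powr_mono2) (auto simp: f_def)
      finally show ?thesis using D(2) by linarith
    qed
    moreover have "((\<lambda>\<tau>. y \<tau> - f \<tau>) has_real_derivative D - ?f') (at \<tau>)"
      by (intro DERIV_diff D f')
    ultimately show "\<exists>D. ((\<lambda>\<tau>. y \<tau> - f \<tau>) has_real_derivative D) (at \<tau>) \<and>
        (0 < y \<tau> - f \<tau> \<longrightarrow> D \<le> 0)" by blast
  qed
  then show ?thesis by (simp add: f_def F_def)
qed

section \<open>Uniform bounds and compactness\<close>

lemma truncated_moment_bounds:
  assumes par: "0 < A" "\<alpha> \<le> \<beta>" "\<beta> \<le> 1" "0 < \<beta>" "\<alpha> < 1"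
    and m: "1 < m" and \<epsilon>0: "0 < e" and \<kappa>0: "0 < k" and \<rho>0: "0 < \<rho>\<^sub>0"
  obtains F \<mu> where "0 < F" "0 < \<mu>"
    "\<And>N B w \<epsilon> \<kappa> t. \<lbrakk>truncated_breakage A \<alpha> \<beta> B N w; daughter_B2 B \<epsilon> \<kappa>; daughter_B3 B; \<epsilon> m = e; \<kappa> m = k;
        truncated_breakage.M N w 1 0 \<le> \<rho>\<^sub>1; \<rho>\<^sub>0 \<le> truncated_breakage.M N w 0 0; 0 < t\<rbrakk> \<Longrightarrow>
      truncated_breakage.M N w m t \<le> F * (1 + 1 / t) powr ((m - 1) / \<beta>) \<and>
      truncated_breakage.M N w m t \<le> max (truncated_breakage.M N w m 0) \<mu>"
proof (rule moment_dissipation[OF par m \<epsilon>0 \<kappa>0 \<rho>0, where ?\<rho>\<^sub>1 = \<rho>\<^sub>1])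
  fix c C assume c: "0 < c" and C: "0 \<le> C" and
    diss: "\<And>N w M. \<lbrakk>\<And>i. 0 \<le> w i; \<And>p. M p = (\<Sum>i=1..N. real i powr p * w i); M 1 \<le> \<rho>\<^sub>1; \<rho>\<^sub>0 \<le> M 0\<rbrakk> \<Longrightarrow>
      A * k * (M (1 + \<alpha>) * M (m - 1 + \<beta>) + M (1 + \<beta>) * M (m - 1 + \<alpha>))
          - A * e * (M (m + \<beta>) * M \<alpha>)
      \<le> C - c * M m powr (1 + \<beta> / (m - 1))"
  define \<gamma> where "\<gamma> = \<beta> / (m - 1)"
  have \<gamma>: "0 < \<gamma>" "1 / \<gamma> = (m - 1) / \<beta>" using par m by (auto simp: \<gamma>_def)
  show thesis
  proof (rule that[of "max 1 (((C + 1 / \<gamma>) / c) powr (1 / \<gamma>))" "max 1 ((C / c) powr (1 / (1 + \<gamma>)))"])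
    fix N B w \<epsilon> \<kappa> and t :: real
    assume w: "truncated_breakage A \<alpha> \<beta> B N w" and B2: "daughter_B2 B \<epsilon> \<kappa>" and B3: "daughter_B3 B"
      and \<epsilon>: "\<epsilon> m = e" and \<kappa>: "\<kappa> m = k"
      and \<rho>1: "truncated_breakage.M N w 1 0 \<le> \<rho>\<^sub>1" and M0: "\<rho>\<^sub>0 \<le> truncated_breakage.M N w 0 0" and t: "0 < t"
    interpret truncated_breakage A \<alpha> \<beta> B N w by (rule w)
    have der: "\<exists>D. (M m has_real_derivative D) (at t) \<and> D \<le> C - c * M m t powr (1 + \<gamma>)" if t: "0 \<le> t" for t
    proof -
      obtain D where D: "(M m has_real_derivative D) (at t)"
        "D \<le> A * \<kappa> m * (M (1 + \<alpha>) t * M (m - 1 + \<beta>) t + M (1 + \<beta>) t * M (m - 1 + \<alpha>) t)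
          - A * \<epsilon> m * (M (m + \<beta>) t * M \<alpha> t)"
        using moment_derivative_le[OF B2 m t] .
      note D(2)
      also have "A * \<kappa> m * (M (1 + \<alpha>) t * M (m - 1 + \<beta>) t + M (1 + \<beta>) t * M (m - 1 + \<alpha>) t)
          - A * \<epsilon> m * (M (m + \<beta>) t * M \<alpha> t) \<le> C - c * M m t powr (1 + \<beta> / (m - 1))"
        unfolding \<epsilon> \<kappa>
        by (rule diss[where w = "w t" and M = "\<lambda>p. M p t" and N = N])
           (use nonneg[OF t] \<rho>1 M0 mass_conservation[OF t] number_nondecreasing[OF B3 t]
             in \<open>auto simp: M_def\<close>)
      finally show ?thesis using D(1) by (auto simp: \<gamma>_def)
    qed
    have "M m t \<le> max 1 (((C + 1 / \<gamma>) / c) powr (1 / \<gamma>)) * (1 + 1 / t) powr (1 / \<gamma>)"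
      by (rule damped_le_universal[OF c C \<gamma>(1) der t])
    moreover have "M m t \<le> max (M m 0) ((C / c) powr (1 / (1 + \<gamma>)))"
      by (rule damped_le_max[OF c C _ der]) (use \<gamma> t in auto)
    ultimately show "M m t \<le> max 1 (((C + 1 / \<gamma>) / c) powr (1 / \<gamma>)) * (1 + 1 / t) powr ((m - 1) / \<beta>) \<and>
      M m t \<le> max (M m 0) (max 1 ((C / c) powr (1 / (1 + \<gamma>))))"
      using \<gamma> by auto
  qed auto
qed

text \<open>
  Tannery's theorem in the form in which the bound holds for all terms of the series at once.
\<close>

lemma suminf_tendsto_dominated:
  fixes a :: "nat \<Rightarrow> 'b \<Rightarrow> real"
  assumes "\<And>k. ((\<lambda>n. a k n) \<longlongrightarrow> b k) F" "eventually (\<lambda>n. \<forall>k. \<bar>a k n\<bar> \<le> M k) F" "summable M" "F \<noteq> bot"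
  shows "summable (\<lambda>k. \<bar>b k\<bar>)" "((\<lambda>n. \<Sum>k. a k n) \<longlongrightarrow> (\<Sum>k. b k)) F"
proof -
  have "eventually (\<lambda>(k,n). norm (a k n) \<le> M k) (at_top \<times>\<^sub>F F)"
    using assms(2) unfolding eventually_prod_filter
    by (intro exI[of _ "\<lambda>_. True"] exI[of _ "\<lambda>n. \<forall>k. \<bar>a k n\<bar> \<le> M k"]) auto
  from tannerys_theorem[OF assms(1) this assms(3,4)]
  show "summable (\<lambda>k. \<bar>b k\<bar>)" "((\<lambda>n. \<Sum>k. a k n) \<longlongrightarrow> (\<Sum>k. b k)) F" by auto
qed

text \<open>
  A diagonal sequence converges at all rational times, and the Lipschitz bound carries convergence
  over to all positive times. Time zero, where no Lipschitz bound is assumed, is itself rational.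
\<close>

lemma pointwise_convergent_subsequence:
  fixes v :: "nat \<Rightarrow> real \<Rightarrow> nat \<Rightarrow> real"
  assumes bnd: "\<And>n t i. 0 \<le> t \<Longrightarrow> \<bar>v n t i\<bar> \<le> K"
    and lip: "\<And>s. 0 < s \<Longrightarrow> \<exists>L. \<forall>n i t t'. s \<le> t \<longrightarrow> s \<le> t' \<longrightarrow> \<bar>v n t i - v n t' i\<bar> \<le> L * \<bar>t - t'\<bar>"
  obtains r w where "strict_mono r" "\<And>t i. 0 \<le> t \<Longrightarrow> (\<lambda>n. v (r n) t i) \<longlonglongrightarrow> w t i"
proof -
  define S :: "(real \<times> nat) set" where "S = (\<rat> \<inter> {0..}) \<times> (UNIV :: nat set)"
  have "countable S" unfolding S_def
    by (intro countable_SIGMA countable_Int1 countable_rat) auto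
  then obtain r where r: "strict_mono (r :: nat \<Rightarrow> nat)"
    "\<And>x. x \<in> S \<Longrightarrow> \<exists>l. (\<lambda>n. (\<lambda>(t, i). v (r n) t i) x) \<longlonglongrightarrow> l"
  proof (rule function_convergent_subsequence[where f = "\<lambda>n (t, i). v n t i" and M = K])
    show "norm ((\<lambda>(t, i). v n t i) x) \<le> K" if "x \<in> S" for n x
      using that bnd by (auto simp: S_def)
  qed blast
  have "convergent (\<lambda>n. v (r n) t i)" if t: "0 \<le> t" for t i
  proof (cases "t = 0")
    case True
    then show ?thesis using r(2)[of "(0, i)"] by (auto simp: S_def convergent_def)
  next
    case False
    then have t: "0 < t" using t by simp
    obtain L where L: "\<And>n i \<tau> \<tau>'. t / 2 \<le> \<tau> \<Longrightarrow> t / 2 \<le> \<tau>' \<Longrightarrow> \<bar>v n \<tau> i - v n \<tau>' i\<bar> \<le> L * \<bar>\<tau> - \<tau>'\<bar>"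
      using lip[OF half_gt_zero[OF t]] by blast
    have "Cauchy (\<lambda>n. v (r n) t i)"
    proof (rule metric_CauchyI)
      fix e :: real assume e: "0 < e"
      define \<delta> where "\<delta> = e / (3 * (\<bar>L\<bar> + 1))"
      have \<delta>: "0 < \<delta>" using e by (simp add: \<delta>_def)
      obtain q where q: "q \<in> \<rat>" "t < q" "q < t + \<delta>"
        using Rats_dense_in_real[of t "t + \<delta>"] \<delta> by auto
      have close: "\<bar>v n t i - v n q i\<bar> < e / 3" for n
      proof -
        have "\<bar>v n t i - v n q i\<bar> \<le> L * \<bar>t - q\<bar>" using q t by (intro L) auto
        also have "\<dots> \<le> (\<bar>L\<bar> + 1) * \<bar>t - q\<bar>" by (intro mult_right_mono) auto
        also have "\<dots> < (\<bar>L\<bar> + 1) * \<delta>" using q by (intro mult_strict_left_mono) auto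
        also have "\<dots> = e / 3" by (simp add: \<delta>_def field_simps)
        finally show ?thesis .
      qed
      obtain l where "(\<lambda>n. v (r n) q i) \<longlonglongrightarrow> l"
        using r(2)[of "(q, i)"] q t by (auto simp: S_def)
      then have "Cauchy (\<lambda>n. v (r n) q i)" by (rule LIMSEQ_imp_Cauchy)
      then obtain n0 where n0: "\<And>m n. m \<ge> n0 \<Longrightarrow> n \<ge> n0 \<Longrightarrow> dist (v (r m) q i) (v (r n) q i) < e / 3"
        using metric_CauchyD[of "\<lambda>n. v (r n) q i" "e / 3"] e by fastforce
      show "\<exists>M. \<forall>m\<ge>M. \<forall>n\<ge>M. dist (v (r m) t i) (v (r n) t i) < e"
      proof (intro exI allI impI)
        fix m n assume "n0 \<le> m" "n0 \<le> n"
        then show "dist (v (r m) t i) (v (r n) t i) < e"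
          using n0[of m n] close[of "r m"] close[of "r n"] unfolding dist_real_def by linarith
      qed
    qed
    then show ?thesis by (rule Cauchy_convergent)
  qed
  then show thesis
    using that[of r "\<lambda>t i. lim (\<lambda>n. v (r n) t i)"] r(1) by (simp add: convergent_LIMSEQ_iff)
qed

text \<open>
  The decay of order five is strong enough to make the gain summable over total sizes \<open>s\<close>: the product
  \<open>j k\<close> with \<open>j + k = s\<close> is at least \<open>s / 2\<close> and occurs to the power \<open>- 4\<close>, while the number of
  daughters and the number of pairs contribute a factor \<open>s\<close> each.
\<close>

lemma gain_term_decay:
  assumes A: "0 < A" "\<alpha> \<le> 1" "\<beta> \<le> 1" and B1: "daughter_B1 B"
    and u: "\<And>j. 1 \<le> j \<Longrightarrow> 0 \<le> u j" "\<And>j. 1 \<le> j \<Longrightarrow> real j ^ 5 * u j \<le> C" and i: "1 \<le> i"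
  shows "0 \<le> gain_term (collision_kernel A \<alpha> \<beta>) B u i s"
    "gain_term (collision_kernel A \<alpha> \<beta>) B u i s \<le> 32 * A * C\<^sup>2 * inverse (real s ^ 2)"
proof -
  let ?a = "collision_kernel A \<alpha> \<beta>"
  show "0 \<le> gain_term ?a B u i s"
    unfolding gain_term_def
    by (intro sum_nonneg mult_nonneg_nonneg daughter_nonneg[OF B1] collision_kernel_nonneg u(1))
       (use A i in auto)
  have C: "0 \<le> C" using u(1)[of 1] u(2)[of 1] by simp
  have inv_power: "x * inverse (x ^ m) = inverse (x ^ n)" if "m = Suc n" "0 < x" for x :: real and m n
    using that by (simp add: field_simps)
  show "gain_term ?a B u i s \<le> 32 * A * C\<^sup>2 * inverse (real s ^ 2)"
  proof (cases "2 \<le> s")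
    case False
    then have "gain_term ?a B u i s = 0" by (simp add: gain_term_def)
    then show ?thesis using A by simp
  next
    case s: True
    have "B (s - k) k i * ?a (s - k) k * u (s - k) * u k \<le> 32 * A * C\<^sup>2 * inverse (real s ^ 3)"
      if k: "k \<in> {1..s - 1}" for k
    proof -
      define j where "j = s - k"
      have j: "1 \<le> j" "j + k = s" "1 \<le> k" using k by (auto simp: j_def)
      define P where "P = real j * real k"
      have P: "0 < P" using j by (simp add: P_def)
      have P_ge: "real s / 2 \<le> P"
      proof -
        have "0 \<le> (real j - 1) * (real k - 1)" using j by (intro mult_nonneg_nonneg) auto
        moreover have "real s = real j + real k" using j(2) by linarith
        ultimately have "real s - 1 \<le> P" by (simp add: P_def algebra_simps)
        then show ?thesis using s by simp
      qed
      have uj: "u n \<le> C / real n ^ 5" if "1 \<le> n" for n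
        using u(2)[OF that] that by (simp add: field_simps)
      have "B j k i * ?a j k * u j * u k
          \<le> real (j + k) * (2 * A * real j * real k) * (C / real j ^ 5) * (C / real k ^ 5)"
      proof (intro mult_mono)
        show "B j k i \<le> real (j + k)" by (rule daughter_le[OF B1]) (use j i in auto)
        show "?a j k \<le> 2 * A * real j * real k" by (rule collision_kernel_le) (use A in auto)
        show "0 \<le> ?a j k" by (rule collision_kernel_nonneg) (use A in auto)
        show "u j \<le> C / real j ^ 5" "u k \<le> C / real k ^ 5" "0 \<le> u j" "0 \<le> u k"
          using u(1) uj j by blast+
        have nonneg: "0 \<le> real j" "0 \<le> real k" "0 \<le> 2 * A" "0 \<le> C / real j ^ 5"
          using A C by auto
        show "0 \<le> real (j + k) * (2 * A * real j * real k)"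
          by (intro mult_nonneg_nonneg nonneg of_nat_0_le_iff)
        then show "0 \<le> real (j + k) * (2 * A * real j * real k) * (C / real j ^ 5)"
          by (rule mult_nonneg_nonneg) (rule nonneg)
      qed simp
      also have "\<dots> = 2 * A * C\<^sup>2 * real (j + k) * inverse (P ^ 4)"
      proof -
        have regroup: "z * (2 * A * x * y) * (C / x ^ 5) * (C / y ^ 5)
            = 2 * A * C\<^sup>2 * z * ((x * inverse (x ^ 5)) * (y * inverse (y ^ 5)))" for x y z :: real
          by (simp add: divide_inverse power2_eq_square)
        have "real (j + k) * (2 * A * real j * real k) * (C / real j ^ 5) * (C / real k ^ 5)
            = 2 * A * C\<^sup>2 * real (j + k) * ((real j * inverse (real j ^ 5)) * (real k * inverse (real k ^ 5)))"
          by (rule regroup)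
        also have "real j * inverse (real j ^ 5) = inverse (real j ^ 4)"
          by (rule inv_power) (use j in auto)
        also have "real k * inverse (real k ^ 5) = inverse (real k ^ 4)"
          by (rule inv_power) (use j in auto)
        finally show ?thesis by (simp only: P_def power_mult_distrib inverse_mult_distrib)
      qed
      also have "\<dots> = 2 * A * C\<^sup>2 * real s * inverse (P ^ 4)" by (simp only: j(2))
      also have "\<dots> \<le> 2 * A * C\<^sup>2 * real s * inverse ((real s / 2) ^ 4)"
        using A P P_ge s by (intro mult_left_mono le_imp_inverse_le power_mono) auto
      also have "\<dots> = 32 * A * C\<^sup>2 * inverse (real s ^ 3)"
      proof -
        have "inverse ((x / 2) ^ 4) = 16 * inverse (x ^ 4)" for x :: real
        proof -
          have "(2::real) ^ 4 = 16" by simp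
          then show ?thesis
            by (simp only: divide_inverse power_mult_distrib inverse_mult_distrib power_inverse
                inverse_inverse_eq mult.commute)
        qed
        then have "inverse ((real s / 2) ^ 4) = 16 * inverse (real s ^ 4)" .
        moreover have "real s * inverse (real s ^ 4) = inverse (real s ^ 3)"
          by (rule inv_power) (use s in auto)
        moreover have "2 * A * C\<^sup>2 * real s * (16 * inverse (real s ^ 4))
            = 32 * A * C\<^sup>2 * (real s * inverse (real s ^ 4))" by simp
        ultimately show ?thesis by metis
      qed
      finally show ?thesis unfolding j_def .
    qed
    then have "gain_term ?a B u i s \<le> (\<Sum>k=1..s - 1. 32 * A * C\<^sup>2 * inverse (real s ^ 3))"
      unfolding gain_term_def by (rule sum_mono)
    also have "\<dots> = real (s - 1) * (32 * A * C\<^sup>2 * inverse (real s ^ 3))" by simp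
    also have "\<dots> \<le> real s * (32 * A * C\<^sup>2 * inverse (real s ^ 3))"
      using A by (intro mult_right_mono) auto
    also have "\<dots> = 32 * A * C\<^sup>2 * inverse (real s ^ 2)"
    proof -
      have "real s * inverse (real s ^ 3) = inverse (real s ^ 2)"
        by (rule inv_power) (use s in auto)
      moreover have "real s * (32 * A * C\<^sup>2 * inverse (real s ^ 3))
          = 32 * A * C\<^sup>2 * (real s * inverse (real s ^ 3))"
        by (rule mult.left_commute)
      ultimately show ?thesis by metis
    qed
    finally show ?thesis .
  qed
qed

section \<open>Passage to the limit\<close>

lemma moment_term_le:
  assumes "real i ^ 5 * u \<le> C" "0 \<le> u" "p \<le> 3" "1 \<le> i"
  shows "real i powr p * u \<le> C * inverse (real i ^ 2)"
proof -
  have "real i powr p \<le> real i powr 3" using assms by (intro powr_mono) auto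
  also have "\<dots> = real i ^ 5 * inverse (real i ^ 2)"
    using assms by (simp add: field_simps flip: power_add)
  finally have "real i powr p * u \<le> (real i ^ 5 * inverse (real i ^ 2)) * u"
    using assms by (intro mult_right_mono) auto
  also have "\<dots> = (real i ^ 5 * u) * inverse (real i ^ 2)" by simp
  also have "\<dots> \<le> C * inverse (real i ^ 2)" using assms by (intro mult_right_mono) auto
  finally show ?thesis .
qed

lemma summable_inverse_square: "summable (\<lambda>i. C * inverse (real i ^ 2))"
  by (intro summable_mult inverse_power_summable) auto

text \<open>
  Unordered sums over an index set are replaced by series over all natural numbers throughout, since
  the terms outside the index set vanish.
\<close>

lemma infsum_eq_suminf_nonneg:
  fixes f :: "nat \<Rightarrow> real"
  assumes f: "\<And>n. n \<in> S \<Longrightarrow> 0 \<le> f n" "\<And>n. n \<notin> S \<Longrightarrow> f n = 0" and summ: "summable f"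
  shows "f summable_on S" "infsum f S = suminf f"
proof -
  have "0 \<le> f n" for n using f[of n] by (cases "n \<in> S") auto
  then have "(f has_sum suminf f) UNIV"
    by (intro sums_nonneg_imp_has_sum summable_sums summ)
  then have "(f has_sum suminf f) S"
    by (subst has_sum_cong_neutral[of UNIV S f f]) (use f in auto)
  then show "f summable_on S" "infsum f S = suminf f"
    by (auto simp: summable_on_def infsumI)
qed

lemma moment_eq_suminf:
  assumes "\<And>i. 1 \<le> i \<Longrightarrow> 0 \<le> u i" "summable (\<lambda>i. real i powr \<gamma> * u i)"
  shows "u \<in> Y_space \<gamma>" "moment \<gamma> u = (\<Sum>i. real i powr \<gamma> * u i)"
proof -
  have *: "(\<lambda>i. real i powr \<gamma> * u i) summable_on {1..}"
    "(\<Sum>\<^sub>\<infinity>i\<in>{1..}. real i powr \<gamma> * u i) = (\<Sum>i. real i powr \<gamma> * u i)"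
    by (rule infsum_eq_suminf_nonneg; use assms in \<open>auto simp: not_le\<close>)+
  then show "moment \<gamma> u = (\<Sum>i. real i powr \<gamma> * u i)" by (simp add: moment_def)
  show "u \<in> Y_space \<gamma>"
    unfolding Y_space_def mem_Collect_eq using *(1)
    by (rule summable_on_cong[THEN iffD1, rotated]) (use assms in auto)
qed

lemma Y_space_summable:
  assumes "u \<in> Y_space \<gamma>" "\<And>i. 1 \<le> i \<Longrightarrow> 0 \<le> u i"
  shows "summable (\<lambda>i. real i powr \<gamma> * u i)"
proof -
  have "(\<lambda>i. real i powr \<gamma> * u i) summable_on {1..}"
    using assms(1) unfolding Y_space_def mem_Collect_eq
    by (rule summable_on_cong[THEN iffD1, rotated]) (use assms in auto)
  then have "(\<lambda>i. real i powr \<gamma> * u i) summable_on UNIV"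
    by (rule summable_on_cong_neutral[THEN iffD1, rotated -1]) (auto simp: not_le)
  then show ?thesis by (rule summable_on_imp_summable)
qed

lemma summable_lower_moment:
  assumes u: "\<And>i. 1 \<le> i \<Longrightarrow> 0 \<le> u i" and q: "summable (\<lambda>i. real i powr q * u i)" and pq: "p \<le> q"
  shows "summable (\<lambda>i. real i powr p * u i)"
proof (rule summable_comparison_test'[OF q])
  show "norm (real i powr p * u i) \<le> real i powr q * u i" for i
  proof (cases "i = 0")
    case False
    then have "real i powr p * u i \<le> real i powr q * u i"
      using u[of i] pq by (intro mult_right_mono powr_mono) auto
    then show ?thesis using False u[of i] by simp
  qed simp
qed

text \<open>
  A pointwise limit of solutions of truncated systems. The hypothesis \<open>moment5\<close> makes series converge
  uniformly in \<open>n\<close> at positive times; conservation of mass does this near time zero.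
\<close>

locale breakage_limit =
  fixes A \<alpha> \<beta> :: real and B :: "nat \<Rightarrow> nat \<Rightarrow> nat \<Rightarrow> real" and N :: "nat \<Rightarrow> nat"
    and v :: "nat \<Rightarrow> real \<Rightarrow> nat \<Rightarrow> real" and w :: "real \<Rightarrow> nat \<Rightarrow> real" and y :: "nat \<Rightarrow> real"
  assumes B1: "daughter_B1 B"
    and approx: "\<And>n. truncated_breakage A \<alpha> \<beta> (shatter_above (N n) B) (N n) (v n)"
    and N_top: "filterlim N at_top sequentially"
    and init: "\<And>n i. i \<in> {1..N n} \<Longrightarrow> v n 0 i = y i"
    and y_nonneg: "\<And>i. 1 \<le> i \<Longrightarrow> 0 \<le> y i"
    and y_summable: "summable (\<lambda>i. real i * y i)"
    and conv: "\<And>t i. 0 \<le> t \<Longrightarrow> (\<lambda>n. v n t i) \<longlonglongrightarrow> w t i"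
    and moment5: "\<And>s. 0 < s \<Longrightarrow> \<exists>C. \<forall>n \<tau>. s \<le> \<tau> \<longrightarrow> truncated_breakage.M (N n) (v n) 5 \<tau> \<le> C"
begin

abbreviation a where "a \<equiv> collision_kernel A \<alpha> \<beta>"

abbreviation Mv :: "nat \<Rightarrow> real \<Rightarrow> real \<Rightarrow> real" where
  "Mv n \<equiv> truncated_breakage.M (N n) (v n)"

lemma Mv_eq: "Mv n p t = (\<Sum>i=1..N n. real i powr p * v n t i)"
  using truncated_breakage.M_def[OF approx] .

lemmas A = truncated_breakage.A[OF approx] and \<alpha>1 = truncated_breakage.\<alpha>1[OF approx]
  and \<beta>1 = truncated_breakage.\<beta>1[OF approx]
  and a_le = truncated_breakage.a_le[OF approx] and a_nonneg = truncated_breakage.a_nonneg[OF approx]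

lemma N_ge: "\<forall>\<^sub>F n in sequentially. K \<le> N n"
  using N_top unfolding filterlim_at_top by blast

lemma v_nonneg: "0 \<le> t \<Longrightarrow> 0 \<le> v n t i"
  by (rule truncated_breakage.nonneg[OF approx])

lemma w_nonneg: "0 \<le> t \<Longrightarrow> 0 \<le> w t i"
  by (rule LIMSEQ_le_const[OF conv]) (auto simp: v_nonneg)

lemma w_zero: "0 \<le> t \<Longrightarrow> w t 0 = 0"
  using conv[of t 0] truncated_breakage.supp[OF approx, of 0] by (simp add: LIMSEQ_const_iff)

lemma w_init: "1 \<le> i \<Longrightarrow> w 0 i = y i"
proof -
  assume i: "1 \<le> i"
  have "\<forall>\<^sub>F n in sequentially. v n 0 i = y i"
    using N_ge[of i] by eventually_elim (use i init in auto)
  then have "(\<lambda>n. v n 0 i) \<longlonglongrightarrow> y i" by (rule tendsto_eventually)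
  then show ?thesis using conv[of 0 i] LIMSEQ_unique by blast
qed

definition \<rho> where "\<rho> = (\<Sum>i. real i * y i)"

lemma y_term_nonneg: "0 \<le> real i * y i"
  using y_nonneg[of i] by (cases "i = 0") auto

lemma Mv1_le: "Mv n 1 0 \<le> \<rho>"
proof -
  have "Mv n 1 0 = (\<Sum>i=1..N n. real i * y i)"
    unfolding Mv_eq using init by (intro sum.cong) auto
  also have "\<dots> \<le> \<rho>"
    unfolding \<rho>_def by (rule sum_le_suminf[OF y_summable]) (use y_term_nonneg in auto)
  finally show ?thesis .
qed

lemma Mv1_nonneg: "0 \<le> Mv n 1 0"
  by (rule truncated_breakage.M_nonneg[OF approx]) simp

lemma \<rho>_nonneg: "0 \<le> \<rho>"
  unfolding \<rho>_def by (rule suminf_nonneg[OF y_summable y_term_nonneg])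

lemma decay_v:
  assumes s: "0 < s"
  obtains C where "\<And>n \<tau> i. s \<le> \<tau> \<Longrightarrow> real i ^ 5 * v n \<tau> i \<le> C"
proof -
  obtain C where C: "\<And>n \<tau>. s \<le> \<tau> \<Longrightarrow> Mv n 5 \<tau> \<le> C"
    using moment5[OF s] by blast
  have "real i ^ 5 * v n \<tau> i \<le> C" if "s \<le> \<tau>" for n \<tau> i
    using truncated_breakage.le_M[OF approx, of \<tau> i 5 n] C[OF that, of n] that s by simp
  then show thesis by (rule that)
qed

lemma decay_w:
  assumes "\<And>n \<tau> i. s \<le> \<tau> \<Longrightarrow> real i ^ 5 * v n \<tau> i \<le> C" "0 < s" "s \<le> \<tau>"
  shows "real i ^ 5 * w \<tau> i \<le> C"
  by (rule LIMSEQ_le_const2[OF tendsto_mult_left[OF conv]]) (use assms in auto)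

lemma Mv_suminf: "Mv n p t = (\<Sum>i. real i powr p * v n t i)"
  unfolding Mv_eq by (subst suminf_finite[of "{1..N n}"]) (use truncated_breakage.supp[OF approx] in auto)

lemma moment_tendsto:
  assumes t: "0 < t" and p: "p \<le> 3"
  shows "summable (\<lambda>i. real i powr p * w t i)"
    "(\<lambda>n. Mv n p t) \<longlonglongrightarrow> (\<Sum>i. real i powr p * w t i)"
proof -
  obtain C where C: "\<And>n \<tau> i. t \<le> \<tau> \<Longrightarrow> real i ^ 5 * v n \<tau> i \<le> C" using decay_v[OF t] by blast
  have "\<bar>real i powr p * v n t i\<bar> \<le> C * inverse (real i ^ 2)" for n i
  proof (cases "i = 0")
    case False
    then show ?thesis using moment_term_le[OF C v_nonneg p, of t i n] v_nonneg t by (simp add: abs_mult)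
  qed auto
  then have bound: "\<forall>\<^sub>F n in sequentially. \<forall>i. \<bar>real i powr p * v n t i\<bar> \<le> C * inverse (real i ^ 2)"
    by (intro always_eventually) blast
  have lim: "(\<lambda>n. real i powr p * v n t i) \<longlonglongrightarrow> real i powr p * w t i" for i
    using t by (intro tendsto_mult_left conv) simp
  note tannery = suminf_tendsto_dominated[OF lim bound summable_inverse_square sequentially_bot]
  show "summable (\<lambda>i. real i powr p * w t i)"
    using tannery(1) by (rule summable_rabs_cancel)
  show "(\<lambda>n. Mv n p t) \<longlonglongrightarrow> (\<Sum>i. real i powr p * w t i)"
    unfolding Mv_suminf by (rule tannery(2))
qed

lemma initial_moment_tendsto:
  assumes "summable (\<lambda>i. real i powr p * y i)"
  shows "(\<lambda>n. Mv n p 0) \<longlonglongrightarrow> (\<Sum>i. real i powr p * y i)"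
proof -
  have "Mv n p 0 = (\<Sum>i\<le>N n. real i powr p * y i)" for n
    unfolding Mv_eq using init by (intro sum.mono_neutral_cong_left) auto
  then show ?thesis
    using filterlim_compose[OF summable_LIMSEQ'[OF assms] N_top] by simp
qed

lemma mass_w:
  assumes "0 \<le> t"
  shows "summable (\<lambda>i. real i powr 1 * w t i)" "(\<Sum>i. real i powr 1 * w t i) = \<rho>"
proof -
  have y1: "summable (\<lambda>i. real i powr 1 * y i)" "(\<Sum>i. real i powr 1 * y i) = \<rho>"
    using y_summable by (simp_all add: \<rho>_def)
  have "summable (\<lambda>i. real i powr 1 * w t i) \<and> (\<Sum>i. real i powr 1 * w t i) = \<rho>"
  proof (cases "t = 0")
    case True
    have "(\<lambda>i. real i powr 1 * w t i) = (\<lambda>i. real i powr 1 * y i)"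
    proof
      show "real i powr 1 * w t i = real i powr 1 * y i" for i
        using w_init[of i] True by (cases "i = 0") auto
    qed
    then show ?thesis using y1 by simp
  next
    case False
    then have t: "0 < t" using assms by simp
    have "(\<lambda>n. Mv n 1 0) \<longlonglongrightarrow> (\<Sum>i. real i powr 1 * w t i)"
      using moment_tendsto(2)[OF t, of 1] truncated_breakage.mass_conservation[OF approx assms] by simp
    then have "(\<Sum>i. real i powr 1 * w t i) = \<rho>"
      using initial_moment_tendsto[OF y1(1)] y1(2) LIMSEQ_unique by metis
    then show ?thesis using moment_tendsto(1)[OF t, of 1] by simp
  qed
  then show "summable (\<lambda>i. real i powr 1 * w t i)" "(\<Sum>i. real i powr 1 * w t i) = \<rho>" by auto
qed

text \<open>
  Modulus of continuity at time zero in the norm of \<open>Y\<^sub>1\<close>. It depends on the initial state only and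
  tends to zero because the initial mass is finite.
\<close>

definition \<omega> :: "real \<Rightarrow> real" where
  "\<omega> t = (\<Sum>j. real j * y j * (1 - exp (- (2 * A * \<rho> * real j * t))))"

lemma \<omega>_term:
  assumes "0 \<le> t"
  shows "0 \<le> 1 - exp (- (2 * A * \<rho> * real j * t))"
    "\<bar>real j * y j * (1 - exp (- (2 * A * \<rho> * real j * t)))\<bar> \<le> real j * y j"
proof -
  have e: "0 \<le> 1 - exp (- (2 * A * \<rho> * real j * t))" "1 - exp (- (2 * A * \<rho> * real j * t)) \<le> 1"
    using assms A \<rho>_nonneg by auto
  then show "0 \<le> 1 - exp (- (2 * A * \<rho> * real j * t))" by simp
  have "\<bar>real j * y j * (1 - exp (- (2 * A * \<rho> * real j * t)))\<bar>
      = real j * y j * (1 - exp (- (2 * A * \<rho> * real j * t)))"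
    by (rule abs_of_nonneg[OF mult_nonneg_nonneg[OF y_term_nonneg e(1)]])
  also have "\<dots> \<le> real j * y j * 1"
    by (rule mult_left_mono[OF e(2) y_term_nonneg])
  finally show "\<bar>real j * y j * (1 - exp (- (2 * A * \<rho> * real j * t)))\<bar> \<le> real j * y j" by simp
qed

lemma \<omega>_tendsto_0: "(\<omega> \<longlongrightarrow> 0) (at_right 0)"
proof -
  have "((\<lambda>t. \<Sum>j. real j * y j * (1 - exp (- (2 * A * \<rho> * real j * t)))) \<longlongrightarrow> (\<Sum>j::nat. 0)) (at_right 0)"
  proof (rule suminf_tendsto_dominated(2)[where M = "\<lambda>j. real j * y j"])
    show "((\<lambda>t. real j * y j * (1 - exp (- (2 * A * \<rho> * real j * t)))) \<longlongrightarrow> 0) (at_right 0)" for j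
      by (auto intro!: tendsto_eq_intros)
    have "\<forall>\<^sub>F t in at_right (0::real). 0 < t" by (simp add: eventually_at_right_less)
    then show "\<forall>\<^sub>F t in at_right 0. \<forall>j. \<bar>real j * y j * (1 - exp (- (2 * A * \<rho> * real j * t)))\<bar> \<le> real j * y j"
      by eventually_elim (use \<omega>_term(2) in auto)
  qed (use y_summable in auto)
  then show ?thesis by (simp add: \<omega>_def[abs_def])
qed

lemma distance_to_initial:
  assumes t: "0 \<le> t"
  shows "(\<Sum>j=1..K. real j * \<bar>w t j - y j\<bar>) \<le> 2 * \<omega> t"
proof (rule LIMSEQ_le_const2)
  show "(\<lambda>n. \<Sum>j=1..K. real j * \<bar>v n t j - y j\<bar>) \<longlonglongrightarrow> (\<Sum>j=1..K. real j * \<bar>w t j - y j\<bar>)"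
    by (intro tendsto_intros conv t)
  have "\<forall>\<^sub>F n in sequentially. (\<Sum>j=1..K. real j * \<bar>v n t j - y j\<bar>) \<le> 2 * \<omega> t"
    using N_ge[of K]
  proof eventually_elim
    case (elim n)
    have "(\<Sum>j=1..K. real j * \<bar>v n t j - y j\<bar>) \<le> (\<Sum>j=1..N n. real j * \<bar>v n t j - y j\<bar>)"
      by (rule sum_mono2) (use elim in auto)
    also have "\<dots> = (\<Sum>j=1..N n. real j * \<bar>v n t j - v n 0 j\<bar>)"
      using init by (intro sum.cong) auto
    also have "\<dots> \<le> 2 * (\<Sum>j=1..N n. real j * v n 0 j * (1 - exp (- (2 * A * Mv n 1 0 * real j * t))))"
      by (rule truncated_breakage.distance_to_initial_le[OF approx t])
    also have "\<dots> \<le> 2 * (\<Sum>j=1..N n. real j * y j * (1 - exp (- (2 * A * \<rho> * real j * t))))"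
    proof (intro mult_left_mono sum_mono)
      fix j assume j: "j \<in> {1..N n}"
      have "2 * A * Mv n 1 0 * real j * t \<le> 2 * A * \<rho> * real j * t"
        using A t Mv1_le by (intro mult_right_mono mult_left_mono) auto
      then show "real j * v n 0 j * (1 - exp (- (2 * A * Mv n 1 0 * real j * t)))
          \<le> real j * y j * (1 - exp (- (2 * A * \<rho> * real j * t)))"
        using init[OF j] y_nonneg[of j] j by (auto intro!: mult_left_mono)
    qed simp
    also have "\<dots> \<le> 2 * \<omega> t"
      unfolding \<omega>_def
    proof (intro mult_left_mono sum_le_suminf)
      show "summable (\<lambda>j. real j * y j * (1 - exp (- (2 * A * \<rho> * real j * t))))"
        by (rule summable_comparison_test'[OF y_summable]) (use \<omega>_term(2)[OF t] in auto)
      show "0 \<le> real j * y j * (1 - exp (- (2 * A * \<rho> * real j * t)))" for j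
        by (intro mult_nonneg_nonneg[OF y_term_nonneg] \<omega>_term t)
    qed auto
    finally show ?case .
  qed
  then show "\<exists>n0. \<forall>n\<ge>n0. (\<Sum>j=1..K. real j * \<bar>v n t j - y j\<bar>) \<le> 2 * \<omega> t"
    by (simp add: eventually_sequentially)
qed

lemma isCont_w:
  assumes t: "0 < t" and i: "1 \<le> i"
  shows "isCont (\<lambda>t. w t i) t"
proof -
  define s where "s = t / 2"
  have s: "0 < s" "s < t" using t by (auto simp: s_def)
  obtain C where C: "\<And>n \<tau>. s \<le> \<tau> \<Longrightarrow> Mv n 5 \<tau> \<le> C" using moment5[OF s(1)] by blast
  define L where "L = 2 * A * \<rho> * (C + \<rho>)"
  have C0: "0 \<le> C"
    using C[of s 0] truncated_breakage.M_nonneg[OF approx, of s 0 5] s by simp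
  have vlip: "\<bar>v n \<tau> i - v n \<tau>' i\<bar> \<le> L * \<bar>\<tau> - \<tau>'\<bar>" if "s \<le> \<tau>" "s \<le> \<tau>'" for n \<tau> \<tau>'
    unfolding L_def
  proof (rule truncated_breakage.lipschitz_in_time[OF approx])
    show "Mv n 2 r \<le> C" if "s \<le> r" for r
      using truncated_breakage.M_mono[OF approx, of r 2 5 n] C[OF that, of n] that s by simp
  qed (use s Mv1_le i that in auto)
  have wlip: "\<bar>w \<tau> i - w \<tau>' i\<bar> \<le> L * \<bar>\<tau> - \<tau>'\<bar>" if "s \<le> \<tau>" "s \<le> \<tau>'" for \<tau> \<tau>'
  proof (rule LIMSEQ_le_const2)
    show "(\<lambda>n. \<bar>v n \<tau> i - v n \<tau>' i\<bar>) \<longlonglongrightarrow> \<bar>w \<tau> i - w \<tau>' i\<bar>"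
      by (intro tendsto_intros conv) (use that s in auto)
  qed (use vlip that in auto)
  have "L-lipschitz_on {s..} (\<lambda>t. w t i)"
    by (rule lipschitz_onI) (use wlip A C0 \<rho>_nonneg in \<open>auto simp: dist_real_def L_def\<close>)
  then have "continuous_on {s..} (\<lambda>t. w t i)" by (rule lipschitz_on_continuous_on)
  then have "continuous_on {s<..} (\<lambda>t. w t i)" by (rule continuous_on_subset) auto
  then show ?thesis using s by (auto simp: continuous_on_eq_continuous_at)
qed

lemma continuous_on_w:
  assumes i: "1 \<le> i"
  shows "continuous_on {0..} (\<lambda>t. w t i)"
proof -
  have "continuous (at t within {0..}) (\<lambda>t. w t i)" if "0 \<le> t" for t
  proof (cases "t = 0")
    case False
    then have "0 < t" using that by simp
    then show ?thesis by (rule continuous_at_imp_continuous_at_within[OF isCont_w[OF _ i]])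
  next
    case True
    have "((\<lambda>t. w t i - y i) \<longlongrightarrow> 0) (at_right 0)"
    proof (rule Lim_null_comparison)
      have "\<forall>\<^sub>F t in at_right (0::real). 0 < t" by (simp add: eventually_at_right_less)
      then show "\<forall>\<^sub>F t in at_right 0. norm (w t i - y i) \<le> 2 * \<omega> t"
      proof eventually_elim
        case (elim t)
        have "\<bar>w t i - y i\<bar> \<le> real i * \<bar>w t i - y i\<bar>" using i by (simp add: mult_le_cancel_right1)
        also have "\<dots> \<le> (\<Sum>j=1..i. real j * \<bar>w t j - y j\<bar>)"
          by (rule member_le_sum) (use i in auto)
        also have "\<dots> \<le> 2 * \<omega> t" by (rule distance_to_initial) (use elim in auto)
        finally show ?case by simp
      qed
      show "((\<lambda>t. 2 * \<omega> t) \<longlongrightarrow> 0) (at_right 0)"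
        using tendsto_mult_left[OF \<omega>_tendsto_0, of 2] by simp
    qed
    then have "((\<lambda>t. w t i) \<longlongrightarrow> w 0 i) (at_right 0)"
      using w_init[OF i] LIM_zero_cancel by metis
    then show ?thesis using True by (simp add: continuous_within at_within_Ici_at_right)
  qed
  then show ?thesis by (simp add: continuous_on_eq_continuous_within)
qed

definition gain :: "nat \<Rightarrow> real \<Rightarrow> real" where "gain i t = (\<Sum>s. gain_term a B (w t) i s)"

definition loss :: "nat \<Rightarrow> real \<Rightarrow> real" where "loss i t = (\<Sum>j. a i j * w t j)"

definition net :: "nat \<Rightarrow> real \<Rightarrow> real" where "net i t = 1 / 2 * gain i t - w t i * loss i t"

text \<open>
  Stated for an arbitrary filter in order to serve twice: along the approximating sequence at a fixed
  time, and along \<open>\<tau> \<rightarrow> t\<close> for continuity of the limiting rates.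
\<close>

lemma rates_tendsto:
  fixes F :: "'b filter" and u :: "'b \<Rightarrow> nat \<Rightarrow> real" and D :: "'b \<Rightarrow> nat \<Rightarrow> nat \<Rightarrow> nat \<Rightarrow> real"
  assumes F: "F \<noteq> bot" and lim: "\<And>j. ((\<lambda>n. u n j) \<longlongrightarrow> w t j) F"
    and dec: "\<forall>\<^sub>F n in F. \<forall>j. 0 \<le> u n j \<and> real j ^ 5 * u n j \<le> C"
    and D: "\<And>n. daughter_B1 (D n)" "\<And>j k. \<forall>\<^sub>F n in F. D n j k = B j k"
    and i: "1 \<le> i"
  shows "((\<lambda>n. \<Sum>s. gain_term a (D n) (u n) i s) \<longlongrightarrow> gain i t) F"
    "summable (gain_term a B (w t) i)"
    "((\<lambda>n. \<Sum>j. a i j * u n j) \<longlongrightarrow> loss i t) F"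
proof -
  have gain_lim: "((\<lambda>n. gain_term a (D n) (u n) i s) \<longlongrightarrow> gain_term a B (w t) i s) F" for s
  proof -
    have "((\<lambda>n. D n (s - k) k i) \<longlongrightarrow> B (s - k) k i) F" for k
      by (rule tendsto_eventually) (use D(2)[of "s - k" k] in eventually_elim, simp)
    then show ?thesis unfolding gain_term_def by (intro tendsto_intros lim)
  qed
  have gain_bound: "\<forall>\<^sub>F n in F. \<forall>s. \<bar>gain_term a (D n) (u n) i s\<bar> \<le> 32 * A * C\<^sup>2 * inverse (real s ^ 2)"
    using dec
  proof eventually_elim
    case (elim n)
    have "0 \<le> gain_term a (D n) (u n) i s" "gain_term a (D n) (u n) i s \<le> 32 * A * C\<^sup>2 * inverse (real s ^ 2)" for s
      by (rule gain_term_decay[OF A _ \<beta>1 D(1)]; use elim i \<alpha>1 in auto)+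
    then show ?case by simp
  qed
  note gain = suminf_tendsto_dominated[OF gain_lim gain_bound summable_inverse_square F]
  show "((\<lambda>n. \<Sum>s. gain_term a (D n) (u n) i s) \<longlongrightarrow> gain i t) F"
    unfolding gain_def by (rule gain(2))
  show "summable (gain_term a B (w t) i)"
    by (rule summable_rabs_cancel[OF gain(1)])
  have loss_lim: "((\<lambda>n. a i j * u n j) \<longlongrightarrow> a i j * w t j) F" for j
    by (intro tendsto_intros lim)
  have loss_bound: "\<forall>\<^sub>F n in F. \<forall>j. \<bar>a i j * u n j\<bar> \<le> 2 * A * real i * C * inverse (real j ^ 2)"
    using dec
  proof eventually_elim
    case (elim n)
    have "\<bar>a i j * u n j\<bar> \<le> 2 * A * real i * C * inverse (real j ^ 2)" for j
    proof (cases "j = 0")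
      case False
      have "\<bar>a i j * u n j\<bar> = a i j * u n j"
        using elim a_nonneg by (intro abs_of_nonneg mult_nonneg_nonneg) auto
      also have "\<dots> \<le> (2 * A * real i * real j) * u n j"
        using elim by (intro mult_right_mono a_le) auto
      also have "\<dots> = 2 * A * real i * (real j powr 1 * u n j)" by simp
      also have "\<dots> \<le> 2 * A * real i * (C * inverse (real j ^ 2))"
        using A elim False by (intro mult_left_mono moment_term_le) auto
      finally show ?thesis by (simp add: mult.assoc)
    qed simp
    then show ?case by blast
  qed
  show "((\<lambda>n. \<Sum>j. a i j * u n j) \<longlongrightarrow> loss i t) F"
    unfolding loss_def by (rule suminf_tendsto_dominated(2)[OF loss_lim loss_bound summable_inverse_square F])
qed

lemma rate_tendsto:
  assumes t: "0 < t" and i: "1 \<le> i"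
  shows "(\<lambda>n. truncated_breakage.rate A \<alpha> \<beta> (shatter_above (N n) B) (N n) (v n) i t) \<longlonglongrightarrow> net i t"
    "summable (gain_term a B (w t) i)"
proof -
  obtain C where C: "\<And>n \<tau> i. t \<le> \<tau> \<Longrightarrow> real i ^ 5 * v n \<tau> i \<le> C" using decay_v[OF t] by blast
  have D: "\<forall>\<^sub>F n in sequentially. shatter_above (N n) B j k = B j k" for j k
    using N_ge[of "j + k"] by eventually_elim (simp add: shatter_above_def fun_eq_iff)
  have dec: "\<forall>\<^sub>F n in sequentially. \<forall>j. 0 \<le> v n t j \<and> real j ^ 5 * v n t j \<le> C"
    using C[of t] v_nonneg[of t] t by (intro always_eventually) auto
  note lims = rates_tendsto[OF sequentially_bot conv dec daughter_B1_shatter_above[OF B1] D i]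
  have "truncated_breakage.rate A \<alpha> \<beta> (shatter_above (N n) B) (N n) (v n) i t
      = 1 / 2 * (\<Sum>s. gain_term a (shatter_above (N n) B) (v n t) i s) - v n t i * (\<Sum>j. a i j * v n t j)" for n
  proof -
    have "(\<Sum>j. a i j * v n t j) = (\<Sum>j=1..N n. a i j * v n t j)"
      by (rule suminf_finite) (use truncated_breakage.supp[OF approx] in auto)
    then show ?thesis
      unfolding truncated_breakage.rate_def[OF approx]
      using sums_unique[OF truncated_breakage.gain_sums[OF approx i]]
      by (simp add: sum_distrib_left ac_simps)
  qed
  then show "(\<lambda>n. truncated_breakage.rate A \<alpha> \<beta> (shatter_above (N n) B) (N n) (v n) i t) \<longlonglongrightarrow> net i t"
    unfolding net_def using t by (simp only:) (intro tendsto_intros conv lims; simp)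
  show "summable (gain_term a B (w t) i)" using lims(2) t by simp
qed

lemma isCont_rates:
  assumes t: "0 < t" and i: "1 \<le> i"
  shows "isCont (gain i) t" "isCont (loss i) t" "isCont (net i) t"
proof -
  have t2: "0 < t / 2" using t by simp
  obtain C where C: "\<And>n \<tau> i. t / 2 \<le> \<tau> \<Longrightarrow> real i ^ 5 * v n \<tau> i \<le> C" using decay_v[OF t2] by blast
  have near: "\<forall>\<^sub>F \<tau> in at t. t / 2 < \<tau>"
    using t by (intro order_tendstoD(1)[OF tendsto_ident_at]) auto
  then have dec: "\<forall>\<^sub>F \<tau> in at t. \<forall>j. 0 \<le> w \<tau> j \<and> real j ^ 5 * w \<tau> j \<le> C"
    by eventually_elim (use t w_nonneg decay_w[OF C t2] in auto)
  have lim: "((\<lambda>\<tau>. w \<tau> j) \<longlongrightarrow> w t j) (at t)" for j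
  proof (cases "j = 0")
    case False
    then show ?thesis using isCont_w[OF t, of j] by (simp add: isCont_def)
  next
    case True
    have "\<forall>\<^sub>F \<tau> in at t. w \<tau> j = w t j"
      using near by eventually_elim (use True t w_zero in auto)
    then show ?thesis by (rule tendsto_eventually)
  qed
  note lims = rates_tendsto[OF trivial_limit_at lim dec B1 _ i]
  show 1: "isCont (gain i) t"
    unfolding isCont_def gain_def[of i "t" for t, abs_def, symmetric]
    using lims(1) by (simp add: gain_def[abs_def])
  show 2: "isCont (loss i) t"
    unfolding isCont_def using lims(3) by (simp add: loss_def[abs_def])
  show "isCont (net i) t"
    unfolding net_def[abs_def] by (intro continuous_intros 1 2 isCont_w t i)
qed

text \<open>
  The integral form passes to the limit by dominated convergence on intervals away from zero; the
  derivative is recovered afterwards from continuity of the limiting rate.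
\<close>

lemma integral_equation:
  assumes s: "0 < s" and t: "s \<le> t" and i: "1 \<le> i"
  shows "integral {s..t} (net i) = w t i - w s i"
proof -
  let ?r = "\<lambda>n. truncated_breakage.rate A \<alpha> \<beta> (shatter_above (N n) B) (N n) (v n) i"
  obtain C where C: "\<And>n \<tau>. s \<le> \<tau> \<Longrightarrow> Mv n 5 \<tau> \<le> C" using moment5[OF s] by blast
  have FTC: "(?r n has_integral (v n t i - v n s i)) {s..t}" for n
  proof (rule fundamental_theorem_of_calculus[OF t])
    fix \<tau> assume "\<tau> \<in> {s..t}"
    then have "0 \<le> \<tau>" using s by simp
    then show "((\<lambda>\<tau>. v n \<tau> i) has_vector_derivative ?r n \<tau>) (at \<tau> within {s..t})"
      unfolding has_real_derivative_iff_has_vector_derivative[symmetric]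
      by (rule has_field_derivative_at_within[OF truncated_breakage.has_rate[OF approx _ i]])
  qed
  have "(\<lambda>n. integral {s..t} (?r n)) \<longlonglongrightarrow> integral {s..t} (net i)"
  proof (rule dominated_convergence(2))
    show "?r n integrable_on {s..t}" for n using FTC by blast
    show "(\<lambda>_. 2 * A * \<rho> * (C + \<rho>)) integrable_on {s..t}" by (rule integrable_const_ivl)
    show "(\<lambda>n. ?r n \<tau>) \<longlonglongrightarrow> net i \<tau>" if "\<tau> \<in> {s..t}" for \<tau>
      using that s by (intro rate_tendsto i) auto
    show "norm (?r n \<tau>) \<le> 2 * A * \<rho> * (C + \<rho>)" if "\<tau> \<in> {s..t}" for n \<tau>
    proof -
      have \<tau>: "0 \<le> \<tau>" "s \<le> \<tau>" using that s by auto
      have "\<bar>?r n \<tau>\<bar> \<le> 2 * A * Mv n 1 0 * (Mv n 2 \<tau> + Mv n 1 0)"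
        by (rule truncated_breakage.rate_bound[OF approx \<tau>(1) i])
      also have "\<dots> \<le> 2 * A * \<rho> * (C + \<rho>)"
      proof (intro mult_mono add_mono)
        show "Mv n 2 \<tau> \<le> C"
          using truncated_breakage.M_mono[OF approx \<tau>(1), of 2 5 n] C[OF \<tau>(2), of n] by simp
        show "0 \<le> Mv n 2 \<tau> + Mv n 1 0"
          by (intro add_nonneg_nonneg truncated_breakage.M_nonneg[OF approx] \<tau>) simp
      qed (use A Mv1_le \<rho>_nonneg Mv1_nonneg in auto)
      finally show ?thesis by simp
    qed
  qed
  moreover have "integral {s..t} (?r n) = v n t i - v n s i" for n
    using FTC by (rule integral_unique)
  moreover have "(\<lambda>n. v n t i - v n s i) \<longlonglongrightarrow> w t i - w s i"
    by (intro tendsto_intros conv) (use s t in auto)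
  ultimately show ?thesis using LIMSEQ_unique by auto
qed

lemma DERIV_w:
  assumes t: "0 < t" and i: "1 \<le> i"
  shows "((\<lambda>t. w t i) has_real_derivative net i t) (at t)"
proof -
  have s: "0 < t / 2" "t / 2 < t" "t < 2 * t" using t by auto
  have "continuous_on {t / 2..2 * t} (net i)"
    by (intro continuous_at_imp_continuous_on ballI isCont_rates i) (use s in auto)
  then have "((\<lambda>\<tau>. integral {t / 2..\<tau>} (net i)) has_real_derivative net i t) (at t within {t / 2..2 * t})"
    by (rule integral_has_real_derivative) (use s in auto)
  then have "((\<lambda>\<tau>. integral {t / 2..\<tau>} (net i)) has_real_derivative net i t) (at t)"
    using s by (simp add: at_within_Icc_at)
  then have "((\<lambda>\<tau>. integral {t / 2..\<tau>} (net i) + w (t / 2) i) has_real_derivative net i t) (at t)"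
    by (auto intro!: derivative_eq_intros)
  moreover have "\<forall>\<^sub>F \<tau> in nhds t. integral {t / 2..\<tau>} (net i) + w (t / 2) i = w \<tau> i"
  proof -
    have "\<forall>\<^sub>F \<tau> in nhds t. \<tau> \<in> {t / 2<..}" by (rule eventually_nhds_in_open) (use s in auto)
    then show ?thesis by eventually_elim (use integral_equation[OF s(1) _ i] in auto)
  qed
  ultimately show ?thesis by (simp cong: DERIV_cong_ev)
qed

lemma summable_loss:
  assumes t: "0 \<le> t"
  shows "summable (\<lambda>j. a i j * w t j)"
proof (rule summable_comparison_test'[OF summable_mult[OF mass_w(1)[OF t], of "2 * A * real i"]])
  show "norm (a i j * w t j) \<le> 2 * A * real i * (real j powr 1 * w t j)" for j
    using mult_right_mono[OF a_le w_nonneg[OF t, of j], of i j] a_nonneg w_nonneg[OF t]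
    by (simp add: abs_mult mult.assoc)
qed

text \<open>
  At time zero the weight \<open>j\<close> in \<open>distance_to_initial\<close> absorbs the growth of the kernel in \<open>j\<close>.
\<close>

lemma continuous_on_loss:
  assumes i: "1 \<le> i"
  shows "continuous_on {0..} (loss i)"
proof -
  have "continuous (at t within {0..}) (loss i)" if "0 \<le> t" for t
  proof (cases "t = 0")
    case False
    then have "0 < t" using that by simp
    then show ?thesis by (rule continuous_at_imp_continuous_at_within[OF isCont_rates(2)[OF _ i]])
  next
    case True
    have "((\<lambda>t. loss i t - loss i 0) \<longlongrightarrow> 0) (at_right 0)"
    proof (rule Lim_null_comparison)
      have "\<forall>\<^sub>F t in at_right (0::real). 0 < t" by (simp add: eventually_at_right_less)
      then show "\<forall>\<^sub>F t in at_right 0. norm (loss i t - loss i 0) \<le> 2 * A * real i * (2 * \<omega> t)"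
      proof eventually_elim
        case (elim t)
        then have t: "0 \<le> t" by simp
        have "(\<lambda>K. \<Sum>j\<le>K. a i j * w t j - a i j * w 0 j) \<longlonglongrightarrow> loss i t - loss i 0"
          unfolding sum_subtractf loss_def
          by (intro tendsto_diff summable_LIMSEQ' summable_loss t order_refl)
        then have "(\<lambda>K. \<bar>\<Sum>j\<le>K. a i j * w t j - a i j * w 0 j\<bar>) \<longlonglongrightarrow> \<bar>loss i t - loss i 0\<bar>"
          by (rule tendsto_rabs)
        moreover have "\<bar>\<Sum>j\<le>K. a i j * w t j - a i j * w 0 j\<bar> \<le> 2 * A * real i * (2 * \<omega> t)" for K
        proof -
          have "\<bar>\<Sum>j\<le>K. a i j * w t j - a i j * w 0 j\<bar> \<le> (\<Sum>j\<le>K. \<bar>a i j * w t j - a i j * w 0 j\<bar>)"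
            by (rule sum_abs)
          also have "\<dots> = (\<Sum>j=1..K. a i j * \<bar>w t j - y j\<bar>)"
          proof (rule sum.mono_neutral_cong_right)
            fix j assume "j \<in> {1..K}"
            then have "w 0 j = y j" using w_init by simp
            then show "\<bar>a i j * w t j - a i j * w 0 j\<bar> = a i j * \<bar>w t j - y j\<bar>"
              using a_nonneg by (simp add: abs_mult flip: right_diff_distrib)
          qed (auto simp: not_less_eq_eq)
          also have "\<dots> \<le> (\<Sum>j=1..K. (2 * A * real i * real j) * \<bar>w t j - y j\<bar>)"
            by (intro sum_mono mult_right_mono a_le) auto
          also have "\<dots> = 2 * A * real i * (\<Sum>j=1..K. real j * \<bar>w t j - y j\<bar>)"
            by (simp add: sum_distrib_left mult.assoc)
          also have "\<dots> \<le> 2 * A * real i * (2 * \<omega> t)"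
            using A by (intro mult_left_mono distance_to_initial t) auto
          finally show ?thesis .
        qed
        ultimately have "\<bar>loss i t - loss i 0\<bar> \<le> 2 * A * real i * (2 * \<omega> t)"
          by (intro LIMSEQ_le_const2) auto
        then show ?case by simp
      qed
      show "((\<lambda>t. 2 * A * real i * (2 * \<omega> t)) \<longlongrightarrow> 0) (at_right 0)"
        using tendsto_mult_left[OF \<omega>_tendsto_0, of "2 * A * real i * 2"] by (simp add: mult.assoc)
    qed
    then have "(loss i \<longlongrightarrow> loss i 0) (at_right 0)"
      by (rule LIM_zero_cancel)
    then show ?thesis using True by (simp add: continuous_within at_within_Ici_at_right)
  qed
  then show ?thesis by (simp add: continuous_on_eq_continuous_within)
qed

lemma gain_term_nonneg: "1 \<le> i \<Longrightarrow> 0 \<le> t \<Longrightarrow> 0 \<le> gain_term a B (w t) i s"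
  unfolding gain_term_def
  by (intro sum_nonneg mult_nonneg_nonneg daughter_nonneg[OF B1] a_nonneg w_nonneg) auto

lemma gain_term_zero: "s \<le> i \<Longrightarrow> gain_term a B u i s = 0"
  unfolding gain_term_def
proof (rule sum.neutral, rule ballI)
  fix k assume "s \<le> i" "k \<in> {1..s - 1}"
  then have "B (s - k) k i = 0" using B1 by (auto simp: daughter_B1_def)
  then show "B (s - k) k i * a (s - k) k * u (s - k) * u k = 0" by simp
qed

lemma gain_infsum:
  assumes t: "0 < t" and i: "1 \<le> i"
  shows "(\<lambda>j. gain_term a B (w t) i j) summable_on {i + 1..}"
    "(\<Sum>\<^sub>\<infinity>j\<in>{i + 1..}. gain_term a B (w t) i j) = gain i t"
  unfolding gain_def
  by (rule infsum_eq_suminf_nonneg;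
      use rate_tendsto(2)[OF t i] gain_term_nonneg[OF i] gain_term_zero t in auto)+

lemma loss_infsum:
  assumes t: "0 \<le> t"
  shows "(\<lambda>j. a i j * w t j) summable_on {1..}" "(\<Sum>\<^sub>\<infinity>j\<in>{1..}. a i j * w t j) = loss i t"
  unfolding loss_def
  by (rule infsum_eq_suminf_nonneg;
      use summable_loss[OF t] a_nonneg w_nonneg[OF t] in \<open>auto simp: not_le\<close>)+

text \<open>
  The function \<open>\<Phi>\<close> below is a primitive of half the gain that is continuous up to \<open>0\<close>. Since the gain is
  non-negative, this alone implies integrability, although no integrable bound near \<open>0\<close> is at
  hand.
\<close>

lemma net_integral:
  assumes t: "0 < t" and i: "1 \<le> i"
  shows "set_integrable lborel {0<..<t} (loss i)" "set_integrable lborel {0<..<t} (gain i)"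
    "(LBINT \<tau>:{0<..<t}. net i \<tau>) = w t i - w 0 i"
proof -
  let ?L = "\<lambda>\<tau>. w \<tau> i * loss i \<tau>"
  let ?\<Phi> = "\<lambda>\<tau>. w \<tau> i + integral {0..\<tau>} ?L"
  have w_cont: "continuous_on {0..t} (\<lambda>\<tau>. w \<tau> i)"
    by (rule continuous_on_subset[OF continuous_on_w[OF i]]) auto
  have loss_cont: "continuous_on {0..t} (loss i)"
    by (rule continuous_on_subset[OF continuous_on_loss[OF i]]) auto
  have L_cont: "continuous_on {0..t} ?L" by (intro continuous_intros w_cont loss_cont)
  have \<Phi>_cont: "continuous_on {0..t} ?\<Phi>"
    by (intro continuous_intros w_cont indefinite_integral_continuous_1 integrable_continuous_real L_cont)
  have ivl: "{0<..<t} = einterval (ereal 0) (ereal t)" by simp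
  have limits: "((f \<circ> real_of_ereal) \<longlongrightarrow> f 0) (at_right (ereal 0))"
    "((f \<circ> real_of_ereal) \<longlongrightarrow> f t) (at_left (ereal t))" if "continuous_on {0..t} f" for f :: "real \<Rightarrow> real"
    unfolding ereal_tendsto_simps1
    using that t by (auto dest: continuous_on_Icc_at_rightD continuous_on_Icc_at_leftD)
  show loss_int: "set_integrable lborel {0<..<t} (loss i)"
    by (rule set_integrable_subset[OF borel_integrable_atLeastAtMost'[OF loss_cont]]) auto
  have L_int: "set_integrable lborel {0<..<t} ?L"
    by (rule set_integrable_subset[OF borel_integrable_atLeastAtMost'[OF L_cont]]) auto
  have gain_half_int: "set_integrable lborel {0<..<t} (\<lambda>\<tau>. 1 / 2 * gain i \<tau>)"
    unfolding ivl
  proof (rule interval_integral_FTC_nonneg(1)[where F = ?\<Phi>, OF _ _ _ _ limits[OF \<Phi>_cont]])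
    fix x assume "ereal 0 < ereal x" "ereal x < ereal t"
    then have x: "0 < x" "x < t" by auto
    show "isCont (\<lambda>\<tau>. 1 / 2 * gain i \<tau>) x" by (intro continuous_intros isCont_rates x i)
    have "((\<lambda>\<tau>. integral {0..\<tau>} ?L) has_real_derivative ?L x) (at x within {0..t})"
      by (rule integral_has_real_derivative[OF L_cont]) (use x in auto)
    then have "((\<lambda>\<tau>. integral {0..\<tau>} ?L) has_real_derivative ?L x) (at x)"
      using x by (simp add: at_within_Icc_at)
    from DERIV_add[OF DERIV_w[OF x(1) i] this]
    show "(?\<Phi> has_real_derivative 1 / 2 * gain i x) (at x)" by (simp add: net_def)
  next
    show "AE x in lborel. ereal 0 < ereal x \<longrightarrow> ereal x < ereal t \<longrightarrow> 0 \<le> 1 / 2 * gain i x"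
    proof (intro AE_I2 impI)
      fix x assume "ereal 0 < ereal x"
      then have "0 \<le> gain i x"
        unfolding gain_def by (intro suminf_nonneg rate_tendsto(2) gain_term_nonneg i) auto
      then show "0 \<le> 1 / 2 * gain i x" by simp
    qed
  qed (use t in auto)
  have "set_integrable lborel {0<..<t} (\<lambda>\<tau>. 2 * (1 / 2 * gain i \<tau>))"
    by (rule set_integrable_mult_right[OF gain_half_int])
  moreover have "(\<lambda>\<tau>. 2 * (1 / 2 * gain i \<tau>)) = gain i" by auto
  ultimately show "set_integrable lborel {0<..<t} (gain i)" by (simp only:)
  have "set_integrable lborel {0<..<t} (net i)"
    unfolding net_def[abs_def] by (intro set_integral_diff gain_half_int L_int)
  then have "(LBINT \<tau>=ereal 0..ereal t. net i \<tau>) = w t i - w 0 i"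
  proof (intro interval_integral_FTC_integrable[where F = "\<lambda>\<tau>. w \<tau> i"] limits(1)[OF w_cont] limits(2)[OF w_cont])
    fix x assume "ereal 0 < ereal x" "ereal x < ereal t"
    then have x: "0 < x" by auto
    show "((\<lambda>\<tau>. w \<tau> i) has_vector_derivative net i x) (at x)"
      using DERIV_w[OF x i] by (simp add: has_real_derivative_iff_has_vector_derivative)
    show "isCont (net i) x" by (intro isCont_rates x i)
  qed (use t in auto)
  then show "(LBINT \<tau>:{0<..<t}. net i \<tau>) = w t i - w 0 i"
    using t by (simp add: interval_integral_Ioo)
qed

theorem mass_conserving_limit:
  assumes Y: "y \<in> Y_plus 1"
  shows "mass_conserving_solution a B \<infinity> y w"
proof -
  have sol: "continuous_on {0..<t} (\<lambda>\<tau>. w \<tau> i) \<and>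
        series_in_L1 t {1..} (\<lambda>\<tau> j. a i j * w \<tau> j) \<and>
        series_in_L1 t {i + 1..} (\<lambda>\<tau> j. gain_term a B (w \<tau>) i j) \<and>
        w t i = y i +
          (LBINT \<tau>:{0<..<t}.
             1 / 2 * (\<Sum>\<^sub>\<infinity>j\<in>{i + 1..}. gain_term a B (w \<tau>) i j)
             - (\<Sum>\<^sub>\<infinity>j\<in>{1..}. a i j * w \<tau> i * w \<tau> j))"
    if i: "1 \<le> i" and t: "0 < t" for i t
  proof (intro conjI)
    show "continuous_on {0..<t} (\<lambda>\<tau>. w \<tau> i)"
      by (rule continuous_on_subset[OF continuous_on_w[OF i]]) auto
    have "set_integrable lborel {0<..<t} (\<lambda>\<tau>. \<Sum>\<^sub>\<infinity>j\<in>{1..}. a i j * w \<tau> j)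
        = set_integrable lborel {0<..<t} (loss i)"
      by (rule set_integrable_cong) (use loss_infsum in auto)
    then show "series_in_L1 t {1..} (\<lambda>\<tau> j. a i j * w \<tau> j)"
      unfolding series_in_L1_def using net_integral(1)[OF t i] loss_infsum(1) by auto
    have "set_integrable lborel {0<..<t} (\<lambda>\<tau>. \<Sum>\<^sub>\<infinity>j\<in>{i + 1..}. gain_term a B (w \<tau>) i j)
        = set_integrable lborel {0<..<t} (gain i)"
      by (rule set_integrable_cong) (use gain_infsum[OF _ i] in auto)
    then show "series_in_L1 t {i + 1..} (\<lambda>\<tau> j. gain_term a B (w \<tau>) i j)"
      unfolding series_in_L1_def using net_integral(2)[OF t i] gain_infsum(1)[OF _ i] by auto
    have "(LBINT \<tau>:{0<..<t}.
             1 / 2 * (\<Sum>\<^sub>\<infinity>j\<in>{i + 1..}. gain_term a B (w \<tau>) i j)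
             - (\<Sum>\<^sub>\<infinity>j\<in>{1..}. a i j * w \<tau> i * w \<tau> j)) = (LBINT \<tau>:{0<..<t}. net i \<tau>)"
    proof (intro set_lebesgue_integral_cong allI impI)
      fix \<tau> assume "\<tau> \<in> {0<..<t}"
      then have \<tau>: "0 < \<tau>" by simp
      have "(\<Sum>\<^sub>\<infinity>j\<in>{1..}. a i j * w \<tau> i * w \<tau> j) = w \<tau> i * (\<Sum>\<^sub>\<infinity>j\<in>{1..}. a i j * w \<tau> j)"
        by (simp add: ac_simps flip: infsum_cmult_right')
      then show "1 / 2 * (\<Sum>\<^sub>\<infinity>j\<in>{i + 1..}. gain_term a B (w \<tau>) i j)
             - (\<Sum>\<^sub>\<infinity>j\<in>{1..}. a i j * w \<tau> i * w \<tau> j) = net i \<tau>"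
        using gain_infsum(2)[OF \<tau> i] loss_infsum(2)[of \<tau> i] \<tau> by (simp add: net_def)
    qed simp
    then show "w t i = y i +
          (LBINT \<tau>:{0<..<t}.
             1 / 2 * (\<Sum>\<^sub>\<infinity>j\<in>{i + 1..}. gain_term a B (w \<tau>) i j)
             - (\<Sum>\<^sub>\<infinity>j\<in>{1..}. a i j * w \<tau> i * w \<tau> j))"
      using net_integral(3)[OF t i] w_init[OF i] by simp
  qed
  have "w t \<in> Y_plus 1 \<and> moment 1 (w t) = moment 1 y" if t: "0 \<le> t" for t
  proof -
    have "moment 1 y = \<rho>"
      using moment_eq_suminf(2)[of y 1] y_nonneg y_summable by (simp add: \<rho>_def)
    then show ?thesis
      using moment_eq_suminf[OF w_nonneg[OF t] mass_w(1)[OF t]] mass_w(2)[OF t] w_nonneg[OF t]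
      by (simp add: Y_plus_def)
  qed
  then show ?thesis
    unfolding mass_conserving_solution_def breakage_solution_def
    using sol Y w_nonneg by simp
qed

lemma number_nondecreasing_limit:
  assumes B3: "daughter_B3 B" and t: "0 \<le> t"
  shows "moment 0 y \<le> moment 0 (w t)"
proof -
  have y0: "summable (\<lambda>i. real i powr 0 * y i)"
    by (rule summable_lower_moment[where q = 1]) (use y_nonneg y_summable in auto)
  note y_moment = moment_eq_suminf(2)[OF y_nonneg y0]
  show ?thesis
  proof (cases "t = 0")
    case True
    have "moment 0 y = moment 0 (w t)"
      unfolding moment_def by (intro infsum_cong) (use True w_init in auto)
    then show ?thesis by simp
  next
    case False
    then have t0: "0 < t" using t by simp
    have "(\<Sum>i. real i powr 0 * y i) \<le> (\<Sum>i. real i powr 0 * w t i)"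
      using truncated_breakage.number_nondecreasing[OF approx daughter_B3_shatter_above[OF B3] t]
      by (intro LIMSEQ_le[OF initial_moment_tendsto[OF y0] moment_tendsto(2)[OF t0]]) auto
    then show ?thesis
      using y_moment moment_eq_suminf(2)[OF w_nonneg[OF t] moment_tendsto(1)[OF t0]] by simp
  qed
qed

lemma moment_le_limit:
  assumes t: "0 \<le> t" and C: "\<And>n. Mv n m t \<le> C"
  shows "w t \<in> Y_space m" "moment m (w t) \<le> C"
proof -
  have partial: "(\<Sum>i<K. real i powr m * w t i) \<le> C" for K
  proof (rule LIMSEQ_le_const2)
    show "(\<lambda>n. \<Sum>i<K. real i powr m * v n t i) \<longlonglongrightarrow> (\<Sum>i<K. real i powr m * w t i)"
      by (intro tendsto_intros conv t)
    have "\<forall>\<^sub>F n in sequentially. (\<Sum>i<K. real i powr m * v n t i) \<le> C"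
      using N_ge[of K]
    proof eventually_elim
      case (elim n)
      have "(\<Sum>i<K. real i powr m * v n t i) \<le> (\<Sum>i\<le>N n. real i powr m * v n t i)"
        by (rule sum_mono2) (use elim v_nonneg[OF t] in auto)
      also have "\<dots> = Mv n m t"
        unfolding Mv_eq by (intro sum.mono_neutral_right) (auto simp: not_less_eq_eq)
      also have "\<dots> \<le> C" by (rule C)
      finally show ?case .
    qed
    then show "\<exists>n0. \<forall>n\<ge>n0. (\<Sum>i<K. real i powr m * v n t i) \<le> C"
      by (simp add: eventually_sequentially)
  qed
  have "summable (\<lambda>i. real i powr m * w t i)"
    by (rule summableI_nonneg_bounded[OF _ partial]) (use w_nonneg[OF t] in auto)
  then show "w t \<in> Y_space m" "moment m (w t) \<le> C"
    using moment_eq_suminf[OF w_nonneg[OF t]] suminf_le_const[OF _ partial] by auto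
qed

end

section \<open>Existence with uniform moment bounds\<close>

text \<open>
  The theorem asks for constants as functions of the parameters, chosen before the daughter
  distribution and the initial state. They are obtained by choice from this predicate, with \<open>fst p\<close>
  for the bound independent of the initial moment and \<open>snd p\<close> for the other one.
\<close>

definition uniform_moment_bounds ::
  "real \<Rightarrow> real \<Rightarrow> real \<Rightarrow> real \<Rightarrow> real \<Rightarrow> real \<Rightarrow> real \<Rightarrow> real \<Rightarrow> real \<times> real \<Rightarrow> bool" where
  "uniform_moment_bounds m A \<alpha> \<beta> e k \<rho>\<^sub>1 \<rho>\<^sub>0 p \<longleftrightarrow> 0 < fst p \<and> 0 < snd p \<and>
     (\<forall>N B w \<epsilon> \<kappa> t. truncated_breakage A \<alpha> \<beta> B N w \<and> daughter_B2 B \<epsilon> \<kappa> \<and> daughter_B3 B \<and>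
        \<epsilon> m = e \<and> \<kappa> m = k \<and> truncated_breakage.M N w 1 0 \<le> \<rho>\<^sub>1 \<and>
        \<rho>\<^sub>0 \<le> truncated_breakage.M N w 0 0 \<and> 0 < t \<longrightarrow>
      truncated_breakage.M N w m t \<le> fst p * (1 + 1 / t) powr ((m - 1) / \<beta>) \<and>
      truncated_breakage.M N w m t \<le> max (truncated_breakage.M N w m 0) (snd p))"

definition moment_bounds ::
  "real \<Rightarrow> real \<Rightarrow> real \<Rightarrow> real \<Rightarrow> real \<Rightarrow> real \<Rightarrow> real \<Rightarrow> real \<Rightarrow> real \<times> real" where
  "moment_bounds m A \<alpha> \<beta> e k \<rho>\<^sub>1 \<rho>\<^sub>0 = (SOME p. uniform_moment_bounds m A \<alpha> \<beta> e k \<rho>\<^sub>1 \<rho>\<^sub>0 p)"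

lemma uniform_moment_bounds:
  assumes "0 < A" "\<alpha> \<le> \<beta>" "\<beta> \<le> 1" "0 < \<beta>" "\<alpha> < 1" "1 < m" "0 < e" "0 < k" "0 < \<rho>\<^sub>0"
  shows "uniform_moment_bounds m A \<alpha> \<beta> e k \<rho>\<^sub>1 \<rho>\<^sub>0 (moment_bounds m A \<alpha> \<beta> e k \<rho>\<^sub>1 \<rho>\<^sub>0)"
  unfolding moment_bounds_def
proof (rule someI_ex, rule truncated_moment_bounds[OF assms, where ?\<rho>\<^sub>1 = \<rho>\<^sub>1])
  fix F \<mu>
  assume pos: "0 < F" "0 < \<mu>" and bounds:
    "\<And>N B w \<epsilon> \<kappa> t. \<lbrakk>truncated_breakage A \<alpha> \<beta> B N w; daughter_B2 B \<epsilon> \<kappa>; daughter_B3 B; \<epsilon> m = e; \<kappa> m = k;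
        truncated_breakage.M N w 1 0 \<le> \<rho>\<^sub>1; \<rho>\<^sub>0 \<le> truncated_breakage.M N w 0 0; 0 < t\<rbrakk> \<Longrightarrow>
      truncated_breakage.M N w m t \<le> F * (1 + 1 / t) powr ((m - 1) / \<beta>) \<and>
      truncated_breakage.M N w m t \<le> max (truncated_breakage.M N w m 0) \<mu>"
  have "uniform_moment_bounds m A \<alpha> \<beta> e k \<rho>\<^sub>1 \<rho>\<^sub>0 (F, \<mu>)"
    unfolding uniform_moment_bounds_def fst_conv snd_conv
    by (rule conjI[OF pos(1) conjI[OF pos(2)]], intro allI impI, elim conjE) (rule bounds)
  then show "\<exists>p. uniform_moment_bounds m A \<alpha> \<beta> e k \<rho>\<^sub>1 \<rho>\<^sub>0 p" ..
qed

text \<open>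
  An initial state without particles gives no lower bound on the number of particles and is treated
  separately.
\<close>

lemma mass_conserving_solution_zero:
  assumes Y: "u \<in> Y_plus 1" and u: "\<And>i. 1 \<le> i \<Longrightarrow> u i = 0"
  shows "mass_conserving_solution a B \<infinity> u (\<lambda>_ _. 0)"
proof -
  have "moment 1 (\<lambda>_. 0) = moment 1 u"
    unfolding moment_def by (intro infsum_cong) (use u in auto)
  then show ?thesis
    unfolding mass_conserving_solution_def breakage_solution_def series_in_L1_def gain_term_def
    using Y u by (auto simp: Y_plus_def Y_space_def set_integrable_def)
qed

text \<open>
  Truncation of the initial state decreases \<open>M\<^sub>0\<close>. Starting with an \<open>N0\<close> for which at least half of it
  remains keeps the lower bound on the number of particles uniform.
\<close>

lemma breakage_limit_exists:
  assumes par: "0 < A" "\<alpha> \<le> \<beta>" "\<beta> \<le> 1" "0 < \<beta>" "\<alpha> < 1"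
    and B1: "daughter_B1 B" and B2: "daughter_B2 B \<epsilon> \<kappa>" and B3: "daughter_B3 B"
    and Y: "y \<in> Y_plus 1" and M0: "0 < moment 0 y"
  obtains N v w where "breakage_limit A \<alpha> \<beta> B N v w y"
    "\<And>n. truncated_breakage.M (N n) (v n) 1 0 \<le> moment 1 y"
    "\<And>n. moment 0 y / 2 \<le> truncated_breakage.M (N n) (v n) 0 0"
proof -
  have y: "0 \<le> y i" if "1 \<le> i" for i using Y that by (simp add: Y_plus_def)
  have y1: "summable (\<lambda>i. real i powr 1 * y i)"
    by (rule Y_space_summable) (use Y y in \<open>auto simp: Y_plus_def\<close>)
  have y0: "summable (\<lambda>i. real i powr 0 * y i)"
    by (rule summable_lower_moment[OF _ y1]) (use y in auto)
  have partial: "(\<Sum>i=1..N. real i powr p * y i) = (\<Sum>i\<le>N. real i powr p * y i)" for N p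
    by (intro sum.mono_neutral_left) (auto simp: not_less_eq_eq)
  have "(\<lambda>N. \<Sum>i\<le>N. real i powr 0 * y i) \<longlonglongrightarrow> moment 0 y"
    using summable_LIMSEQ'[OF y0] moment_eq_suminf(2)[OF y y0] by simp
  then have "\<forall>\<^sub>F N in sequentially. moment 0 y / 2 < (\<Sum>i\<le>N. real i powr 0 * y i)"
    by (rule order_tendstoD) (use M0 in simp)
  then obtain N0 where N0: "\<And>N. N0 \<le> N \<Longrightarrow> moment 0 y / 2 < (\<Sum>i=1..N. real i powr 0 * y i)"
    unfolding partial eventually_sequentially by blast
  have "\<exists>u. truncated_breakage A \<alpha> \<beta> (shatter_above (n + N0) B) (n + N0) u \<and> (\<forall>i\<in>{1..n + N0}. u 0 i = y i)" for n
  proof -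
    have "0 < (\<Sum>i=1..n + N0. real i powr 0 * y i)" using N0[of "n + N0"] M0 by simp
    also have "\<dots> \<le> (\<Sum>i=1..n + N0. real i * y i)"
    proof (rule sum_mono)
      show "real i powr 0 * y i \<le> real i * y i" if "i \<in> {1..n + N0}" for i
        using mult_right_mono[of 1 "real i" "y i"] y[of i] that by auto
    qed
    finally have mass_pos: "0 < (\<Sum>i=1..n + N0. real i * y i)" .
    show ?thesis
    proof (rule truncated_breakage_exists[OF par daughter_B1_shatter_above[OF B1]
          shatter_above_closed[OF B1] _ mass_pos])
      show "0 \<le> y i" if "i \<in> {1..n + N0}" for i using y that by simp
    qed blast+
  qed
  then obtain u where u: "\<And>n. truncated_breakage A \<alpha> \<beta> (shatter_above (n + N0) B) (n + N0) (u n)"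
    and u0: "\<And>n i. i \<in> {1..n + N0} \<Longrightarrow> u n 0 i = y i" by metis
  let ?M = "\<lambda>n. truncated_breakage.M (n + N0) (u n)"
  have M_init: "?M n p 0 = (\<Sum>i=1..n + N0. real i powr p * y i)" for n p
    unfolding truncated_breakage.M_def[OF u] by (intro sum.cong) (use u0 in auto)
  have M1: "?M n 1 0 \<le> moment 1 y" for n
  proof -
    have "(\<Sum>i=1..n + N0. real i powr 1 * y i) \<le> (\<Sum>i. real i powr 1 * y i)"
      by (rule sum_le_suminf[OF y1]) (use y in \<open>auto simp: not_le\<close>)
    then show ?thesis using moment_eq_suminf(2)[OF y y1] M_init[of n 1] by simp
  qed
  have M0_ge: "moment 0 y / 2 \<le> ?M n 0 0" for n
    unfolding M_init using N0[of "n + N0"] by simp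
  have decay: "\<exists>C. \<forall>n \<tau>. s \<le> \<tau> \<longrightarrow> ?M n m \<tau> \<le> C" if s: "0 < s" and m: "1 < m" for s m
  proof -
    have \<epsilon>\<kappa>: "0 < \<epsilon> m" "0 < \<kappa> m" using B2 m by (auto simp: daughter_B2_def intro: less_le_trans)
    define F where "F = fst (moment_bounds m A \<alpha> \<beta> (\<epsilon> m) (\<kappa> m) (moment 1 y) (moment 0 y / 2))"
    have bounds: "uniform_moment_bounds m A \<alpha> \<beta> (\<epsilon> m) (\<kappa> m) (moment 1 y) (moment 0 y / 2)
        (moment_bounds m A \<alpha> \<beta> (\<epsilon> m) (\<kappa> m) (moment 1 y) (moment 0 y / 2))"
      by (rule uniform_moment_bounds) (use par m \<epsilon>\<kappa> M0 in auto)
    have "?M n m \<tau> \<le> F * (1 + 1 / s) powr ((m - 1) / \<beta>)" if "s \<le> \<tau>" for n \<tau>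
    proof -
      have \<tau>: "0 < \<tau>" using that s by simp
      have "?M n m \<tau> \<le> F * (1 + 1 / \<tau>) powr ((m - 1) / \<beta>)"
        using bounds u[of n] daughter_B2_shatter_above[OF B2, of "n + N0"]
          daughter_B3_shatter_above[OF B3, of "n + N0"] M1[of n] M0_ge[of n] \<tau>
        unfolding uniform_moment_bounds_def F_def by blast
      also have "\<dots> \<le> F * (1 + 1 / s) powr ((m - 1) / \<beta>)"
      proof (intro mult_left_mono powr_mono2)
        show "1 + 1 / \<tau> \<le> 1 + 1 / s" using that s by (simp add: frac_le)
        show "0 \<le> F" using bounds by (simp add: uniform_moment_bounds_def F_def)
      qed (use par m \<tau> in auto)
      finally show ?thesis .
    qed
    then show ?thesis by blast
  qed
  obtain r w where r: "strict_mono (r :: nat \<Rightarrow> nat)" and conv: "\<And>t i. 0 \<le> t \<Longrightarrow> (\<lambda>n. u (r n) t i) \<longlonglongrightarrow> w t i"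
  proof (rule pointwise_convergent_subsequence[of u "moment 1 y"])
    fix n i and t :: real assume t: "0 \<le> t"
    show "\<bar>u n t i\<bar> \<le> moment 1 y"
    proof (cases "i = 0")
      case True
      then show ?thesis
        using truncated_breakage.supp[OF u, of 0 n t] M1[of n] truncated_breakage.M_nonneg[OF u, of 0 n 1] by simp
    next
      case False
      have "\<bar>u n t i\<bar> = 1 * u n t i" using truncated_breakage.nonneg[OF u t] by simp
      also have "\<dots> \<le> real i powr 1 * u n t i"
        using False truncated_breakage.nonneg[OF u t] by (intro mult_right_mono) auto
      also have "\<dots> \<le> ?M n 1 0"
        using truncated_breakage.le_M[OF u t, of i 1 n] truncated_breakage.mass_conservation[OF u t] by simp
      finally show ?thesis using M1[of n] by simp
    qed
  next
    fix s :: real assume s: "0 < s"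
    obtain C where C: "\<And>n \<tau>. s \<le> \<tau> \<Longrightarrow> ?M n 2 \<tau> \<le> C" using decay[OF s, of 2] by auto
    have "\<bar>u n t i - u n t' i\<bar> \<le> 2 * A * moment 1 y * (C + moment 1 y) * \<bar>t - t'\<bar>"
      if tt: "s \<le> t" "s \<le> t'" for n i t t'
    proof (cases "i = 0")
      case True
      have "0 \<le> C" using C[of s 0] truncated_breakage.M_nonneg[OF u, of s 0 2] s by simp
      moreover have "0 \<le> moment 1 y" using M1[of 0] truncated_breakage.M_nonneg[OF u, of 0 0 1] by simp
      moreover have "u n t i = 0" for t
        by (rule truncated_breakage.supp[OF u]) (use True in simp)
      ultimately show ?thesis using par(1) by simp
    next
      case False
      show ?thesis
        by (rule truncated_breakage.lipschitz_in_time[OF u _ C M1 _ tt]) (use False s in auto)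
    qed
    then show "\<exists>L. \<forall>n i t t'. s \<le> t \<longrightarrow> s \<le> t' \<longrightarrow> \<bar>u n t i - u n t' i\<bar> \<le> L * \<bar>t - t'\<bar>" by blast
  qed blast
  show thesis
  proof (rule that[of "\<lambda>n. r n + N0" "\<lambda>n. u (r n)" w])
    show "breakage_limit A \<alpha> \<beta> B (\<lambda>n. r n + N0) (\<lambda>n. u (r n)) w y"
    proof (rule breakage_limit.intro)
      have "filterlim r at_top sequentially" using r by (rule filterlim_subseq)
      then show "filterlim (\<lambda>n. r n + N0) at_top sequentially"
        by (rule filterlim_at_top_mono) auto
      show "summable (\<lambda>i. real i * y i)" using y1 by simp
      show "\<exists>C. \<forall>n \<tau>. s \<le> \<tau> \<longrightarrow> ?M (r n) 5 \<tau> \<le> C" if "0 < s" for s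
        using decay[OF that, of 5] by auto
    qed (use B1 u u0 y conv in auto)
  qed (use M1 M0_ge in auto)
qed

theorem theorem2p2:
  "\<exists>(F :: real \<Rightarrow> real \<Rightarrow> real \<Rightarrow> real \<Rightarrow> real \<Rightarrow> real \<Rightarrow> real \<Rightarrow> real \<Rightarrow> real)
     (\<mu> :: real \<Rightarrow> real \<Rightarrow> real \<Rightarrow> real \<Rightarrow> real \<Rightarrow> real \<Rightarrow> real \<Rightarrow> real \<Rightarrow> real).
     \<forall>(A :: real) (\<alpha> :: real) (\<beta> :: real) (B :: nat \<Rightarrow> nat \<Rightarrow> nat \<Rightarrow> real)
      (\<epsilon> :: real \<Rightarrow> real) (\<kappa> :: real \<Rightarrow> real) (w_in :: nat \<Rightarrow> real).
       0 < A \<and> \<alpha> \<le> \<beta> \<and> \<beta> \<le> 1 \<and> 0 < \<beta> \<and> \<alpha> < 1 \<and>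
       daughter_B1 B \<and> daughter_B2 B \<epsilon> \<kappa> \<and> daughter_B3 B \<and> w_in \<in> Y_plus 1 \<longrightarrow>
       (\<exists>w :: real \<Rightarrow> nat \<Rightarrow> real.
          mass_conserving_solution (collision_kernel A \<alpha> \<beta>) B \<infinity> w_in w \<and>
          (\<forall>t\<ge>0. moment 0 (w t) \<ge> moment 0 w_in) \<and>
          (\<forall>m>1.
             0 < F m A \<alpha> \<beta> (\<epsilon> m) (\<kappa> m) (moment 1 w_in) (moment 0 w_in) \<and>
             (\<forall>t>0. w t \<in> Y_space m \<and>
                moment m (w t)
                  \<le> F m A \<alpha> \<beta> (\<epsilon> m) (\<kappa> m) (moment 1 w_in) (moment 0 w_in)
                     * (1 + 1 / t) powr ((m - 1) / \<beta>))) \<and>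
          (\<forall>m>1. \<forall>\<rho>\<^sub>0 \<rho>\<^sub>1. 0 < \<rho>\<^sub>0 \<and> \<rho>\<^sub>0 \<le> \<rho>\<^sub>1 \<longrightarrow>
             0 < \<mu> m A \<alpha> \<beta> (\<epsilon> m) (\<kappa> m) \<rho>\<^sub>1 \<rho>\<^sub>0 \<and>
             (w_in \<in> Y_space m \<and> moment 1 w_in \<le> \<rho>\<^sub>1 \<and> moment 0 w_in \<ge> \<rho>\<^sub>0 \<longrightarrow>
                (\<forall>t>0. moment m (w t)
                   \<le> max (moment m w_in) (\<mu> m A \<alpha> \<beta> (\<epsilon> m) (\<kappa> m) \<rho>\<^sub>1 \<rho>\<^sub>0)))))"
proof -
  let ?b = "\<lambda>m A \<alpha> \<beta> e k \<rho>\<^sub>1 \<rho>\<^sub>0. moment_bounds m A \<alpha> \<beta> e k \<rho>\<^sub>1 (\<rho>\<^sub>0 / 2)"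
  \<comment> \<open>The value \<open>1\<close> serves the zero initial state only.\<close>
  let ?F = "\<lambda>m A \<alpha> \<beta> e k \<rho>\<^sub>1 \<rho>\<^sub>0. if 0 < \<rho>\<^sub>0 then fst (?b m A \<alpha> \<beta> e k \<rho>\<^sub>1 \<rho>\<^sub>0) else 1 :: real"
  let ?\<mu> = "\<lambda>m A \<alpha> \<beta> e k \<rho>\<^sub>1 \<rho>\<^sub>0. snd (?b m A \<alpha> \<beta> e k \<rho>\<^sub>1 \<rho>\<^sub>0)"
  show ?thesis
  proof (rule exI[of _ ?F], rule exI[of _ ?\<mu>], intro allI impI, elim conjE)
    fix A \<alpha> \<beta> :: real and B :: "nat \<Rightarrow> nat \<Rightarrow> nat \<Rightarrow> real" and \<epsilon> \<kappa> :: "real \<Rightarrow> real"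
      and y :: "nat \<Rightarrow> real"
    assume par: "0 < A" "\<alpha> \<le> \<beta>" "\<beta> \<le> 1" "0 < \<beta>" "\<alpha> < 1"
      and B1: "daughter_B1 B" and B2: "daughter_B2 B \<epsilon> \<kappa>" and B3: "daughter_B3 B"
      and Y: "y \<in> Y_plus 1"
    have y: "0 \<le> y i" if "1 \<le> i" for i using Y that by (simp add: Y_plus_def)
    have bounds: "uniform_moment_bounds m A \<alpha> \<beta> (\<epsilon> m) (\<kappa> m) \<rho>\<^sub>1 (\<rho>\<^sub>0 / 2) (?b m A \<alpha> \<beta> (\<epsilon> m) (\<kappa> m) \<rho>\<^sub>1 \<rho>\<^sub>0)"
      if "1 < m" "0 < \<rho>\<^sub>0" for m \<rho>\<^sub>1 \<rho>\<^sub>0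
      by (rule uniform_moment_bounds) (use par that B2 in \<open>auto simp: daughter_B2_def intro: less_le_trans\<close>)
    then have \<mu>_pos: "0 < ?\<mu> m A \<alpha> \<beta> (\<epsilon> m) (\<kappa> m) \<rho>\<^sub>1 \<rho>\<^sub>0" if "1 < m" "0 < \<rho>\<^sub>0" for m \<rho>\<^sub>1 \<rho>\<^sub>0
      using that by (simp add: uniform_moment_bounds_def)
    let ?claim = "\<lambda>w.
            mass_conserving_solution (collision_kernel A \<alpha> \<beta>) B \<infinity> y w \<and>
            (\<forall>t\<ge>0. moment 0 (w t) \<ge> moment 0 y) \<and>
            (\<forall>m>1.
               0 < ?F m A \<alpha> \<beta> (\<epsilon> m) (\<kappa> m) (moment 1 y) (moment 0 y) \<and>
               (\<forall>t>0. w t \<in> Y_space m \<and>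
                  moment m (w t)
                    \<le> ?F m A \<alpha> \<beta> (\<epsilon> m) (\<kappa> m) (moment 1 y) (moment 0 y)
                       * (1 + 1 / t) powr ((m - 1) / \<beta>))) \<and>
            (\<forall>m>1. \<forall>\<rho>\<^sub>0 \<rho>\<^sub>1. 0 < \<rho>\<^sub>0 \<and> \<rho>\<^sub>0 \<le> \<rho>\<^sub>1 \<longrightarrow>
               0 < ?\<mu> m A \<alpha> \<beta> (\<epsilon> m) (\<kappa> m) \<rho>\<^sub>1 \<rho>\<^sub>0 \<and>
               (y \<in> Y_space m \<and> moment 1 y \<le> \<rho>\<^sub>1 \<and> moment 0 y \<ge> \<rho>\<^sub>0 \<longrightarrow>
                  (\<forall>t>0. moment m (w t)
                     \<le> max (moment m y) (?\<mu> m A \<alpha> \<beta> (\<epsilon> m) (\<kappa> m) \<rho>\<^sub>1 \<rho>\<^sub>0))))"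
    show "\<exists>w. ?claim w"
    proof (cases "0 < moment 0 y")
      case False
      have y0: "summable (\<lambda>i. real i powr 0 * y i)"
        by (rule summable_lower_moment[where q = 1], rule y, assumption, rule Y_space_summable)
           (use Y y in \<open>auto simp: Y_plus_def\<close>)
      have zero: "y i = 0" if "1 \<le> i" for i
      proof -
        have "sum (\<lambda>i. real i powr 0 * y i) {i} \<le> (\<Sum>i. real i powr 0 * y i)"
          by (rule sum_le_suminf[OF y0]) (use y in \<open>auto simp: not_le\<close>)
        then show ?thesis using that y[OF that] False moment_eq_suminf(2)[OF y y0] by simp
      qed
      have "?claim (\<lambda>_ _. 0)"
      proof (intro conjI allI impI)
        show "mass_conserving_solution (collision_kernel A \<alpha> \<beta>) B \<infinity> y (\<lambda>_ _. 0)"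
          by (rule mass_conserving_solution_zero[OF Y zero])
        show "moment m (\<lambda>_. 0) \<le> max (moment m y) (?\<mu> m A \<alpha> \<beta> (\<epsilon> m) (\<kappa> m) \<rho>\<^sub>1 \<rho>\<^sub>0)"
          if "1 < m" "0 < \<rho>\<^sub>0 \<and> \<rho>\<^sub>0 \<le> \<rho>\<^sub>1" for m \<rho>\<^sub>0 \<rho>\<^sub>1
          using \<mu>_pos[OF that(1), of \<rho>\<^sub>0 \<rho>\<^sub>1] that(2) by (simp add: moment_def)
      qed (use False \<mu>_pos in \<open>auto simp: moment_def Y_space_def\<close>)
      then show ?thesis by blast
    next
      case True
      show ?thesis
      proof (rule breakage_limit_exists[OF par B1 B2 B3 Y True])
        fix N v w assume lim: "breakage_limit A \<alpha> \<beta> B N v w y"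
          and M1: "\<And>n. truncated_breakage.M (N n) (v n) 1 0 \<le> moment 1 y"
          and M0: "\<And>n. moment 0 y / 2 \<le> truncated_breakage.M (N n) (v n) 0 0"
        interpret breakage_limit A \<alpha> \<beta> B N v w y by (rule lim)
        have v_bounds: "Mv n m t \<le> fst (?b m A \<alpha> \<beta> (\<epsilon> m) (\<kappa> m) \<rho>\<^sub>1 \<rho>\<^sub>0) * (1 + 1 / t) powr ((m - 1) / \<beta>) \<and>
            Mv n m t \<le> max (Mv n m 0) (?\<mu> m A \<alpha> \<beta> (\<epsilon> m) (\<kappa> m) \<rho>\<^sub>1 \<rho>\<^sub>0)"
          if "1 < m" "0 < \<rho>\<^sub>0" "moment 1 y \<le> \<rho>\<^sub>1" "\<rho>\<^sub>0 \<le> moment 0 y" "0 < t" for m \<rho>\<^sub>0 \<rho>\<^sub>1 t n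
        proof -
          have "Mv n 1 0 \<le> \<rho>\<^sub>1" "\<rho>\<^sub>0 / 2 \<le> Mv n 0 0" using M1[of n] M0[of n] that by auto
          then show ?thesis
            using bounds[OF that(1,2), of \<rho>\<^sub>1] approx[of n] daughter_B2_shatter_above[OF B2, of "N n"]
              daughter_B3_shatter_above[OF B3, of "N n"] that(5)
            unfolding uniform_moment_bounds_def by blast
        qed
        have "?claim w"
        proof (intro conjI allI impI)
          show "mass_conserving_solution (collision_kernel A \<alpha> \<beta>) B \<infinity> y w"
            by (rule mass_conserving_limit[OF Y])
          show "moment 0 y \<le> moment 0 (w t)" if "0 \<le> t" for t
            by (rule number_nondecreasing_limit[OF B3 that])
          fix m :: real assume m: "1 < m"
          show "0 < ?F m A \<alpha> \<beta> (\<epsilon> m) (\<kappa> m) (moment 1 y) (moment 0 y)"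
            using bounds[OF m True] by (simp add: uniform_moment_bounds_def)
          fix t :: real assume t: "0 < t"
          have "Mv n m t \<le> ?F m A \<alpha> \<beta> (\<epsilon> m) (\<kappa> m) (moment 1 y) (moment 0 y)
                         * (1 + 1 / t) powr ((m - 1) / \<beta>)" for n
            using v_bounds[OF m True order_refl order_refl t] True by simp
          from moment_le_limit[OF less_imp_le[OF t] this]
          show "w t \<in> Y_space m" "moment m (w t) \<le> ?F m A \<alpha> \<beta> (\<epsilon> m) (\<kappa> m) (moment 1 y) (moment 0 y)
                         * (1 + 1 / t) powr ((m - 1) / \<beta>)" .
        next
          fix m \<rho>\<^sub>0 \<rho>\<^sub>1 :: real assume m: "1 < m" and \<rho>: "0 < \<rho>\<^sub>0 \<and> \<rho>\<^sub>0 \<le> \<rho>\<^sub>1"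
          then show "0 < ?\<mu> m A \<alpha> \<beta> (\<epsilon> m) (\<kappa> m) \<rho>\<^sub>1 \<rho>\<^sub>0" by (intro \<mu>_pos) auto
          fix t :: real
          assume ym: "y \<in> Y_space m \<and> moment 1 y \<le> \<rho>\<^sub>1 \<and> \<rho>\<^sub>0 \<le> moment 0 y" and t: "0 < t"
          have ym_sum: "summable (\<lambda>i. real i powr m * y i)" by (rule Y_space_summable) (use ym y in auto)
          have "Mv n m t \<le> max (moment m y) (?\<mu> m A \<alpha> \<beta> (\<epsilon> m) (\<kappa> m) \<rho>\<^sub>1 \<rho>\<^sub>0)" for n
          proof -
            have "Mv n m 0 = (\<Sum>i=1..N n. real i powr m * y i)"
              unfolding Mv_eq by (intro sum.cong) (use init in auto)
            also have "\<dots> \<le> (\<Sum>i. real i powr m * y i)"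
              by (rule sum_le_suminf[OF ym_sum]) (use y in \<open>auto simp: not_le\<close>)
            also have "\<dots> = moment m y" using moment_eq_suminf(2)[OF y ym_sum] by simp
            finally show ?thesis using v_bounds[OF m _ _ _ t, of \<rho>\<^sub>0 \<rho>\<^sub>1 n] \<rho> ym by force
          qed
          from moment_le_limit(2)[OF less_imp_le[OF t] this]
          show "moment m (w t) \<le> max (moment m y) (?\<mu> m A \<alpha> \<beta> (\<epsilon> m) (\<kappa> m) \<rho>\<^sub>1 \<rho>\<^sub>0)" .
        qed
        then show "\<exists>w. ?claim w" by blast
      qed
    qed
  qed
qed

end
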